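(* Fix $0<\varepsilon<1/64$. For every $T>0$, the laws of $\{X^k,\mathbb P^{a^*_k},k\ge1\}$ (the random walks $X^k$ started from $a^*_k$) are C-tight in the Skorokhod space $\mathbf D([0,T],E,\rho)$ equipped with the Skorokhod topology.
   Context: C-tight means: tight, and every weak limit point is supported on the set of continuous paths. $\mathbf D([0,T],E,\rho)$ is the space of càdlàg paths $[0,T]\to(E,\rho)$. **State space $E$.** Let $B_\varepsilon$ be the closed disk in $\mathbb R^2$ centered at the origin with radius $\varepsilon$ and $D_\varepsilon:=\mathbb R^2\setminus B_\varepsilon$. Identify $B_\varepsilon$ with a single point $a^*$ and let $E:=D_\varepsilon\cup\{a^*\}\cup\mathbb R_+$, where the origin of the half line $\mathbb R_+$ is identified with $a^*$. $\rho$ is the geodesic distance on $E$: with $|x|_\rho:=\rho(x,a^* )$ (so $|x|_\rho=|x|-\varepsilon$ for $x\in D_\varepsilon$ and $|x|_\rho=|x|$ for $x\in \mathbb R_+$), $\rho(x,y)=|x-y|\wedge(|x|_\rho+|y|_\rho)$ for $x,y\in D_\varepsilon$; $\rho(x,y)=|x-y|$ for $x,y\in\mathbb R_+$; $\rho(x,y)=|x|+|y|-\varepsilon$ if one of them is in $\mathbb R_+$ and the other in $D_\varepsilon$. **Random walks $X^k$.** For $k\in\mathbb N$ let $D^k_\varepsilon:=D_\varepsilon\cap 2^{-k}\mathbb Z^2$; the vertices of $2^{-k}\mathbb Z^2$ in $B_\varepsilon$ are identified with a single point $a^*_k$. Let $E^k:=2^{-k}\mathbb Z_+\cup\{a^*_k\}\cup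 D^k_\varepsilon$, $\mathbb Z_+=\{1,2,\dots\}$; the point $0$ of the lattice $2^{-k}\mathbb Z_+\cup\{0\}$ is identified with $a^*_k$. $E^k$ is regarded as a subset of $E$, $a^*_k$ being identified with $a^*$. The graph $G^k$ has vertex set $E^k$ and the following unoriented edges (at most one per pair of vertices): between $x,y\in D^k_\varepsilon$ with $|x-y|=2^{-k}$ whose connecting lattice segment is disjoint from $B_\varepsilon$; between nearest neighbors of $2^{-k}\mathbb Z_+\cup\{0\}$; and between $x\in D^k_\varepsilon$ and $a^*_k$ whenever there is $y\in 2^{-k}\mathbb Z^2\cap B_\varepsilon$ with $|x-y|=2^{-k}$. Write $x\leftrightarrow y$ for adjacency and $v_k(x)$ for the number of vertices adjacent to $x$ in $G^k$. Let $m_k(x)=\frac{2^{-2k}}4v_k(x)$ for $x\in D^k_\varepsilon$, $m_k(x)=\frac{2^{-k}}2v_k(x)$ for $x\in2^{-k}\mathbb Z_+$, $m_k(a^*_k)=\frac{2^{-k}}2+\frac{2^{-2k}}4(v_k(a^*_k)-1)$. $X^k$ is the $m_k$-symmetric continuous-time Markov chain on $E^k$ associated with the regular Dirichlet form on $L^2(E^k,m_k)$ with domain $L^2(E^k,m_k)$ and $$\mathcal E^k(f,f)=\frac18\sum_{(x,y)}(f(x)-f(y))^2+\frac{2^k}4\sum_{(x,y)}{}'(f(x)-f(y))^2,$$ where the first sum is over oriented edges of $G^k$ with both endpoints in $D^k_\varepsilon\cup\{a^*_k\}$ and the second (primed) sum over oriented edges with both endpoints in $2^{-k}\mathbb Z_+\cup\{a^*_k\}$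 (each unoriented edge is counted twice). Equivalently, $X^k$ waits at each vertex an exponential time with parameter $2^{2k}$ and then jumps from $x\ne a^*_k$ to a uniformly chosen adjacent vertex, and from $a_k^*$ to each adjacent $y\in D^k_\varepsilon$ with probability $1/(v_k(a^*_k)+2^{k+1}-1)$ and to the adjacent $y\in2^{-k}\mathbb Z_+$ with probability $2^{k+1}/(v_k(a^*_k)+2^{k+1}-1)$. *)

theory Defs
  imports "HOL-Probability.Probability"
begin

section \<open>Tightness and weak limit points over a topology\<close>

definition borel_of :: "'a topology \<Rightarrow> 'a measure" where
  "borel_of X = sigma (topspace X) {U. openin X U}"

definition weak_conv_in :: "'a topology \<Rightarrow> (nat \<Rightarrow> 'a measure) \<Rightarrow> 'a measure \<Rightarrow> bool" where
  "weak_conv_in X N \<mu> \<longleftrightarrow>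
     (\<forall>f :: 'a \<Rightarrow> real. continuous_map X euclideanreal f \<and> (\<exists>B. \<forall>x\<in>topspace X. \<bar>f x\<bar> \<le> B) \<longrightarrow>
        (\<lambda>n. \<integral>x. f x \<partial>N n) \<longlonglongrightarrow> (\<integral>x. f x \<partial>\<mu>))"

definition tight_family :: "'a topology \<Rightarrow> 'i set \<Rightarrow> ('i \<Rightarrow> 'a measure) \<Rightarrow> bool" where
  "tight_family X I N \<longleftrightarrow>
     (\<forall>i\<in>I. prob_space (N i) \<and> sets (N i) = sets (borel_of X)) \<and>
     (\<forall>\<eta>>0. \<exists>K. compactin X K \<and> (\<forall>i\<in>I. measure (N i) K \<ge> 1 - \<eta>))"

definition weak_limit_point :: "'a topology \<Rightarrow> nat set \<Rightarrow> (nat \<Rightarrow> 'a measure) \<Rightarrow> 'a measure \<Rightarrow> bool" where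
  "weak_limit_point X I N \<mu> \<longleftrightarrow>
     prob_space \<mu> \<and> sets \<mu> = sets (borel_of X) \<and>
     (\<exists>r. strict_mono r \<and> range r \<subseteq> I \<and> weak_conv_in X (N \<circ> r) \<mu>)"


section \<open>The Skorokhod space over a metric space\<close>

text \<open>Monotone bijections of an interval are automatically continuous.\<close>

definition time_changes :: "real \<Rightarrow> (real \<Rightarrow> real) set" where
  "time_changes T = {g. strict_mono_on {0..T} g \<and> g ` {0..T} = {0..T}}"

lemma id_time_change: "(\<lambda>t. t) \<in> time_changes T"
  by (auto simp: time_changes_def strict_mono_on_def)

lemma time_change_compose:
  assumes "f \<in> time_changes T" "g \<in> time_changes T"
  shows "g \<circ> f \<in> time_changes T"
proof -
  have "f t \<in> {0..T}" if "t \<in> {0..T}" for t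
    using assms(1) that by (auto simp: time_changes_def)
  then have "strict_mono_on {0..T} (g \<circ> f)"
    using assms unfolding time_changes_def strict_mono_on_def by auto
  moreover have "(g \<circ> f) ` {0..T} = {0..T}"
    using assms unfolding time_changes_def image_comp[symmetric] by simp
  ultimately show ?thesis by (simp add: time_changes_def)
qed

lemma time_change_inverse:
  assumes f: "f \<in> time_changes T"
  obtains g where "g \<in> time_changes T" "\<And>t. t \<in> {0..T} \<Longrightarrow> f (g t) = t"
proof
  let ?g = "inv_into {0..T} f"
  have im: "f ` {0..T} = {0..T}" and mono: "strict_mono_on {0..T} f"
    using f by (auto simp: time_changes_def)
  have inj: "inj_on f {0..T}" using mono by (rule strict_mono_on_imp_inj_on)
  show fg: "f (?g t) = t" if "t \<in> {0..T}" for t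
    using that im by (simp add: f_inv_into_f)
  have gin: "?g t \<in> {0..T}" if "t \<in> {0..T}" for t
    using that im by (metis inv_into_into)
  have "?g s < ?g t" if "s \<in> {0..T}" "t \<in> {0..T}" "s < t" for s t
  proof (rule ccontr)
    assume "\<not> ?g s < ?g t"
    then have "f (?g t) \<le> f (?g s)"
      using strict_mono_onD[OF mono gin[OF that(2)] gin[OF that(1)]]
      by (cases "?g t = ?g s") auto
    then show False using fg that by auto
  qed
  then have "strict_mono_on {0..T} ?g" by (auto simp: strict_mono_on_def)
  moreover have "?g ` {0..T} = {0..T}"
    using inv_into_image_cancel[OF inj, of "{0..T}"] im by simp
  ultimately show "?g \<in> time_changes T" by (simp add: time_changes_def)
qed

context Metric_space
begin

text \<open>Paths are extensional: they take a fixed dummy value outside the interval \<open>{0..T}\<close>.\<close>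

definition cadlag_paths :: "real \<Rightarrow> (real \<Rightarrow> 'a) set" where
  "cadlag_paths T =
     {x \<in> {0..T} \<rightarrow>\<^sub>E M.
        (\<forall>t\<in>{0..<T}. limitin mtopology x (x t) (at_right t)) \<and>
        (\<forall>t\<in>{0<..T}. \<exists>l. limitin mtopology x l (at_left t))}"

definition continuous_paths :: "real \<Rightarrow> (real \<Rightarrow> 'a) set" where
  "continuous_paths T =
     {x \<in> {0..T} \<rightarrow>\<^sub>E M. continuous_map (top_of_set {0..T}) mtopology x}"

definition skorokhod_close :: "real \<Rightarrow> (real \<Rightarrow> 'a) \<Rightarrow> (real \<Rightarrow> 'a) \<Rightarrow> real \<Rightarrow> bool" where
  "skorokhod_close T x y e \<longleftrightarrow>
     (\<exists>g\<in>time_changes T. \<forall>t\<in>{0..T}. \<bar>g t - t\<bar> \<le> e \<and> d (x t) (y (g t)) \<le> e)"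

text \<open>
  The \<open>J\<^sub>1\<close> metric.  The value \<open>0\<close> off the path space only serves to meet the unrelativised
  positivity and symmetry requirements of the locale \<^locale>\<open>Metric_space\<close>.
\<close>

definition skorokhod_dist :: "real \<Rightarrow> (real \<Rightarrow> 'a) \<Rightarrow> (real \<Rightarrow> 'a) \<Rightarrow> real" where
  "skorokhod_dist T x y =
     (if x \<in> cadlag_paths T \<and> y \<in> cadlag_paths T then Inf {e. 0 < e \<and> skorokhod_close T x y e} else 0)"

definition skorokhod_topology :: "real \<Rightarrow> (real \<Rightarrow> 'a) topology" where
  "skorokhod_topology T = Metric_space.mtopology (cadlag_paths T) (skorokhod_dist T)"

definition C_tight :: "real \<Rightarrow> nat set \<Rightarrow> (nat \<Rightarrow> (real \<Rightarrow> 'a) measure) \<Rightarrow> bool" where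
  "C_tight T I N \<longleftrightarrow>
     tight_family (skorokhod_topology T) I N \<and>
     (\<forall>\<mu>. weak_limit_point (skorokhod_topology T) I N \<mu> \<longrightarrow> measure \<mu> (continuous_paths T) = 1)"

lemma cadlag_bounded:
  assumes x: "x \<in> cadlag_paths T" and c: "c \<in> M"
  obtains B where "B > 0" "\<And>t. t \<in> {0..T} \<Longrightarrow> d c (x t) \<le> B"
proof -
  have xM: "x t \<in> M" if "t \<in> {0..T}" for t
    using x that by (auto simp: cadlag_paths_def)
  have loc: "\<exists>U B. open U \<and> t \<in> U \<and> (\<forall>s\<in>U \<inter> {0..T}. d c (x s) \<le> B)" if t: "t \<in> {0..T}" for t
  proof -
    have R: "\<exists>b B. b > t \<and> (\<forall>s. t < s \<and> s < b \<and> s \<in> {0..T} \<longrightarrow> d c (x s) \<le> B)"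
    proof (cases "t < T")
      case True
      then have "limitin mtopology x (x t) (at_right t)"
        using x t by (auto simp: cadlag_paths_def)
      then have "\<forall>\<^sub>F s in at_right t. x s \<in> M \<and> d (x s) (x t) < 1"
        by (auto simp: limitin_metric)
      then obtain b where b: "b > t" "\<And>s. t < s \<Longrightarrow> s < b \<Longrightarrow> x s \<in> M \<and> d (x s) (x t) < 1"
        by (auto simp: eventually_at_right_field)
      have "d c (x s) \<le> d c (x t) + 1" if "t < s" "s < b" for s
      proof -
        have s: "x s \<in> M" "d (x s) (x t) < 1" using b(2)[OF that] by auto
        show ?thesis using triangle'[OF c xM[OF t] s(1)] s(2) by linarith
      qed
      then show ?thesis using b(1) by blast
    next
      case False
      then show ?thesis using t by (intro exI[of _ "t + 1"]) auto
    qed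
    have L: "\<exists>a B. a < t \<and> (\<forall>s. a < s \<and> s < t \<and> s \<in> {0..T} \<longrightarrow> d c (x s) \<le> B)"
    proof (cases "0 < t")
      case True
      then have "t \<in> {0<..T}" using t by auto
      then obtain l where l: "limitin mtopology x l (at_left t)"
        using x unfolding cadlag_paths_def by blast
      then have lM: "l \<in> M" by (auto simp: limitin_metric)
      from l have "\<forall>\<^sub>F s in at_left t. x s \<in> M \<and> d (x s) l < 1"
        by (auto simp: limitin_metric)
      then obtain b where b: "b < t" "\<And>s. b < s \<Longrightarrow> s < t \<Longrightarrow> x s \<in> M \<and> d (x s) l < 1"
        by (auto simp: eventually_at_left_field)
      have "d c (x s) \<le> d c l + 1" if "b < s" "s < t" for s
      proof -
        have s: "x s \<in> M" "d (x s) l < 1" using b(2)[OF that] by auto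
        show ?thesis using triangle'[OF c lM s(1)] s(2) by linarith
      qed
      then show ?thesis using b(1) by blast
    next
      case False
      then show ?thesis using t by (intro exI[of _ "t - 1"]) auto
    qed
    obtain b B where B: "b > t" "\<And>s. t < s \<Longrightarrow> s < b \<Longrightarrow> s \<in> {0..T} \<Longrightarrow> d c (x s) \<le> B"
      using R by blast
    obtain a A where A: "a < t" "\<And>s. a < s \<Longrightarrow> s < t \<Longrightarrow> s \<in> {0..T} \<Longrightarrow> d c (x s) \<le> A"
      using L by blast
    have "d c (x s) \<le> max (max A B) (d c (x t))" if "s \<in> {a<..<b} \<inter> {0..T}" for s
      using that A(2)[of s] B(2)[of s] by (cases s t rule: linorder_cases) auto
    then show ?thesis using A(1) B(1)
      by (intro exI[of _ "{a<..<b}"] exI[of _ "max (max A B) (d c (x t))"]) auto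
  qed
  then obtain U B where UB: "\<And>t. t \<in> {0..T} \<Longrightarrow> open (U t) \<and> t \<in> U t \<and> (\<forall>s\<in>U t \<inter> {0..T}. d c (x s) \<le> B t)"
    by metis
  have "compact {0..T}" by simp
  then obtain F where F: "F \<subseteq> {0..T}" "finite F" "{0..T} \<subseteq> (\<Union>t\<in>F. U t)"
    by (rule compactE_image[of _ "{0..T}" U]) (use UB in auto)
  define C where "C = Max (insert 1 (B ` F))"
  have "d c (x s) \<le> C" if s: "s \<in> {0..T}" for s
  proof -
    obtain t where t: "t \<in> F" "s \<in> U t" using F s by auto
    then have "d c (x s) \<le> B t" using UB[of t] F s by auto
    also have "B t \<le> C" using t F by (auto simp: C_def intro!: Max_ge)
    finally show ?thesis .
  qed
  moreover have "C > 0"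
    unfolding C_def using Max_ge[OF finite.insertI[OF finite_imageI[OF F(2), of B]] insertI1, of 1] by linarith
  ultimately show ?thesis using that by blast
qed

lemma skorokhod_close_sym:
  assumes "skorokhod_close T x y e"
  shows "skorokhod_close T y x e"
proof -
  obtain f where f: "f \<in> time_changes T" "\<And>t. t \<in> {0..T} \<Longrightarrow> \<bar>f t - t\<bar> \<le> e \<and> d (x t) (y (f t)) \<le> e"
    using assms by (auto simp: skorokhod_close_def)
  obtain g where g: "g \<in> time_changes T" "\<And>t. t \<in> {0..T} \<Longrightarrow> f (g t) = t"
    using time_change_inverse[OF f(1)] by blast
  have "\<bar>g t - t\<bar> \<le> e \<and> d (y t) (x (g t)) \<le> e" if t: "t \<in> {0..T}" for t
  proof -
    have "g t \<in> {0..T}" using g(1) t by (auto simp: time_changes_def)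
    from f(2)[OF this] show ?thesis using g(2)[OF t] by (simp add: commute abs_minus_commute)
  qed
  then show ?thesis using g(1) unfolding skorokhod_close_def by blast
qed

lemma skorokhod_close_trans:
  assumes M: "x \<in> {0..T} \<rightarrow> M" "y \<in> {0..T} \<rightarrow> M" "z \<in> {0..T} \<rightarrow> M"
    and xy: "skorokhod_close T x y e" and yz: "skorokhod_close T y z e'"
  shows "skorokhod_close T x z (e + e')"
proof -
  obtain f where f: "f \<in> time_changes T" "\<And>t. t \<in> {0..T} \<Longrightarrow> \<bar>f t - t\<bar> \<le> e \<and> d (x t) (y (f t)) \<le> e"
    using xy by (auto simp: skorokhod_close_def)
  obtain g where g: "g \<in> time_changes T" "\<And>t. t \<in> {0..T} \<Longrightarrow> \<bar>g t - t\<bar> \<le> e' \<and> d (y t) (z (g t)) \<le> e'"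
    using yz by (auto simp: skorokhod_close_def)
  have "\<bar>(g \<circ> f) t - t\<bar> \<le> e + e' \<and> d (x t) (z ((g \<circ> f) t)) \<le> e + e'" if t: "t \<in> {0..T}" for t
  proof -
    have ft: "f t \<in> {0..T}" using f(1) t by (auto simp: time_changes_def)
    have gft: "g (f t) \<in> {0..T}" using g(1) ft by (auto simp: time_changes_def)
    have "d (x t) (z (g (f t))) \<le> d (x t) (y (f t)) + d (y (f t)) (z (g (f t)))"
      using M t ft gft by (intro triangle) auto
    then show ?thesis using f(2)[OF t] g(2)[OF ft] by auto
  qed
  then show ?thesis using time_change_compose[OF f(1) g(1)] unfolding skorokhod_close_def by blast
qed

lemma skorokhod_close_ex:
  assumes x: "x \<in> cadlag_paths T" and y: "y \<in> cadlag_paths T"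
  shows "\<exists>e>0. skorokhod_close T x y e"
proof (cases "0 \<le> T")
  case True
  then have c: "x 0 \<in> M" using x by (auto simp: cadlag_paths_def)
  obtain A where A: "A > 0" "\<And>t. t \<in> {0..T} \<Longrightarrow> d (x 0) (x t) \<le> A"
    using cadlag_bounded[OF x c] by blast
  obtain B where B: "B > 0" "\<And>t. t \<in> {0..T} \<Longrightarrow> d (x 0) (y t) \<le> B"
    using cadlag_bounded[OF y c] by blast
  have "d (x t) (y t) \<le> A + B" if t: "t \<in> {0..T}" for t
  proof -
    have "x t \<in> M" "y t \<in> M" using x y t by (auto simp: cadlag_paths_def)
    from triangle''[OF this(1) c this(2)] show ?thesis
      using triangle[OF \<open>x t \<in> M\<close> c \<open>y t \<in> M\<close>] A(2)[OF t] B(2)[OF t] by (simp add: commute)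
  qed
  then have "skorokhod_close T x y (A + B)"
    unfolding skorokhod_close_def using id_time_change A(1) B(1) by (intro bexI[of _ "\<lambda>t. t"]) auto
  then show ?thesis using A(1) B(1) by (intro exI[of _ "A + B"]) auto
next
  case False
  then show ?thesis using id_time_change
    by (intro exI[of _ 1]) (auto simp: skorokhod_close_def)
qed

lemma skorokhod_close_zero:
  assumes x: "x \<in> cadlag_paths T" and y: "y \<in> cadlag_paths T"
    and close: "\<And>e. e > 0 \<Longrightarrow> skorokhod_close T x y e"
  shows "x = y"
proof -
  have xM: "x t \<in> M" and yM: "y t \<in> M" if "t \<in> {0..T}" for t
    using x y that by (auto simp: cadlag_paths_def)
  have near: "d (x t) (y t) < r"
    if t: "t \<in> {0..<T}" and r: "r > 0" for t r
  proof -
    have "limitin mtopology x (x t) (at_right t)" "limitin mtopology y (y t) (at_right t)"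
      using x y t by (auto simp: cadlag_paths_def)
    then have "\<forall>\<^sub>F s in at_right t. d (x s) (x t) < r/4" "\<forall>\<^sub>F s in at_right t. d (y s) (y t) < r/4"
      using r unfolding limitin_metric by (auto elim!: allE[of _ "r/4"] elim: eventually_mono)
    then have "\<forall>\<^sub>F s in at_right t. d (x s) (x t) < r/4 \<and> d (y s) (y t) < r/4"
      by (rule eventually_conj)
    then obtain b where b: "b > t" "\<And>s. t < s \<Longrightarrow> s < b \<Longrightarrow> d (x s) (x t) < r/4 \<and> d (y s) (y t) < r/4"
      by (auto simp: eventually_at_right_field)
    define c where "c = min b T"
    define s where "s = (t + c) / 2"
    have c: "t < c" using b t by (auto simp: c_def)
    have s: "t < s" "s < c" "s \<in> {0..T}" "s < b" using c t by (auto simp: s_def c_def)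
    define e where "e = min (r/4) ((c - t) / 4)"
    have e: "e > 0" "e \<le> r/4" "e \<le> (c - t)/4" using r c unfolding e_def min_def by auto
    obtain f where f: "f \<in> time_changes T" "\<And>u. u \<in> {0..T} \<Longrightarrow> \<bar>f u - u\<bar> \<le> e \<and> d (x u) (y (f u)) \<le> e"
      using close[OF e(1)] by (auto simp: skorokhod_close_def)
    have fs: "f s \<in> {0..T}" using f(1) s by (auto simp: time_changes_def)
    have "\<bar>f s - s\<bar> \<le> (c - t)/4" using f(2)[OF s(3)] e by linarith
    then have fs2: "t < f s" "f s < c" using c by (auto simp: s_def abs_if field_simps split: if_splits)
    then have "f s < b" by (auto simp: c_def)
    then have 1: "d (y (f s)) (y t) < r/4" using b fs2 by auto
    have 2: "d (x s) (x t) < r/4" using b s by auto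
    have 3: "d (x s) (y (f s)) \<le> r/4" using f(2)[OF s(3)] e by linarith
    have t': "t \<in> {0..T}" using t by auto
    have "d (x t) (y t) \<le> d (x t) (x s) + d (x s) (y t)"
      using xM yM t' s(3) by (intro triangle) auto
    also have "d (x s) (y t) \<le> d (x s) (y (f s)) + d (y (f s)) (y t)"
      using xM yM t' s(3) fs by (intro triangle) auto
    finally show ?thesis using 1 2 3 r by (simp add: commute)
  qed
  have eq: "x t = y t" if t: "t \<in> {0..<T}" for t
  proof (rule ccontr)
    assume "x t \<noteq> y t"
    moreover have "x t \<in> M" "y t \<in> M" using xM yM t by auto
    ultimately have "d (x t) (y t) > 0" by simp
    from near[OF t this] show False by simp
  qed
  have eqT: "x T = y T" if "0 \<le> T"
  proof (rule ccontr)
    assume ne: "x T \<noteq> y T"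
    have T: "T \<in> {0..T}" using that by simp
    have pos: "d (x T) (y T) > 0" using ne xM[OF T] yM[OF T] by simp
    obtain f where f: "f \<in> time_changes T"
      "\<And>u. u \<in> {0..T} \<Longrightarrow> \<bar>f u - u\<bar> \<le> d (x T) (y T) / 2 \<and> d (x u) (y (f u)) \<le> d (x T) (y T) / 2"
      using close[of "d (x T) (y T) / 2"] pos by (auto simp: skorokhod_close_def)
    have "T \<in> f ` {0..T}" using f(1) T by (auto simp: time_changes_def)
    then obtain u where u: "u \<in> {0..T}" "f u = T" by auto
    have "f T \<in> {0..T}" using f(1) T unfolding time_changes_def by blast
    have "u = T"
    proof (rule ccontr)
      assume "u \<noteq> T"
      then have "f u < f T" using f(1) u T by (auto simp: time_changes_def strict_mono_on_def)
      then show False using u \<open>f T \<in> {0..T}\<close> by auto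
    qed
    then show False using f(2)[OF T] u pos by auto
  qed
  show ?thesis
  proof
    fix t
    show "x t = y t"
    proof (cases "t \<in> {0..T}")
      case True
      then show ?thesis using eq[of t] eqT by (cases "t = T") auto
    next
      case False
      then show ?thesis using x y by (auto simp: cadlag_paths_def PiE_def extensional_def)
    qed
  qed
qed

lemma skorokhod_close_mono:
  "skorokhod_close T x y e \<Longrightarrow> e \<le> e' \<Longrightarrow> skorokhod_close T x y e'"
  unfolding skorokhod_close_def by (meson order_trans)

lemma skorokhod_dist_less_iff:
  assumes x: "x \<in> cadlag_paths T" and y: "y \<in> cadlag_paths T"
  shows "skorokhod_dist T x y < r \<longleftrightarrow> (\<exists>e. 0 < e \<and> e < r \<and> skorokhod_close T x y e)"
proof -
  let ?S = "{e. 0 < e \<and> skorokhod_close T x y e}"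
  have "?S \<noteq> {}" "bdd_below ?S"
    using skorokhod_close_ex[OF x y] by (auto intro: bdd_belowI[of _ 0])
  then show ?thesis using x y by (auto simp: skorokhod_dist_def cInf_less_iff)
qed

lemma Metric_space_skorokhod: "Metric_space (cadlag_paths T) (skorokhod_dist T)"
proof
  show nn: "0 \<le> skorokhod_dist T x y" for x y
  proof (cases "x \<in> cadlag_paths T \<and> y \<in> cadlag_paths T")
    case True
    then have "\<not> skorokhod_dist T x y < 0" by (auto simp: skorokhod_dist_less_iff)
    then show ?thesis by simp
  qed (auto simp: skorokhod_dist_def)
  have "skorokhod_close T x y = skorokhod_close T y x" for x y
    using skorokhod_close_sym by blast
  then show "skorokhod_dist T x y = skorokhod_dist T y x" for x y
    unfolding skorokhod_dist_def by metis
  show "skorokhod_dist T x y = 0 \<longleftrightarrow> x = y" if x: "x \<in> cadlag_paths T" and y: "y \<in> cadlag_paths T" for x y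
  proof
    assume 0: "skorokhod_dist T x y = 0"
    show "x = y"
    proof (rule skorokhod_close_zero[OF x y])
      fix e :: real assume "e > 0"
      then have "skorokhod_dist T x y < e" using 0 by simp
      then show "skorokhod_close T x y e"
        using skorokhod_dist_less_iff[OF x y] skorokhod_close_mono by (meson less_imp_le)
    qed
  next
    assume xy: "x = y"
    have "skorokhod_dist T x y < e" if "e > 0" for e
    proof -
      have "skorokhod_close T x y (e/2)"
        unfolding skorokhod_close_def xy using id_time_change that y
        by (intro bexI[of _ "\<lambda>t. t"]) (auto simp: cadlag_paths_def PiE_def Pi_def)
      then show ?thesis using that skorokhod_dist_less_iff[OF x y] by (auto intro!: exI[of _ "e/2"])
    qed
    then show "skorokhod_dist T x y = 0" using nn[of x y] by (metis less_irrefl order_le_less)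
  qed
  show "skorokhod_dist T x z \<le> skorokhod_dist T x y + skorokhod_dist T y z"
    if x: "x \<in> cadlag_paths T" and y: "y \<in> cadlag_paths T" and z: "z \<in> cadlag_paths T" for x y z
  proof (rule field_le_epsilon)
    fix r :: real assume r: "r > 0"
    have "skorokhod_dist T x y < skorokhod_dist T x y + r/2"
      and "skorokhod_dist T y z < skorokhod_dist T y z + r/2" using r by auto
    then obtain e e' where e: "0 < e" "e < skorokhod_dist T x y + r/2" "skorokhod_close T x y e"
      and e': "0 < e'" "e' < skorokhod_dist T y z + r/2" "skorokhod_close T y z e'"
      using skorokhod_dist_less_iff[OF x y] skorokhod_dist_less_iff[OF y z] by blast
    have "skorokhod_close T x z (e + e')"
      by (rule skorokhod_close_trans[OF _ _ _ e(3) e'(3)]) (use x y z in \<open>auto simp: cadlag_paths_def\<close>)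
    moreover have "0 < e + e'" "e + e' < skorokhod_dist T x y + skorokhod_dist T y z + r"
      using e e' by auto
    ultimately have "skorokhod_dist T x z < skorokhod_dist T x y + skorokhod_dist T y z + r"
      using skorokhod_dist_less_iff[OF x z] by blast
    then show "skorokhod_dist T x z \<le> skorokhod_dist T x y + skorokhod_dist T y z + r" by simp
  qed
qed

end


section \<open>The state space of varying dimension\<close>

text \<open>
  \<open>Star\<close> is \<open>a\<^sup>*\<close>, that is, the collapsed disk and also the origin of the half line;
  \<open>Plane z\<close> is a point of the plane outside the disk, \<open>Line r\<close> a point \<open>r > 0\<close> of the half line.
\<close>

datatype point = Star | Plane "real ^ 2" | Line real

definition E_space :: "real \<Rightarrow> point set" where
  "E_space \<epsilon> = {Star} \<union> Plane ` (- cball 0 \<epsilon>) \<union> Line ` {0<..}"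

text \<open>
  On \<open>E_space \<epsilon>\<close> the absolute values are superfluous; they only make the distance nonnegative
  on the whole type, as the locale \<^locale>\<open>Metric_space\<close> demands.
\<close>

fun rad :: "real \<Rightarrow> point \<Rightarrow> real" where
  "rad \<epsilon> Star = 0"
| "rad \<epsilon> (Plane z) = \<bar>norm z - \<epsilon>\<bar>"
| "rad \<epsilon> (Line r) = \<bar>r\<bar>"

fun rho :: "real \<Rightarrow> point \<Rightarrow> point \<Rightarrow> real" where
  "rho \<epsilon> (Plane z) (Plane w) = min (norm (z - w)) (rad \<epsilon> (Plane z) + rad \<epsilon> (Plane w))"
| "rho \<epsilon> (Line r) (Line s) = \<bar>r - s\<bar>"
| "rho \<epsilon> x y = rad \<epsilon> x + rad \<epsilon> y"

lemma Metric_space_E: "Metric_space (E_space \<epsilon>) (rho \<epsilon>)"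
proof
  fix x y z
  show "0 \<le> rho \<epsilon> x y" by (cases x; cases y) auto
  show "rho \<epsilon> x y = rho \<epsilon> y x" by (cases x; cases y) (auto simp: norm_minus_commute)
  show "rho \<epsilon> x y = 0 \<longleftrightarrow> x = y" if "x \<in> E_space \<epsilon>" "y \<in> E_space \<epsilon>"
    using that by (cases x; cases y) (auto simp: E_space_def min_def)
  have n: "\<bar>norm u - norm v\<bar> \<le> norm (u - v)" "norm (u - v) \<le> norm (u - w) + norm (w - v)"
    for u v w :: "real ^ 2"
    using norm_triangle_ineq3[of u v] norm_triangle_ineq[of "u - w" "w - v"] by simp_all
  show "rho \<epsilon> x z \<le> rho \<epsilon> x y + rho \<epsilon> y z"
    if "x \<in> E_space \<epsilon>" "y \<in> E_space \<epsilon>" "z \<in> E_space \<epsilon>"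
    apply (cases x; cases y; cases z)
    using that n by (auto simp: E_space_def) (smt (verit) n)+
qed


section \<open>The lattice graph, speed measure and Dirichlet form\<close>

definition mesh :: "nat \<Rightarrow> real" where
  "mesh k = 1 / 2 ^ k"

definition lattice :: "nat \<Rightarrow> (real ^ 2) set" where
  "lattice k = {z. \<forall>i. \<exists>n::int. z $ i = of_int n * mesh k}"

definition plane_vertices :: "real \<Rightarrow> nat \<Rightarrow> point set" where
  "plane_vertices \<epsilon> k = Plane ` (lattice k - cball 0 \<epsilon>)"

definition line_vertices :: "nat \<Rightarrow> point set" where
  "line_vertices k = {Line (real n * mesh k) | n::nat. n \<ge> 1}"

definition vertices :: "real \<Rightarrow> nat \<Rightarrow> point set" where
  "vertices \<epsilon> k = {Star} \<union> plane_vertices \<epsilon> k \<union> line_vertices k"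

text \<open>Each unoriented edge is listed here in one or both orientations; \<open>adjacent\<close> symmetrises.\<close>

inductive edge :: "real \<Rightarrow> nat \<Rightarrow> point \<Rightarrow> point \<Rightarrow> bool" for \<epsilon> k where
  plane_plane: "\<lbrakk>u \<in> lattice k - cball 0 \<epsilon>; v \<in> lattice k - cball 0 \<epsilon>; norm (u - v) = mesh k;
      closed_segment u v \<inter> cball 0 \<epsilon> = {}\<rbrakk> \<Longrightarrow> edge \<epsilon> k (Plane u) (Plane v)"
| plane_star: "\<lbrakk>u \<in> lattice k - cball 0 \<epsilon>; v \<in> lattice k \<inter> cball 0 \<epsilon>; norm (u - v) = mesh k\<rbrakk>
      \<Longrightarrow> edge \<epsilon> k (Plane u) Star"
| line_star: "edge \<epsilon> k (Line (mesh k)) Star"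
| line_line: "n \<ge> 1 \<Longrightarrow> edge \<epsilon> k (Line (real n * mesh k)) (Line (real (n + 1) * mesh k))"

definition adjacent :: "real \<Rightarrow> nat \<Rightarrow> point \<Rightarrow> point \<Rightarrow> bool" where
  "adjacent \<epsilon> k x y \<longleftrightarrow> edge \<epsilon> k x y \<or> edge \<epsilon> k y x"

definition deg :: "real \<Rightarrow> nat \<Rightarrow> point \<Rightarrow> nat" where
  "deg \<epsilon> k x = card {y. adjacent \<epsilon> k x y}"

fun mass :: "real \<Rightarrow> nat \<Rightarrow> point \<Rightarrow> real" where
  "mass \<epsilon> k (Plane z) = mesh k ^ 2 / 4 * real (deg \<epsilon> k (Plane z))"
| "mass \<epsilon> k (Line r) = mesh k / 2 * real (deg \<epsilon> k (Line r))"
| "mass \<epsilon> k Star = mesh k / 2 + mesh k ^ 2 / 4 * (real (deg \<epsilon> k Star) - 1)"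

definition speed :: "real \<Rightarrow> nat \<Rightarrow> point measure" where
  "speed \<epsilon> k = point_measure (vertices \<epsilon> k) (\<lambda>x. ennreal (mass \<epsilon> k x))"

definition oriented_edges :: "real \<Rightarrow> nat \<Rightarrow> point set \<Rightarrow> (point \<times> point) set" where
  "oriented_edges \<epsilon> k V = {(x, y). x \<in> V \<and> y \<in> V \<and> adjacent \<epsilon> k x y}"

definition energy :: "real \<Rightarrow> nat \<Rightarrow> (point \<Rightarrow> real) \<Rightarrow> real" where
  "energy \<epsilon> k f =
     1 / 8 * (\<Sum>\<^sub>\<infinity>(x, y)\<in>oriented_edges \<epsilon> k (plane_vertices \<epsilon> k \<union> {Star}). (f x - f y)\<^sup>2)
     + 2 ^ k / 4 * (\<Sum>\<^sub>\<infinity>(x, y)\<in>oriented_edges \<epsilon> k (line_vertices k \<union> {Star}). (f x - f y)\<^sup>2)"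


section \<open>The random walks\<close>

text \<open>
  \<open>K t x\<close> is the law at time \<open>t\<close> of the chain started at \<open>x\<close>.  The last clause says that
  the Dirichlet form of the semigroup, \<open>lim (f - P\<^sub>t f, f) / t\<close> as \<open>t\<close> decreases to \<open>0\<close>,
  has domain all of \<open>L\<^sup>2\<close> of the speed measure and equals \<^const>\<open>energy\<close> there.
\<close>

definition walk_semigroup :: "real \<Rightarrow> nat \<Rightarrow> (real \<Rightarrow> point \<Rightarrow> point pmf) \<Rightarrow> bool" where
  "walk_semigroup \<epsilon> k K \<longleftrightarrow>
     (\<forall>x\<in>vertices \<epsilon> k. K 0 x = return_pmf x) \<and>
     (\<forall>t\<ge>0. \<forall>x\<in>vertices \<epsilon> k. set_pmf (K t x) \<subseteq> vertices \<epsilon> k) \<and>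
     (\<forall>s\<ge>0. \<forall>t\<ge>0. \<forall>x\<in>vertices \<epsilon> k. K (s + t) x = bind_pmf (K s x) (K t)) \<and>
     (\<forall>t\<ge>0. \<forall>x\<in>vertices \<epsilon> k. \<forall>y\<in>vertices \<epsilon> k.
        mass \<epsilon> k x * pmf (K t x) y = mass \<epsilon> k y * pmf (K t y) x) \<and>
     (\<forall>f. integrable (speed \<epsilon> k) (\<lambda>x. (f x)\<^sup>2) \<longrightarrow>
        ((\<lambda>t. (\<integral>x. (f x - measure_pmf.expectation (K t x) f) * f x \<partial>speed \<epsilon> k) / t)
           \<longlongrightarrow> energy \<epsilon> k f) (at_right 0))"

primrec path_prob ::
  "(real \<Rightarrow> point \<Rightarrow> point pmf) \<Rightarrow> real \<Rightarrow> point \<Rightarrow> (real \<times> point) list \<Rightarrow> real" where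
  "path_prob K s x [] = 1"
| "path_prob K s x (p # ps) = pmf (K (fst p - s) x) (snd p) * path_prob K (fst p) (snd p) ps"

definition random_walk :: "real \<Rightarrow> nat \<Rightarrow> 'w measure \<Rightarrow> (real \<Rightarrow> 'w \<Rightarrow> point) \<Rightarrow> bool" where
  "random_walk \<epsilon> k P X \<longleftrightarrow>
     prob_space P \<and>
     (\<forall>t\<ge>0. X t \<in> measurable P (count_space (vertices \<epsilon> k))) \<and>
     (\<forall>\<omega>\<in>space P. \<forall>T>0.
        restrict (\<lambda>t. X t \<omega>) {0..T} \<in> Metric_space.cadlag_paths (E_space \<epsilon>) (rho \<epsilon>) T) \<and>
     (\<exists>K. walk_semigroup \<epsilon> k K \<and>
        (\<forall>ts xs. length ts = length xs \<and> sorted (0 # ts) \<longrightarrow>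
           measure P {\<omega> \<in> space P. \<forall>i<length ts. X (ts ! i) \<omega> = xs ! i}
             = path_prob K 0 Star (zip ts xs)))"

definition path_law ::
  "real \<Rightarrow> real \<Rightarrow> 'w measure \<Rightarrow> (real \<Rightarrow> 'w \<Rightarrow> point) \<Rightarrow> (real \<Rightarrow> point) measure" where
  "path_law \<epsilon> T P X =
     distr P (borel_of (Metric_space.skorokhod_topology (E_space \<epsilon>) (rho \<epsilon>) T))
       (\<lambda>\<omega>. restrict (\<lambda>t. X t \<omega>) {0..T})"

end

theory Submission
  imports Defs "HOL-Library.Diagonal_Subsequence"
begin

text \<open>
  C-tightness follows from tightness of each single law together with a modulus of continuity that is
  uniform for large \<open>k\<close>.  For fixed \<open>k\<close> the paths are step functions with values in a uniformly discrete
  countable set, and bi-Lipschitz reparametrisations of one step path form a compact set.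

  For the modulus, the disk and the graph near \<open>Star\<close> play no role: to move by a macroscopic
  distance the walk has to cross an annulus, a ball of the plane or an interval of the half line in which it
  is a simple random walk.  Test functions supported there have a bounded generator, so such a crossing
  before time \<open>t\<close> has probability \<open>O(t)\<close>; having to cross two such regions one after the other gives
  \<open>O(t\<^sup>2)\<close>, uniformly in the starting point and in large \<open>k\<close>.  Ottaviani's inequality turns
  this into a bound for the oscillation over \<open>[i T/m, (i+1) T/m]\<close>, and the \<open>m\<close> exceptional events have total
  probability \<open>O(1/m)\<close>.
\<close>

section \<open>Equicontinuous families of paths\<close>

context Metric_space
begin

text \<open>The order \<open>O(t\<^sup>2)\<close> is dictated by the partition of
  \<open>{0..T}\<close>: with a bound of order \<open>t\<close> for each of the \<open>m\<close>
  intervals the total would not become small. The test functions are squares of a truncated squared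
  distance. Under simple random walk the squared distance has constant drift, and squaring its
  positive part removes a kink at which the generator would be of order \<open>1 / mesh k\<close>.
  The Dirichlet form describes the semigroup only by limits of quadratic forms; indicators of one
  and two points turn these into jump rates, and from there on all generator estimates are
  one-sided. The total jump rate \<open>4 ^ k\<close> grows with \<open>k\<close>, but it serves
  only to dominate limits for fixed \<open>k\<close> and enters no final constant. On the side of
  the paths the obstacle is that a walk with jumps has no modulus of continuity at fine scales. The
  classes of paths used therefore demand only the scales that are admissible for the given
  \<open>k\<close>, and they approach a compact class of continuous paths. They need not be compact
  themselves, and as \<open>skorokhod_dist\<close> is not complete in general, compact sets for
  single laws are constructed explicitly.\<close>

lemma continuous_paths_iff:
  "x \<in> continuous_paths T \<longleftrightarrow> x \<in> {0..T} \<rightarrow>\<^sub>E M \<and>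
     (\<forall>t\<in>{0..T}. \<forall>e>0. \<exists>\<delta>>0. \<forall>s\<in>{0..T}. \<bar>s - t\<bar> < \<delta> \<longrightarrow> d (x t) (x s) < e)"
proof (cases "x \<in> {0..T} \<rightarrow>\<^sub>E M")
  case True
  then have xM: "x t \<in> M" if "t \<in> {0..T}" for t using that by auto
  have "(\<exists>U. openin (top_of_set {0..T}) U \<and> t \<in> U \<and> (\<forall>s\<in>U. x s \<in> mball (x t) e)) \<longleftrightarrow>
        (\<exists>\<delta>>0. \<forall>s\<in>{0..T}. \<bar>s - t\<bar> < \<delta> \<longrightarrow> d (x t) (x s) < e)" (is "?L = ?R")
    if t: "t \<in> {0..T}" for t e
  proof
    assume ?L
    then obtain V where V: "open V" "t \<in> V" "\<forall>s\<in>{0..T} \<inter> V. x s \<in> mball (x t) e"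
      unfolding openin_open by auto
    then obtain \<delta> where "\<delta> > 0" "\<forall>y. dist y t < \<delta> \<longrightarrow> y \<in> V" by (meson open_dist)
    then show ?R using V by (intro exI[of _ \<delta>]) (auto simp: dist_real_def)
  next
    assume ?R
    then obtain \<delta> where \<delta>: "\<delta> > 0" "\<forall>s\<in>{0..T}. \<bar>s - t\<bar> < \<delta> \<longrightarrow> d (x t) (x s) < e" by auto
    have "openin (top_of_set {0..T}) ({0..T} \<inter> ball t \<delta>)" by auto
    moreover have "t \<in> {0..T} \<inter> ball t \<delta>" using \<delta> t by auto
    moreover have "x s \<in> mball (x t) e" if "s \<in> {0..T} \<inter> ball t \<delta>" for s
      using that \<delta> xM t by (auto simp: dist_real_def abs_minus_commute)
    ultimately show ?L by blast
  qed
  then show ?thesis using True unfolding continuous_paths_def continuous_map_to_metric by auto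
qed (auto simp: continuous_paths_def)

lemma continuous_paths_subset_cadlag: "continuous_paths T \<subseteq> cadlag_paths T"
proof
  fix x assume "x \<in> continuous_paths T"
  then have x: "x \<in> {0..T} \<rightarrow>\<^sub>E M"
    and c: "\<And>t e. t\<in>{0..T} \<Longrightarrow> e>0 \<Longrightarrow> \<exists>\<delta>>0. \<forall>s\<in>{0..T}. \<bar>s - t\<bar> < \<delta> \<longrightarrow> d (x t) (x s) < e"
    unfolding continuous_paths_iff by auto
  have xM: "x t \<in> M" if "t \<in> {0..T}" for t using that x by auto
  have "limitin mtopology x (x t) (at t within S)" if t: "t \<in> {0..T}" and S: "\<forall>\<^sub>F s in at t within S. s \<in> {0..T}" for t S
    unfolding limitin_metric
  proof (intro conjI allI impI)
    show "x t \<in> M" using xM t .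
    fix e :: real assume "e > 0"
    then obtain \<delta> where \<delta>: "\<delta> > 0" "\<forall>s\<in>{0..T}. \<bar>s - t\<bar> < \<delta> \<longrightarrow> d (x t) (x s) < e" using c t by meson
    have "\<forall>\<^sub>F s in at t within S. dist s t < \<delta>" using \<delta>(1) by (auto simp: eventually_at)
    with S show "\<forall>\<^sub>F s in at t within S. x s \<in> M \<and> d (x s) (x t) < e"
      by eventually_elim (use \<delta> xM commute in \<open>auto simp: dist_real_def\<close>)
  qed
  moreover have "\<forall>\<^sub>F s in at_right t. s \<in> {0..T}" if "t \<in> {0..<T}" for t
    using that by (auto simp: eventually_at_right_field intro!: exI[of _ T])
  moreover have "\<forall>\<^sub>F s in at_left t. s \<in> {0..T}" if "t \<in> {0<..T}" for t
    using that by (auto simp: eventually_at_left_field intro!: exI[of _ 0])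
  ultimately have "\<And>t. t \<in> {0..<T} \<Longrightarrow> limitin mtopology x (x t) (at_right t)"
    "\<And>t. t \<in> {0<..T} \<Longrightarrow> limitin mtopology x (x t) (at_left t)" by auto
  with x show "x \<in> cadlag_paths T" unfolding cadlag_paths_def by blast
qed

text \<open>Going back from \<open>t\<close> to 0 takes at most \<open>i\<close> steps of length
  \<open>\<delta>\<close>, each worth at most 1. This traps the paths in one compact ball.\<close>

lemma bounded_of_modulus:
  assumes x: "\<And>t. t \<in> {0..T} \<Longrightarrow> x t \<in> M" and "\<delta> > 0"
    and mod: "\<And>s t. s \<in> {0..T} \<Longrightarrow> t \<in> {0..T} \<Longrightarrow> \<bar>s - t\<bar> \<le> \<delta> \<Longrightarrow> d (x s) (x t) \<le> 1"
    and t: "t \<in> {0..T}" "t \<le> real i * \<delta>"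
  shows "d (x 0) (x t) \<le> real i"
  using t
proof (induction i arbitrary: t)
  case 0
  then have "t = 0" by auto
  then show ?case using mod[of t t] 0 x[of t] by simp
next
  case (Suc i)
  define s where "s = max 0 (t - \<delta>)"
  have s: "s \<in> {0..T}" "s \<le> real i * \<delta>" "\<bar>s - t\<bar> \<le> \<delta>"
    using Suc.prems \<open>\<delta> > 0\<close> by (auto simp: s_def algebra_simps)
  have "d (x 0) (x t) \<le> d (x 0) (x s) + d (x s) (x t)"
    using Suc.prems s by (intro triangle x) auto
  then show ?case using Suc.IH[OF s(1,2)] mod[OF s(1) Suc.prems(1) s(3)] by simp
qed

text \<open>The \<open>x n\<close> themselves may jump: each \<open>e\<close> is met only from some
  index on, which suffices because a limit sees only the tail. The proof is the diagonal argument,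
  with compact balls in place of completeness of \<open>M\<close>.\<close>

lemma asymptotic_Arzela_Ascoli:
  fixes x :: "nat \<Rightarrow> real \<Rightarrow> 'a"
  assumes T: "0 < T" and proper: "\<And>a B. compactin mtopology (mcball a B)"
    and c: "c \<in> M" "\<And>n. x n 0 = c" and xM: "\<And>n t. t \<in> {0..T} \<Longrightarrow> x n t \<in> M"
    and mod: "\<And>e. e > 0 \<Longrightarrow> \<exists>\<delta>>0. \<exists>N. \<forall>n\<ge>N. \<forall>s\<in>{0..T}. \<forall>t\<in>{0..T}. \<bar>s - t\<bar> \<le> \<delta> \<longrightarrow> d (x n s) (x n t) \<le> e"
  obtains r :: "nat \<Rightarrow> nat" and y where "strict_mono r" "y \<in> continuous_paths T"
    "\<And>e. e > 0 \<Longrightarrow> \<exists>N. \<forall>n\<ge>N. \<forall>t\<in>{0..T}. d (x (r n) t) (y t) \<le> e"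
proof -
  obtain \<delta>1 N1 where d1: "\<delta>1 > 0" "\<And>n s t. n \<ge> N1 \<Longrightarrow> s \<in> {0..T} \<Longrightarrow> t \<in> {0..T} \<Longrightarrow> \<bar>s - t\<bar> \<le> \<delta>1 \<Longrightarrow> d (x n s) (x n t) \<le> 1"
    using mod[of 1] zero_less_one by blast
  obtain i where i: "T \<le> real i * \<delta>1" using d1(1) ex_less_of_nat_mult[of \<delta>1 T] by (meson less_imp_le)
  have bd: "x n t \<in> mcball c (real i)" if "n \<ge> N1" "t \<in> {0..T}" for n t
  proof -
    have "d (x n 0) (x n t) \<le> real i"
      by (rule bounded_of_modulus[of T "x n" \<delta>1]) (use that i d1 xM in auto)
    then show ?thesis using c xM that by simp
  qed
  \<comment> \<open>The points of all uniform grids of \<open>{0..T}\<close>: whatever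
    \<open>\<delta>\<close> a given \<open>e\<close> requires, a finite grid of that spacing lies in
    \<open>D\<close>.\<close>
  define D where "D = (\<lambda>(i,m). T * real i / real m) ` {(i,m::nat). i \<le> m \<and> m > 0}"
  define q where "q = from_nat_into D"
  have D: "D \<subseteq> {0..T}"
    using T by (auto simp: D_def field_simps)
  have Dne: "D \<noteq> {}" "countable D" by (auto simp: D_def)
  have q: "q j \<in> D" for j unfolding q_def using Dne by (simp add: from_nat_into)
  \<comment> \<open>The shift by \<open>N1\<close> skips the indices for which \<open>bd\<close>
    provides no compact ball.\<close>
  define P where "P j s \<longleftrightarrow> (\<exists>l. limitin mtopology (\<lambda>n. x (s n + N1) (q j)) l sequentially)" for j s
  interpret subseqs P
  proof
    fix j and s :: "nat \<Rightarrow> nat" assume "strict_mono s"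
    have "range (\<lambda>n. x (s n + N1) (q j)) \<subseteq> mcball c (real i)"
    proof (rule image_subsetI)
      fix n show "x (s n + N1) (q j) \<in> mcball c (real i)" by (rule bd) (use q[of j] D in auto)
    qed
    with proper[of c "real i"] obtain l r where "strict_mono r"
      "limitin mtopology ((\<lambda>n. x (s n + N1) (q j)) \<circ> r) l sequentially"
      unfolding compactin_sequentially by blast
    then show "\<exists>r'. strict_mono r' \<and> P j (s \<circ> r')" by (auto simp: P_def o_def)
  qed
  define r where "r n = diagseq n + N1" for n
  have r: "strict_mono r" using subseq_diagseq by (auto simp: r_def strict_mono_def)
  have rN: "r n \<ge> n" "r n \<ge> N1" for n using seq_suble[OF subseq_diagseq, of n] by (auto simp: r_def)
  have conv: "\<exists>l. limitin mtopology (\<lambda>n. x (r n) p) l sequentially" if p: "p \<in> D" for p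
  proof -
    obtain j where j: "q j = p" using from_nat_into_surj[OF Dne(2) p] by (auto simp: q_def)
    have "P j (diagseq \<circ> ((+) (Suc j)))"
    proof (rule diagseq_holds)
      fix r s n assume "strict_mono (r::nat\<Rightarrow>nat)" "P n s"
      then show "P n (s \<circ> r)" unfolding P_def
        using limitin_subsequence[of r mtopology] by (fastforce simp: o_def)
    qed
    then obtain l where "limitin mtopology (\<lambda>n. x (r (n + Suc j)) p) l sequentially"
      by (auto simp: P_def r_def j o_def add.commute)
    then have "limitin mtopology (\<lambda>n. x (r n) p) l sequentially"
      by (rule limitin_sequentially_offset_rev)
    then show ?thesis by blast
  qed
  have cauchyD: "\<exists>N. \<forall>m\<ge>N. \<forall>n\<ge>N. d (x (r m) p) (x (r n) p) < e" if p: "p \<in> D" and e: "e > 0" for p e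
  proof -
    obtain l where l: "limitin mtopology (\<lambda>n. x (r n) p) l sequentially" using conv p by blast
    then obtain N where N: "\<And>n. n \<ge> N \<Longrightarrow> x (r n) p \<in> M \<and> d (x (r n) p) l < e/2" "l \<in> M"
      using e unfolding limitin_metric eventually_sequentially by (metis half_gt_zero)
    have "d (x (r m) p) (x (r n) p) < e" if "m \<ge> N" "n \<ge> N" for m n
      using triangle[of "x (r m) p" l "x (r n) p"] N that commute[of l "x (r n) p"] by (smt (verit) field_sum_of_halves)
    then show ?thesis by blast
  qed
  have cauchy: "\<exists>N. \<forall>m\<ge>N. \<forall>n\<ge>N. \<forall>t\<in>{0..T}. d (x (r m) t) (x (r n) t) \<le> e" if e: "e > 0" for e
  proof -
    obtain \<delta> N where d: "\<delta> > 0" "\<And>n s t. n \<ge> N \<Longrightarrow> s \<in> {0..T} \<Longrightarrow> t \<in> {0..T} \<Longrightarrow> \<bar>s - t\<bar> \<le> \<delta> \<Longrightarrow> d (x n s) (x n t) \<le> e/3"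
      using mod[OF divide_pos_pos[OF e zero_less_numeral, of "num.Bit1 num.One"]] by blast
    obtain m :: nat where m: "T < real m * \<delta>" using ex_less_of_nat_mult d(1) by blast
    have m0: "m > 0" using m T d(1) by (cases m) auto
    let ?F = "(\<lambda>i. T * real i / real m) ` {..m}"
    have F: "?F \<subseteq> D" "finite ?F" using m0 by (auto simp: D_def image_iff)
    have "\<forall>p\<in>?F. \<exists>N. \<forall>a\<ge>N. \<forall>b\<ge>N. d (x (r a) p) (x (r b) p) < e/3"
    proof
      fix p assume "p \<in> ?F"
      then have "p \<in> D" using F by blast
      then show "\<exists>N. \<forall>a\<ge>N. \<forall>b\<ge>N. d (x (r a) p) (x (r b) p) < e/3" by (rule cauchyD) (use e in simp)
    qed
    then obtain Nf where Nf: "\<And>p a b. p \<in> ?F \<Longrightarrow> a \<ge> Nf p \<Longrightarrow> b \<ge> Nf p \<Longrightarrow> d (x (r a) p) (x (r b) p) < e/3" by metis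
    define N' where "N' = max N (Max (Nf ` ?F))"
    have N': "N' \<ge> Nf p" if "p \<in> ?F" for p using that F by (auto simp: N'_def intro!: max.coboundedI2 Max_ge)
    have "d (x (r a) t) (x (r b) t) \<le> e" if ab: "a \<ge> N'" "b \<ge> N'" and t: "t \<in> {0..T}" for a b t
    proof -
      define j where "j = nat \<lfloor>t * real m / T\<rfloor>"
      define p where "p = T * real j / real m"
      have tm: "0 \<le> t * real m / T" "t * real m / T \<le> real m" using t T by (auto simp: divide_le_eq mult.commute intro: mult_right_mono)
      have j: "real j \<le> t * real m / T" "t * real m / T < real j + 1" using tm floor_correct[of "t * real m / T"] unfolding j_def by auto
      have jm: "j \<le> m" using j(1) tm(2) by linarith
      then have p: "p \<in> ?F" by (auto simp: p_def)
      then have p2: "p \<in> {0..T}" using F D by blast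
      have "p \<le> t" using j(1) m0 T by (simp add: p_def field_simps)
      moreover have "t - p \<le> T / real m"
      proof -
        have "t = (t * real m / T) * (T / real m)" using m0 T by simp
        also have "\<dots> \<le> (real j + 1) * (T / real m)" using j(2) m0 T by (intro mult_right_mono) auto
        also have "\<dots> = p + T / real m" by (simp add: p_def algebra_simps add_divide_distrib)
        finally show ?thesis by simp
      qed
      moreover have "T / real m \<le> \<delta>" using m m0 by (simp add: field_simps)
      ultimately have tp: "\<bar>t - p\<bar> \<le> \<delta>" "\<bar>p - t\<bar> \<le> \<delta>" by linarith+
      have ra: "r a \<ge> N" "r b \<ge> N" using ab rN[of a] rN[of b] by (auto simp: N'_def)
      have 1: "d (x (r a) t) (x (r a) p) \<le> e/3" using d(2)[OF ra(1) t p2 tp(1)] .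
      have 2: "d (x (r b) p) (x (r b) t) \<le> e/3" using d(2)[OF ra(2) p2 t tp(2)] .
      have 3: "d (x (r a) p) (x (r b) p) < e/3" using Nf[OF p] N'[OF p] ab by simp
      have "d (x (r a) t) (x (r b) t) \<le> d (x (r a) t) (x (r a) p) + d (x (r a) p) (x (r b) t)"
        using t p2 by (intro triangle xM) auto
      also have "d (x (r a) p) (x (r b) t) \<le> d (x (r a) p) (x (r b) p) + d (x (r b) p) (x (r b) t)"
        using t p2 by (intro triangle xM) auto
      finally show ?thesis using 1 2 3 by linarith
    qed
    then show ?thesis by blast
  qed
  \<comment> \<open>As \<open>M\<close> need not be complete, the value of the limit is taken as a
    cluster point in a compact ball; \<open>cauchy\<close> then makes the convergence uniform in
    time.\<close>
  have "\<exists>l. l \<in> M \<and> (\<forall>e>0. \<forall>N. \<exists>m\<ge>N. d (x (r m) t) l < e)" if t: "t \<in> {0..T}" for t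
  proof -
    have "range (\<lambda>n. x (r n) t) \<subseteq> mcball c (real i)"
    proof (rule image_subsetI)
      fix n show "x (r n) t \<in> mcball c (real i)" by (rule bd) (use rN t in auto)
    qed
    with proper[of c "real i"] obtain l f where f: "strict_mono f"
      "limitin mtopology ((\<lambda>n. x (r n) t) \<circ> f) l sequentially"
      unfolding compactin_sequentially by blast
    have "\<exists>m\<ge>N. d (x (r m) t) l < e" if e: "e > 0" for e N
    proof -
      obtain K where K: "\<And>n. n \<ge> K \<Longrightarrow> d (x (r (f n)) t) l < e" using f(2) e
        unfolding limitin_metric eventually_sequentially o_def by meson
      have "f (max K N) \<ge> N" using seq_suble[OF f(1), of "max K N"] by simp
      then show ?thesis using K[of "max K N"] by auto
    qed
    moreover have "l \<in> M" using f(2) limitin_mspace by blast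
    ultimately show ?thesis by blast
  qed
  then obtain y0 where y0: "\<And>t. t \<in> {0..T} \<Longrightarrow> y0 t \<in> M"
    "\<And>t e N. t \<in> {0..T} \<Longrightarrow> e > 0 \<Longrightarrow> \<exists>m\<ge>N. d (x (r m) t) (y0 t) < e" by metis
  define y where "y = restrict y0 {0..T}"
  have yM: "y t \<in> M" if "t \<in> {0..T}" for t using y0 that by (simp add: y_def)
  have unif: "\<exists>N. \<forall>n\<ge>N. \<forall>t\<in>{0..T}. d (x (r n) t) (y t) \<le> e" if e: "e > 0" for e
  proof -
    obtain N where N: "\<And>m n t. m \<ge> N \<Longrightarrow> n \<ge> N \<Longrightarrow> t \<in> {0..T} \<Longrightarrow> d (x (r m) t) (x (r n) t) \<le> e/2"
      using cauchy[of "e/2"] e by (meson half_gt_zero)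
    have "d (x (r n) t) (y t) \<le> e" if n: "n \<ge> N" and t: "t \<in> {0..T}" for n t
    proof -
      obtain m where m: "m \<ge> N" "d (x (r m) t) (y0 t) < e/2" using y0(2)[OF t, of "e/2"] e by auto
      have "d (x (r n) t) (y t) \<le> d (x (r n) t) (x (r m) t) + d (x (r m) t) (y t)"
        using xM yM t by (intro triangle) auto
      then show ?thesis using N[OF n m(1) t] m(2) t by (simp add: y_def)
    qed
    then show ?thesis by blast
  qed
  have cont: "y \<in> continuous_paths T"
    unfolding continuous_paths_iff
  proof (intro conjI ballI allI impI)
    show "y \<in> {0..T} \<rightarrow>\<^sub>E M" using y0 by (auto simp: y_def)
    fix t and e :: real assume t: "t \<in> {0..T}" and e: "e > 0"
    obtain \<delta> N where d: "\<delta> > 0" "\<And>n s t. n \<ge> N \<Longrightarrow> s \<in> {0..T} \<Longrightarrow> t \<in> {0..T} \<Longrightarrow> \<bar>s - t\<bar> \<le> \<delta> \<Longrightarrow> d (x n s) (x n t) \<le> e/4"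
      using mod[OF divide_pos_pos[OF e zero_less_numeral, of "num.Bit0 (num.Bit0 num.One)"]] by blast
    obtain N2 where N2: "\<And>n t. n \<ge> N2 \<Longrightarrow> t \<in> {0..T} \<Longrightarrow> d (x (r n) t) (y t) \<le> e/4" using unif[of "e/4"] e by force
    define n where "n = max N N2"
    have n: "r n \<ge> N" "n \<ge> N2" using rN(1)[of n] by (auto simp: n_def)
    have "d (y t) (y s) < e" if s: "s \<in> {0..T}" "\<bar>s - t\<bar> < \<delta>" for s
    proof -
      have "d (y t) (y s) \<le> d (y t) (x (r n) t) + d (x (r n) t) (y s)"
        using s t by (intro triangle xM yM) auto
      also have "d (x (r n) t) (y s) \<le> d (x (r n) t) (x (r n) s) + d (x (r n) s) (y s)"
        using s t by (intro triangle xM yM) auto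
      finally show ?thesis
        using N2[OF n(2) t] N2[OF n(2) s(1)] d(2)[OF n(1) t s(1)] s(2) e by (simp add: commute abs_minus_commute)
    qed
    then show "\<exists>\<delta>>0. \<forall>s\<in>{0..T}. \<bar>s - t\<bar> < \<delta> \<longrightarrow> d (y t) (y s) < e" using d(1) by blast
  qed
  show ?thesis using that[OF r cont] unif by blast
qed

end

section \<open>Borel sets of a topology and continuity of time changes\<close>

lemma space_borel_of [simp]: "space (borel_of X) = topspace X"
  unfolding borel_of_def by (rule space_measure_of) (auto dest: openin_subset)

lemma sets_borel_of: "sets (borel_of X) = sigma_sets (topspace X) {U. openin X U}"
  unfolding borel_of_def by (rule sets_measure_of) (auto dest: openin_subset)

lemma openin_borel_of: "openin X U \<Longrightarrow> U \<in> sets (borel_of X)"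
  by (simp add: sets_borel_of)

lemma closedin_borel_of: "closedin X C \<Longrightarrow> C \<in> sets (borel_of X)"
proof -
  assume C: "closedin X C"
  then have "topspace X - (topspace X - C) \<in> sets (borel_of X)"
    using openin_borel_of[of X "topspace X - C"] sets.compl_sets[of "topspace X - C" "borel_of X"] by auto
  moreover have "topspace X - (topspace X - C) = C" using closedin_subset[OF C] by auto
  ultimately show ?thesis by simp
qed

lemma continuous_map_borel_of:
  fixes f :: "'a \<Rightarrow> real"
  assumes "continuous_map X euclideanreal f" shows "f \<in> borel_measurable (borel_of X)"
proof (rule borel_measurableI)
  fix S :: "real set" assume "open S"
  then have "openin X {x \<in> topspace X. f x \<in> S}"
    using assms by (auto simp: continuous_map_def)
  moreover have "f -` S \<inter> space (borel_of X) = {x \<in> topspace X. f x \<in> S}" by auto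
  ultimately show "f -` S \<inter> space (borel_of X) \<in> sets (borel_of X)" by (simp add: openin_borel_of)
qed

lemma time_change_continuous:
  assumes g: "g \<in> time_changes T" and t: "t \<in> {0..T}" and e: "e > 0"
  shows "\<exists>\<delta>>0. \<forall>s\<in>{0..T}. \<bar>s - t\<bar> < \<delta> \<longrightarrow> \<bar>g s - g t\<bar> < e"
proof -
  have gm: "\<And>a b. a \<in> {0..T} \<Longrightarrow> b \<in> {0..T} \<Longrightarrow> a < b \<Longrightarrow> g a < g b"
    and im: "g ` {0..T} = {0..T}" using g by (auto simp: time_changes_def strict_mono_on_def)
  have gt: "g t \<in> {0..T}" using im t by blast
  \<comment> \<open>Surjectivity provides preimages \<open>u\<close> and \<open>v\<close> of two
    levels around \<open>g t\<close>, clipped to the interval; monotonicity confines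
    \<open>g\<close> between these levels.\<close>
  have "max 0 (g t - e/2) \<in> g ` {0..T}" "min T (g t + e/2) \<in> g ` {0..T}" using gt e unfolding im by auto
  then obtain u v where u: "u \<in> {0..T}" "g u = max 0 (g t - e/2)" and v: "v \<in> {0..T}" "g v = min T (g t + e/2)"
    by auto
  \<comment> \<open>\<open>u < t\<close> fails only if \<open>g t = 0\<close>, when no time of the
    interval lies below \<open>t\<close>, and similarly for \<open>v\<close>; so the default 1 does
    no harm.\<close>
  define \<delta> where "\<delta> = min (if u < t then t - u else 1) (if t < v then v - t else 1)"
  have "\<bar>g s - g t\<bar> < e" if s: "s \<in> {0..T}" "\<bar>s - t\<bar> < \<delta>" for s
  proof (cases s t rule: linorder_cases)
    case less
    have gs: "g s \<ge> 0" using im s by auto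
    have "u < t"
    proof (rule ccontr)
      assume "\<not> u < t"
      then have "g t \<le> g u" using gm[OF t u(1)] by (cases "u = t") auto
      then have "g t \<le> 0" using u(2) e by auto
      then show False using gm[OF s(1) t less] gs by auto
    qed
    then have "u < s" using s(2) less by (auto simp: \<delta>_def)
    then show ?thesis using gm[OF u(1) s(1)] gm[OF s(1) t less] u(2) e by auto
  next
    case greater
    have gs: "g s \<le> T" using im s by auto
    have "t < v"
    proof (rule ccontr)
      assume "\<not> t < v"
      then have "g v \<le> g t" using gm[OF v(1) t] by (cases "v = t") auto
      then have "g t \<ge> T" using v(2) e by auto
      then show False using gm[OF t s(1) greater] gs by auto
    qed
    then have "s < v" using s(2) greater by (auto simp: \<delta>_def)
    then show ?thesis using gm[OF s(1) v(1)] gm[OF t s(1) greater] v(2) e by auto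
  qed (use e in auto)
  moreover have "\<delta> > 0" by (auto simp: \<delta>_def)
  ultimately show ?thesis by blast
qed

section \<open>Compact unions and the closed set of continuous paths\<close>

context Metric_space
begin

text \<open>A Lebesgue number: after halving the radii, the minimum over a finite subcover works for
  all points of \<open>C\<close>.\<close>

lemma compactin_nbhd:
  assumes C: "compactin mtopology C" and U: "openin mtopology U" "C \<subseteq> U"
  shows "\<exists>r>0. \<forall>y\<in>C. mball y r \<subseteq> U"
proof -
  have CM: "C \<subseteq> M" using compactin_subset_topspace[OF C] by simp
  have "\<forall>y\<in>C. \<exists>r>0. mball y r \<subseteq> U" using U openin_mtopology by blast
  then obtain R where R: "\<And>y. y \<in> C \<Longrightarrow> R y > 0 \<and> mball y (R y) \<subseteq> U" by metis
  let ?B = "(\<lambda>y. mball y (R y / 2)) ` C"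
  have cov: "C \<subseteq> \<Union>?B" using R CM by fastforce
  have op: "\<And>B. B \<in> ?B \<Longrightarrow> openin mtopology B" by auto
  obtain \<F> where \<F>: "finite \<F>" "\<F> \<subseteq> ?B" "C \<subseteq> \<Union>\<F>"
    using compactinD[OF C op cov] by blast
  then obtain F where F: "finite F" "F \<subseteq> C" "\<F> = (\<lambda>y. mball y (R y / 2)) ` F"
    by (meson finite_subset_image)
  define r where "r = Min (insert 1 ((\<lambda>y. R y / 2) ` F))"
  have r0: "r > 0" using F R by (auto simp: r_def)
  have rF: "r \<le> R y / 2" if "y \<in> F" for y using F that unfolding r_def by (intro Min_le) auto
  have "mball y r \<subseteq> U" if y: "y \<in> C" for y
  proof
    fix z assume z: "z \<in> mball y r"
    obtain a where a: "a \<in> F" "y \<in> mball a (R a / 2)" using y \<F> F by auto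
    have "d a z \<le> d a y + d y z" using a z by (intro triangle) auto
    also have "\<dots> < R a" using a z rF[OF a(1)] by auto
    finally have "z \<in> mball a (R a)" using a z by auto
    then show "z \<in> U" using R a F by blast
  qed
  then show ?thesis using r0 by blast
qed

text \<open>A finite subcover of \<open>C\<close> covers a whole neighbourhood of \<open>C\<close>,
  hence all \<open>K k\<close> from some index on; only finitely many \<open>K k\<close> call for
  further open sets.\<close>

lemma compactin_Un_shrinking:
  fixes K :: "nat \<Rightarrow> 'a set"
  assumes C: "compactin mtopology C" and K: "\<And>k. compactin mtopology (K k)"
    and near: "\<And>r. r > 0 \<Longrightarrow> \<exists>k0. \<forall>k\<ge>k0. \<forall>x\<in>K k. \<exists>y\<in>C. d y x < r"
  shows "compactin mtopology (C \<union> (\<Union>k. K k))"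
  unfolding compactin_def
proof (intro conjI allI impI)
  show "C \<union> (\<Union>k. K k) \<subseteq> topspace mtopology"
    using C K compactin_subset_topspace by blast
  fix \<U> assume "Ball \<U> (openin mtopology) \<and> C \<union> (\<Union>k. K k) \<subseteq> \<Union>\<U>"
  then have op: "\<And>B. B \<in> \<U> \<Longrightarrow> openin mtopology B" and cov: "C \<subseteq> \<Union>\<U>" "\<And>k. K k \<subseteq> \<Union>\<U>" by blast+
  obtain \<F> where \<F>: "finite \<F>" "\<F> \<subseteq> \<U>" "C \<subseteq> \<Union>\<F>" using compactinD[OF C op cov(1)] by blast
  have "openin mtopology (\<Union>\<F>)" using \<F> op by blast
  from compactin_nbhd[OF C this \<F>(3)] obtain r where r: "r > 0" "\<And>y. y \<in> C \<Longrightarrow> mball y r \<subseteq> \<Union>\<F>" by blast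
  obtain k0 where k0: "\<And>k x. k \<ge> k0 \<Longrightarrow> x \<in> K k \<Longrightarrow> \<exists>y\<in>C. d y x < r" using near[OF r(1)] by blast
  have "\<forall>k. \<exists>\<G>. finite \<G> \<and> \<G> \<subseteq> \<U> \<and> K k \<subseteq> \<Union>\<G>" using compactinD[OF K op cov(2)] by blast
  then obtain \<G> where \<G>: "\<And>k. finite (\<G> k) \<and> \<G> k \<subseteq> \<U> \<and> K k \<subseteq> \<Union>(\<G> k)" by metis
  have K\<F>: "K k \<subseteq> \<Union>\<F>" if k: "k \<ge> k0" for k
  proof
    fix x assume x: "x \<in> K k"
    obtain y where y: "y \<in> C" "d y x < r" using k0[OF k x] by blast
    have "x \<in> M" "y \<in> M" using K[of k] C x y compactin_subset_topspace by fastforce+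
    then have "x \<in> mball y r" using y by auto
    then show "x \<in> \<Union>\<F>" using r(2)[OF y(1)] by blast
  qed
  have KU: "K k \<subseteq> \<Union>(\<F> \<union> (\<Union>k<k0. \<G> k))" for k
  proof (cases "k < k0")
    case True
    then have "\<Union>(\<G> k) \<subseteq> \<Union>(\<F> \<union> (\<Union>k<k0. \<G> k))" by blast
    then show ?thesis using \<G>[of k] by blast
  next
    case False
    then have "K k \<subseteq> \<Union>\<F>" by (intro K\<F>) simp
    then show ?thesis by blast
  qed
  show "\<exists>\<F>. finite \<F> \<and> \<F> \<subseteq> \<U> \<and> C \<union> (\<Union>k. K k) \<subseteq> \<Union>\<F>"
  proof (intro exI conjI)
    show "finite (\<F> \<union> (\<Union>k<k0. \<G> k))" using \<F>(1) \<G> by simp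
    show "\<F> \<union> (\<Union>k<k0. \<G> k) \<subseteq> \<U>" using \<F>(2) \<G> by blast
    have "C \<subseteq> \<Union>(\<F> \<union> (\<Union>k<k0. \<G> k))" using \<F>(3) by auto
    then show "C \<union> (\<Union>k. K k) \<subseteq> \<Union>(\<F> \<union> (\<Union>k<k0. \<G> k))" by (intro Un_least UN_least KU)
  qed
qed

lemma topspace_skorokhod [simp]: "topspace (skorokhod_topology T) = cadlag_paths T"
  unfolding skorokhod_topology_def by (rule Metric_space.topspace_mtopology[OF Metric_space_skorokhod])

lemma skorokhod_dist_less_uniform:
  assumes "x \<in> cadlag_paths T" "y \<in> cadlag_paths T" and "\<And>t. t \<in> {0..T} \<Longrightarrow> d (x t) (y t) \<le> e" "0 < e" "e < r"
  shows "skorokhod_dist T x y < r"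
  unfolding skorokhod_dist_less_iff[OF assms(1,2)] skorokhod_close_def
  using assms id_time_change by (intro exI[of _ e] conjI bexI[of _ "\<lambda>t. t"]) auto

text \<open>If a continuous \<open>y\<close> is close to \<open>x\<close>, then \<open>y\<close>
  composed with the time change is still continuous and uniformly close to \<open>x\<close>; the
  rest is the usual three-term estimate. Closedness also makes the set measurable.\<close>

lemma closedin_continuous_paths: "closedin (skorokhod_topology T) (continuous_paths T)"
proof -
  interpret Sk: Metric_space "cadlag_paths T" "skorokhod_dist T" by (rule Metric_space_skorokhod)
  have "x \<in> continuous_paths T"
    if x: "x \<in> cadlag_paths T" and near: "\<forall>r>0. \<exists>y\<in>continuous_paths T. skorokhod_dist T x y < r" for x
    unfolding continuous_paths_iff
  proof (intro conjI ballI allI impI)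
    show "x \<in> {0..T} \<rightarrow>\<^sub>E M" using x by (simp add: cadlag_paths_def)
    fix t and e :: real assume t: "t \<in> {0..T}" and e: "e > 0"
    obtain y where y: "y \<in> continuous_paths T" "skorokhod_dist T x y < e/3" using near e by (meson divide_pos_pos zero_less_numeral)
    have yD: "y \<in> cadlag_paths T" using y continuous_paths_subset_cadlag by blast
    obtain e' where e': "0 < e'" "e' < e/3" "skorokhod_close T x y e'"
      using y(2) unfolding skorokhod_dist_less_iff[OF x yD] by blast
    then obtain g where g: "g \<in> time_changes T" "\<And>s. s \<in> {0..T} \<Longrightarrow> d (x s) (y (g s)) \<le> e'"
      unfolding skorokhod_close_def by blast
    have gs: "g s \<in> {0..T}" if "s \<in> {0..T}" for s using g(1) that unfolding time_changes_def by blast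
    have xM: "x s \<in> M" "y s \<in> M" if "s \<in> {0..T}" for s using x yD that by (auto simp: cadlag_paths_def)
    obtain \<delta>1 where d1: "\<delta>1 > 0" "\<And>s. s \<in> {0..T} \<Longrightarrow> \<bar>s - g t\<bar> < \<delta>1 \<Longrightarrow> d (y (g t)) (y s) < e/3"
      using y(1) gs[OF t] divide_pos_pos[OF e zero_less_numeral, of "num.Bit1 num.One"]
      unfolding continuous_paths_iff by blast
    obtain \<delta> where d: "\<delta> > 0" "\<And>s. s \<in> {0..T} \<Longrightarrow> \<bar>s - t\<bar> < \<delta> \<Longrightarrow> \<bar>g s - g t\<bar> < \<delta>1"
      using time_change_continuous[OF g(1) t d1(1)] by blast
    have "d (x t) (x s) < e" if s: "s \<in> {0..T}" "\<bar>s - t\<bar> < \<delta>" for s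
    proof -
      have "d (x t) (x s) \<le> d (x t) (y (g t)) + d (y (g t)) (x s)"
        using s t gs by (intro triangle xM) auto
      also have "d (y (g t)) (x s) \<le> d (y (g t)) (y (g s)) + d (y (g s)) (x s)"
        using s t gs by (intro triangle xM) auto
      finally show ?thesis
        using g(2)[OF t] g(2)[OF s(1)] d1(2)[OF gs[OF s(1)] d(2)[OF s]] e' by (simp add: commute)
    qed
    then show "\<exists>\<delta>>0. \<forall>s\<in>{0..T}. \<bar>s - t\<bar> < \<delta> \<longrightarrow> d (x t) (x s) < e" using d(1) by blast
  qed
  then show ?thesis
    unfolding skorokhod_topology_def Sk.closedin_metric using continuous_paths_subset_cadlag
    by (fastforce simp: disjnt_iff)
qed

section \<open>Classes with given moduli of continuity and a criterion for C-tightness\<close>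

definition modulus_le :: "real \<Rightarrow> (real \<Rightarrow> 'a) \<Rightarrow> real \<Rightarrow> real \<Rightarrow> bool" where
  "modulus_le T x \<delta> \<eta> \<longleftrightarrow> (\<forall>s\<in>{0..T}. \<forall>t\<in>{0..T}. \<bar>s - t\<bar> \<le> \<delta> \<longrightarrow> d (x s) (x t) \<le> \<eta>)"

definition modulus_class :: "real \<Rightarrow> 'a \<Rightarrow> (nat \<Rightarrow> real) \<Rightarrow> (real \<Rightarrow> 'a) set" where
  "modulus_class T c \<delta> = {x \<in> continuous_paths T. x 0 = c \<and> (\<forall>j. modulus_le T x (\<delta> j) (1 / real (Suc j)))}"

text \<open>A path with a jump satisfies no modulus below the size of the jump. Index
  \<open>k\<close> therefore demands only those \<open>j \<le> k\<close> whose threshold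
  \<open>k0 j\<close> has been reached: finitely many at a time, but each \<open>j\<close> for all
  large \<open>k\<close>.\<close>

definition almost_modulus_class :: "real \<Rightarrow> 'a \<Rightarrow> (nat \<Rightarrow> real) \<Rightarrow> (nat \<Rightarrow> nat) \<Rightarrow> nat \<Rightarrow> (real \<Rightarrow> 'a) set" where
  "almost_modulus_class T c \<delta> k0 k =
     {x \<in> cadlag_paths T. x 0 = c \<and> (\<forall>j\<le>k. k0 j \<le> k \<longrightarrow> modulus_le T x (\<delta> j) (1 / real (Suc j)))}"

lemma modulus_class_subset: "modulus_class T c \<delta> \<subseteq> almost_modulus_class T c \<delta> k0 k"
  using continuous_paths_subset_cadlag by (auto simp: modulus_class_def almost_modulus_class_def)

text \<open>Each \<open>j\<close> is demanded from some index on, which is the hypothesis of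
  \<open>asymptotic_Arzela_Ascoli\<close>; for the same reason the limit inherits every modulus.
  Uniform convergence implies convergence in the Skorokhod topology.\<close>

lemma almost_modulus_class_limit:
  assumes T: "0 < T" and proper: "\<And>a B. compactin mtopology (mcball a B)" and c: "c \<in> M"
    and \<delta>: "\<And>j. \<delta> j > 0" and n: "\<And>n. \<kappa> n \<ge> n" and x: "\<And>n. x n \<in> almost_modulus_class T c \<delta> k0 (\<kappa> n)"
  obtains y and r :: "nat \<Rightarrow> nat" where "strict_mono r" "y \<in> modulus_class T c \<delta>"
    "limitin (skorokhod_topology T) (x \<circ> r) y sequentially"
proof -
  interpret Sk: Metric_space "cadlag_paths T" "skorokhod_dist T" by (rule Metric_space_skorokhod)
  have xD: "x n \<in> cadlag_paths T" "x n 0 = c" for n using x[of n] by (auto simp: almost_modulus_class_def)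
  have xM: "x n t \<in> M" if "t \<in> {0..T}" for n t using xD(1)[of n] that by (auto simp: cadlag_paths_def)
  have mj: "d (x n s) (x n t) \<le> 1 / real (Suc j)"
    if "n \<ge> max j (k0 j)" "s \<in> {0..T}" "t \<in> {0..T}" "\<bar>s - t\<bar> \<le> \<delta> j" for j n s t
  proof -
    have "j \<le> \<kappa> n" "k0 j \<le> \<kappa> n" using n[of n] that(1) by auto
    then show ?thesis using x[of n] that(2-) unfolding almost_modulus_class_def modulus_le_def by blast
  qed
  have md: "\<exists>\<delta>>0. \<exists>N. \<forall>n\<ge>N. \<forall>s\<in>{0..T}. \<forall>t\<in>{0..T}. \<bar>s - t\<bar> \<le> \<delta> \<longrightarrow> d (x n s) (x n t) \<le> e"
    if e: "e > 0" for e
  proof -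
    obtain j where j: "1 / real (Suc j) < e" using nat_approx_posE[OF e] by metis
    then show "\<exists>\<delta>>0. \<exists>N. \<forall>n\<ge>N. \<forall>s\<in>{0..T}. \<forall>t\<in>{0..T}. \<bar>s - t\<bar> \<le> \<delta> \<longrightarrow> d (x n s) (x n t) \<le> e"
      using \<delta>[of j] order.trans[OF mj[of j] less_imp_le[OF j]]
      by (intro exI[of _ "\<delta> j"] conjI exI[of _ "max j (k0 j)"] allI ballI impI; blast)
  qed
  obtain r :: "nat \<Rightarrow> nat" and y where r: "strict_mono r" and y: "y \<in> continuous_paths T"
    and u: "\<And>e. e > 0 \<Longrightarrow> \<exists>N. \<forall>n\<ge>N. \<forall>t\<in>{0..T}. d (x (r n) t) (y t) \<le> e"
    using asymptotic_Arzela_Ascoli[of T c x] T proper c xD(2) xM md by blast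
  have yD: "y \<in> cadlag_paths T" using y continuous_paths_subset_cadlag by blast
  have yM: "y t \<in> M" if "t \<in> {0..T}" for t using yD that by (auto simp: cadlag_paths_def)
  have "y 0 = c"
  proof (rule ccontr)
    assume "y 0 \<noteq> c"
    then have "d c (y 0) / 2 > 0" using c yM[of 0] T by auto
    from u[OF this] obtain N where "d (x (r N) 0) (y 0) \<le> d c (y 0) / 2" using T by force
    then show False using xD(2) \<open>d c (y 0) / 2 > 0\<close> by auto
  qed
  moreover have "modulus_le T y (\<delta> j) (1 / real (Suc j))" for j
    unfolding modulus_le_def
  proof (intro ballI impI)
    fix s t assume st: "s \<in> {0..T}" "t \<in> {0..T}" "\<bar>s - t\<bar> \<le> \<delta> j"
    show "d (y s) (y t) \<le> 1 / real (Suc j)"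
    proof (rule field_le_epsilon)
      fix e :: real assume "e > 0"
      then obtain N where N: "\<And>n t. n \<ge> N \<Longrightarrow> t \<in> {0..T} \<Longrightarrow> d (x (r n) t) (y t) \<le> e/2" using u[of "e/2"] by force
      define n where "n = max N (max j (k0 j))"
      have rn: "r n \<ge> max j (k0 j)" using seq_suble[OF r, of n] by (simp add: n_def)
      have "d (y s) (y t) \<le> d (y s) (x (r n) s) + d (x (r n) s) (y t)"
        using st by (intro triangle xM yM) auto
      also have "d (x (r n) s) (y t) \<le> d (x (r n) s) (x (r n) t) + d (x (r n) t) (y t)"
        using st by (intro triangle xM yM) auto
      finally show "d (y s) (y t) \<le> 1 / real (Suc j) + e"
        using N[of n s] N[of n t] mj[OF rn st] st by (simp add: commute n_def)
    qed
  qed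
  ultimately have yC: "y \<in> modulus_class T c \<delta>" using y by (simp add: modulus_class_def)
  have "limitin (skorokhod_topology T) (x \<circ> r) y sequentially"
    unfolding skorokhod_topology_def Sk.limitin_metric eventually_sequentially
  proof (intro conjI allI impI)
    fix e :: real assume e: "e > 0"
    then obtain N where N: "\<And>n t. n \<ge> N \<Longrightarrow> t \<in> {0..T} \<Longrightarrow> d (x (r n) t) (y t) \<le> e/2" using u[of "e/2"] by force
    have "skorokhod_dist T (x (r n)) y < e" if "n \<ge> N" for n
      by (rule skorokhod_dist_less_uniform[OF xD(1) yD N[OF that]]) (use e in auto)
    then show "\<exists>N. \<forall>n\<ge>N. (x \<circ> r) n \<in> cadlag_paths T \<and> skorokhod_dist T ((x \<circ> r) n) y < e"
      using xD(1) by auto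
  qed (rule yD)
  then show ?thesis by (rule that[OF r yC])
qed

text \<open>With thresholds 0 a path of the class lies in all the almost classes, so the preceding
  lemma yields sequential compactness.\<close>

lemma compactin_modulus_class:
  assumes T: "0 < T" and proper: "\<And>a B. compactin mtopology (mcball a B)" and c: "c \<in> M" and \<delta>: "\<And>j. \<delta> j > 0"
  shows "compactin (skorokhod_topology T) (modulus_class T c \<delta>)"
proof -
  interpret Sk: Metric_space "cadlag_paths T" "skorokhod_dist T" by (rule Metric_space_skorokhod)
  have "\<exists>l r. l \<in> modulus_class T c \<delta> \<and> strict_mono r \<and> limitin Sk.mtopology (x \<circ> r) l sequentially"
    if "range x \<subseteq> modulus_class T c \<delta>" for x :: "nat \<Rightarrow> _"
  proof -
    have "\<And>n. x n \<in> almost_modulus_class T c \<delta> (\<lambda>_. 0) n" using that modulus_class_subset by blast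
    from almost_modulus_class_limit[OF T proper c \<delta> order.refl this] show ?thesis
      unfolding skorokhod_topology_def by blast
  qed
  moreover have "modulus_class T c \<delta> \<subseteq> cadlag_paths T"
    using continuous_paths_subset_cadlag by (auto simp: modulus_class_def)
  ultimately show ?thesis unfolding skorokhod_topology_def Sk.compactin_sequentially by blast
qed

text \<open>Otherwise ever later classes would contain paths at distance at least \<open>r\<close>,
  and a subsequence of these would converge into the class.\<close>

lemma almost_modulus_class_near:
  assumes T: "0 < T" and proper: "\<And>a B. compactin mtopology (mcball a B)" and c: "c \<in> M" and \<delta>: "\<And>j. \<delta> j > 0"
    and r: "r > 0"
  shows "\<exists>k1. \<forall>k\<ge>k1. \<forall>x\<in>almost_modulus_class T c \<delta> k0 k. \<exists>y\<in>modulus_class T c \<delta>. skorokhod_dist T x y < r"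
proof (rule ccontr)
  interpret Sk: Metric_space "cadlag_paths T" "skorokhod_dist T" by (rule Metric_space_skorokhod)
  assume "\<not> ?thesis"
  then have "\<forall>n. \<exists>k x. k \<ge> n \<and> x \<in> almost_modulus_class T c \<delta> k0 k \<and> (\<forall>y\<in>modulus_class T c \<delta>. \<not> skorokhod_dist T x y < r)"
    by meson
  then obtain \<kappa> x where x: "\<And>n. \<kappa> n \<ge> n" "\<And>n. x n \<in> almost_modulus_class T c \<delta> k0 (\<kappa> n)"
    "\<And>n y. y\<in>modulus_class T c \<delta> \<Longrightarrow> \<not> skorokhod_dist T (x n) y < r" by metis
  obtain y f where y: "strict_mono f" "y \<in> modulus_class T c \<delta>" "limitin (skorokhod_topology T) (x \<circ> f) y sequentially"
    using almost_modulus_class_limit[OF T proper c \<delta> x(1,2)] by blast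
  then obtain N where "skorokhod_dist T (x (f N)) y < r"
    using r unfolding skorokhod_topology_def Sk.limitin_metric eventually_sequentially by fastforce
  then show False using x(3)[OF y(2)] by blast
qed

text \<open>A portmanteau inequality with sets that change along the sequence: a Urysohn function
  vanishes on all late almost classes and equals 1 at some distance from the limit class; then this
  distance shrinks to 0.\<close>

lemma weak_limit_measure_le:
  assumes T: "0 < T" and proper: "\<And>a B. compactin mtopology (mcball a B)" and c: "c \<in> M"
    and \<delta>: "\<And>j. \<delta> j > 0"
    and P: "\<And>k. k \<ge> 1 \<Longrightarrow> prob_space (P k)"
    and Y: "\<And>k. k \<ge> 1 \<Longrightarrow> Y k \<in> measurable (P k) (borel_of (skorokhod_topology T))"
    and A: "\<And>k. k \<ge> k1 \<Longrightarrow> A k \<in> sets (P k)" "\<And>k. k \<ge> k1 \<Longrightarrow> measure (P k) (A k) \<ge> 1 - \<kappa>"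
      "\<And>k \<omega>. k \<ge> k1 \<Longrightarrow> \<omega> \<in> A k \<Longrightarrow> Y k \<omega> \<in> almost_modulus_class T c \<delta> k0 k"
    and \<mu>: "weak_limit_point (skorokhod_topology T) {1..} (\<lambda>k. distr (P k) (borel_of (skorokhod_topology T)) (Y k)) \<mu>"
  shows "measure \<mu> (modulus_class T c \<delta>) \<ge> 1 - \<kappa>"
proof -
  interpret Sk: Metric_space "cadlag_paths T" "skorokhod_dist T" by (rule Metric_space_skorokhod)
  let ?X = "skorokhod_topology T"
  let ?C = "modulus_class T c \<delta>"
  have X: "?X = Sk.mtopology" by (simp add: skorokhod_topology_def)
  interpret \<mu>: prob_space \<mu> using \<mu> by (simp add: weak_limit_point_def)
  have s\<mu>: "sets \<mu> = sets (borel_of ?X)" using \<mu> by (simp add: weak_limit_point_def)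
  have sp\<mu>: "space \<mu> = cadlag_paths T" using sets_eq_imp_space_eq[OF s\<mu>] by simp
  obtain f where f: "strict_mono f" "range f \<subseteq> {1..}"
    and wk: "weak_conv_in ?X ((\<lambda>k. distr (P k) (borel_of ?X) (Y k)) \<circ> f) \<mu>"
    using \<mu> unfolding weak_limit_point_def by blast
  have CD: "?C \<subseteq> cadlag_paths T" using continuous_paths_subset_cadlag by (auto simp: modulus_class_def)
  have Cc: "compactin ?X ?C" by (rule compactin_modulus_class[OF T proper c \<delta>])
  have Ccl: "closedin ?X ?C"
    using Cc unfolding X by (rule compactin_imp_closedin[OF Sk.Hausdorff_space_mtopology])
  \<comment> \<open>Late almost classes lie within \<open>r\<close> of \<open>?C\<close>, and taking
    the closure costs another \<open>r\<close>; hence the factor 2, which keeps \<open>F r\<close>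
    disjoint from \<open>S\<close>.\<close>
  define F where "F r = cadlag_paths T - (\<Union>y\<in>?C. Sk.mball y (2 * r))" for r
  have Fcl: "closedin ?X (F r)" for r
  proof -
    have "openin Sk.mtopology (\<Union>y\<in>?C. Sk.mball y (2 * r))" by (rule openin_Union) auto
    then show ?thesis unfolding F_def X using closedin_diff[OF closedin_topspace] by force
  qed
  have small: "measure \<mu> (F r) \<le> \<kappa>" if r: "r > 0" for r
  proof -
    obtain k2 where k2: "\<And>k x. k \<ge> k2 \<Longrightarrow> x \<in> almost_modulus_class T c \<delta> k0 k \<Longrightarrow> \<exists>y\<in>?C. skorokhod_dist T x y < r"
      using almost_modulus_class_near[where \<delta> = \<delta> and ?k0.0 = k0, OF T proper c \<delta> r] by blast
    define S where "S = ?X closure_of (\<Union>k\<in>{k2..}. almost_modulus_class T c \<delta> k0 k)"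
    have sub: "almost_modulus_class T c \<delta> k0 k \<subseteq> S" if "k \<ge> k2" for k
    proof -
      have "(\<Union>k\<in>{k2..}. almost_modulus_class T c \<delta> k0 k) \<subseteq> S"
        unfolding S_def by (rule closure_of_subset) (auto simp: almost_modulus_class_def)
      then show ?thesis using that by auto
    qed
    have disj: "disjnt S (F r)"
      unfolding disjnt_iff
    proof (intro allI notI, elim conjE)
      fix x assume x: "x \<in> S" "x \<in> F r"
      then have xD: "x \<in> cadlag_paths T" by (simp add: F_def)
      have "\<exists>y\<in>(\<Union>k\<in>{k2..}. almost_modulus_class T c \<delta> k0 k). y \<in> Sk.mball x r"
        using x(1) r unfolding S_def X Sk.metric_closure_of by blast
      then obtain k w where w: "k \<ge> k2" "w \<in> almost_modulus_class T c \<delta> k0 k" "skorokhod_dist T x w < r" "w \<in> cadlag_paths T"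
        by auto
      obtain y where y: "y \<in> ?C" "skorokhod_dist T w y < r" using k2[OF w(1,2)] by blast
      have yD: "y \<in> cadlag_paths T" using y CD by blast
      have "skorokhod_dist T x y < 2 * r" using Sk.triangle[OF xD w(4) yD] w(3) y(2) by simp
      then have "x \<in> Sk.mball y (2 * r)" using xD yD by (simp add: Sk.commute)
      then show False using x(2) y(1) by (auto simp: F_def)
    qed
    have normal: "normal_space ?X" unfolding X by (rule metrizable_imp_normal_space[OF Sk.metrizable_space_mtopology])
    obtain h where h: "continuous_map ?X (top_of_set {0..1::real}) h" "h ` S \<subseteq> {0}" "h ` F r \<subseteq> {1}"
      using Urysohn_lemma[OF normal _ Fcl disj, of 0 1] by (auto simp: S_def)
    have hc: "continuous_map ?X euclideanreal h" using h(1) by (simp add: continuous_map_in_subtopology)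
    have h01: "0 \<le> h x" "h x \<le> 1" if "x \<in> cadlag_paths T" for x
      using h(1) that by (auto simp: continuous_map_in_subtopology Pi_iff)
    have hm: "h \<in> borel_measurable (borel_of ?X)" by (rule continuous_map_borel_of[OF hc])
    have hm\<mu>: "h \<in> borel_measurable \<mu>" using hm measurable_cong_sets[OF s\<mu> refl] by blast
    have lim: "(\<lambda>n. \<integral>x. h x \<partial>(distr (P (f n)) (borel_of ?X) (Y (f n)))) \<longlonglongrightarrow> (\<integral>x. h x \<partial>\<mu>)"
      using wk[unfolded weak_conv_in_def, rule_format, of h] hc h01 by (fastforce simp: o_def)
    have le: "(\<integral>x. h x \<partial>(distr (P k) (borel_of ?X) (Y k))) \<le> \<kappa>" if k: "k \<ge> 1" "k \<ge> k1" "k \<ge> k2" for k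
    proof -
      interpret prob_space "P k" by (rule P[OF k(1)])
      have Yk: "Y k \<in> measurable (P k) (borel_of ?X)" by (rule Y[OF k(1)])
      have YD: "Y k \<omega> \<in> cadlag_paths T" if "\<omega> \<in> space (P k)" for \<omega> using measurable_space[OF Yk that] by simp
      have "(\<integral>x. h x \<partial>(distr (P k) (borel_of ?X) (Y k))) = (\<integral>\<omega>. h (Y k \<omega>) \<partial>P k)"
        by (rule integral_distr[OF Yk hm])
      also have "\<dots> \<le> (\<integral>\<omega>. indicator (space (P k) - A k) \<omega> \<partial>P k)"
      proof (rule integral_mono)
        show "integrable (P k) (\<lambda>\<omega>. h (Y k \<omega>))"
          by (rule integrable_const_bound[of _ 1]) (use h01 YD measurable_compose[OF Yk hm] in auto)
        show "integrable (P k) (indicator (space (P k) - A k) :: _ \<Rightarrow> real)"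
          using A(1)[OF k(2)] by (intro integrable_real_indicator) (auto simp: emeasure_eq_measure)
        fix \<omega> assume w: "\<omega> \<in> space (P k)"
        show "h (Y k \<omega>) \<le> indicator (space (P k) - A k) \<omega>"
        proof (cases "\<omega> \<in> A k")
          case True
          then have "Y k \<omega> \<in> S" using A(3)[OF k(2)] sub[OF k(3)] by blast
          then show ?thesis using h(2) by auto
        qed (use h01 YD w in auto)
      qed
      also have "\<dots> = prob (space (P k) - A k)" using A(1)[OF k(2)] by (simp add: Int_absorb1)
      also have "\<dots> \<le> \<kappa>" using prob_compl[OF A(1)[OF k(2)]] A(2)[OF k(2)] by simp
      finally show ?thesis .
    qed
    have "(\<integral>x. h x \<partial>\<mu>) \<le> \<kappa>"
    proof (rule LIMSEQ_le_const2[OF lim], intro exI allI impI)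
      fix n assume n: "n \<ge> max k1 k2"
      then have "f n \<ge> max k1 k2" using seq_suble[OF f(1), of n] by simp
      moreover have "f n \<ge> 1" using f(2) by auto
      ultimately show "(\<integral>x. h x \<partial>(distr (P (f n)) (borel_of ?X) (Y (f n)))) \<le> \<kappa>" by (intro le) auto
    qed
    moreover have "measure \<mu> (F r) \<le> (\<integral>x. h x \<partial>\<mu>)"
    proof -
      have Fs: "F r \<in> sets \<mu>" using closedin_borel_of[OF Fcl] s\<mu> by simp
      have "measure \<mu> (F r) = (\<integral>x. indicator (F r) x \<partial>\<mu>)" using sets.sets_into_space[OF Fs] by (simp add: Int_absorb2)
      also have "\<dots> \<le> (\<integral>x. h x \<partial>\<mu>)"
      proof (rule integral_mono)
        show "integrable \<mu> (indicator (F r) :: _ \<Rightarrow> real)"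
          using Fs by (intro integrable_real_indicator) (auto simp: \<mu>.emeasure_eq_measure)
        show "integrable \<mu> h"
          by (rule \<mu>.integrable_const_bound[of _ 1]) (use h01 hm\<mu> sp\<mu> in auto)
        fix x assume "x \<in> space \<mu>"
        then show "indicator (F r) x \<le> h x" using h(3) h01 sp\<mu> by (auto simp: indicator_def)
      qed
      finally show ?thesis .
    qed
    ultimately show ?thesis by simp
  qed
  \<comment> \<open>As \<open>?C\<close> is closed, the sets \<open>F r\<close> exhaust its
    complement when \<open>r\<close> decreases to 0.\<close>
  define G where "G n = F (1 / real (Suc n))" for n
  have Gs: "G n \<in> sets \<mu>" for n using closedin_borel_of[OF Fcl] s\<mu> by (simp add: G_def)
  have "incseq G"
  proof (rule incseq_SucI)
    fix n
    have "1 / real (Suc (Suc n)) \<le> 1 / real (Suc n)" by (simp add: field_simps)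
    then show "G n \<le> G (Suc n)" unfolding G_def F_def by fastforce
  qed
  then have "(\<lambda>n. measure \<mu> (G n)) \<longlonglongrightarrow> measure \<mu> (\<Union>n. G n)"
    using Gs by (intro \<mu>.finite_Lim_measure_incseq) auto
  then have le: "measure \<mu> (\<Union>n. G n) \<le> \<kappa>"
    by (rule LIMSEQ_le_const2) (auto simp: G_def intro!: small)
  have "space \<mu> - ?C \<subseteq> (\<Union>n. G n)"
  proof
    fix x assume x: "x \<in> space \<mu> - ?C"
    then obtain e where e: "e > 0" "disjnt ?C (Sk.mball x e)"
      using Ccl sp\<mu> unfolding X Sk.closedin_metric by blast
    have "e / 2 > 0" using e by simp
    then obtain n where n: "1 / real (Suc n) < e / 2" by (metis nat_approx_posE)
    have "x \<notin> Sk.mball y (2 * (1 / real (Suc n)))" if "y \<in> ?C" for y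
    proof
      assume "x \<in> Sk.mball y (2 * (1 / real (Suc n)))"
      then have "y \<in> Sk.mball x e" using n by (auto simp: Sk.commute)
      then show False using e(2) that by (auto simp: disjnt_iff)
    qed
    then have "x \<in> G n" using x sp\<mu> by (auto simp: G_def F_def)
    then show "x \<in> (\<Union>n. G n)" by blast
  qed
  then have "measure \<mu> (space \<mu> - ?C) \<le> measure \<mu> (\<Union>n. G n)"
    using Gs by (intro \<mu>.finite_measure_mono) auto
  moreover have "measure \<mu> (space \<mu> - ?C) = 1 - measure \<mu> ?C"
    using closedin_borel_of[OF Ccl] s\<mu> by (intro \<mu>.prob_compl) simp
  ultimately show ?thesis using le by simp
qed

text \<open>For fixed \<open>k\<close> an almost class need not be compact. So \<open>single\<close>
  supplies a compact set for each \<open>k\<close>, and intersecting it with the closure of the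
  almost class makes these sets shrink to one compact class, as
  \<open>compactin_Un_shrinking\<close> requires.\<close>

theorem C_tight_criterion:
  assumes T: "0 < T" and proper: "\<And>a B. compactin mtopology (mcball a B)" and c: "c \<in> M"
    and P: "\<And>k. k \<ge> 1 \<Longrightarrow> prob_space (P k)"
    and Y: "\<And>k. k \<ge> 1 \<Longrightarrow> Y k \<in> measurable (P k) (borel_of (skorokhod_topology T))"
    and single: "\<And>k e. k \<ge> 1 \<Longrightarrow> e > 0 \<Longrightarrow>
      \<exists>K. compactin (skorokhod_topology T) K \<and> measure (P k) (Y k -` K \<inter> space (P k)) \<ge> 1 - e"
    and modulus: "\<And>\<eta> \<kappa>. \<eta> > 0 \<Longrightarrow> \<kappa> > 0 \<Longrightarrow> \<exists>\<delta>>0. \<exists>k0. \<forall>k\<ge>k0. k \<ge> 1 \<longrightarrow>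
      (\<exists>A\<in>sets (P k). measure (P k) A \<ge> 1 - \<kappa> \<and> (\<forall>\<omega>\<in>A. Y k \<omega> 0 = c \<and> modulus_le T (Y k \<omega>) \<delta> \<eta>))"
  shows "C_tight T {1..} (\<lambda>k. distr (P k) (borel_of (skorokhod_topology T)) (Y k))"
proof -
  interpret Sk: Metric_space "cadlag_paths T" "skorokhod_dist T" by (rule Metric_space_skorokhod)
  let ?X = "skorokhod_topology T"
  let ?N = "\<lambda>k. distr (P k) (borel_of ?X) (Y k)"
  have X: "?X = Sk.mtopology" by (simp add: skorokhod_topology_def)
  have ev: "\<exists>\<delta> k0 k1 A. (\<forall>j. \<delta> j > 0) \<and> (\<forall>k\<ge>k1. 1 \<le> k \<and> A k \<in> sets (P k) \<and> measure (P k) (A k) \<ge> 1 - \<kappa> \<and>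
      (\<forall>\<omega>\<in>A k. Y k \<omega> \<in> almost_modulus_class T c \<delta> k0 k))" if \<kappa>: "\<kappa> > 0" for \<kappa>
  proof -
    \<comment> \<open>The failure probabilities \<open>\<kappa> * (1/2)^Suc j\<close> of the
      separate moduli add up to at most \<open>\<kappa>\<close>.\<close>
    define Q where "Q j \<delta> k0 A \<longleftrightarrow> \<delta> > 0 \<and> (\<forall>k. k \<ge> k0 \<longrightarrow> 1 \<le> k \<longrightarrow> A k \<in> sets (P k) \<and>
      measure (P k) (A k) \<ge> 1 - \<kappa> * (1/2)^Suc j \<and>
      (\<forall>\<omega>\<in>A k. Y k \<omega> 0 = c \<and> modulus_le T (Y k \<omega>) \<delta> (1 / real (Suc j))))" for j \<delta> k0 A
    have "\<exists>\<delta> k0 A. Q j \<delta> k0 A" for j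
    proof -
      have "1 / real (Suc j) > 0" "\<kappa> * (1/2)^Suc j > 0" using \<kappa> by auto
      from modulus[OF this] obtain \<delta> k0 where d: "\<delta> > 0" and k0: "\<forall>k\<ge>k0. k \<ge> 1 \<longrightarrow> (\<exists>A\<in>sets (P k).
        measure (P k) A \<ge> 1 - \<kappa> * (1/2)^Suc j \<and> (\<forall>\<omega>\<in>A. Y k \<omega> 0 = c \<and> modulus_le T (Y k \<omega>) \<delta> (1 / real (Suc j))))"
        by blast
      then have "\<exists>A. \<forall>k\<ge>k0. k \<ge> 1 \<longrightarrow> A k \<in> sets (P k) \<and>
        measure (P k) (A k) \<ge> 1 - \<kappa> * (1/2)^Suc j \<and> (\<forall>\<omega>\<in>A k. Y k \<omega> 0 = c \<and> modulus_le T (Y k \<omega>) \<delta> (1 / real (Suc j)))"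
        by metis
      with d show ?thesis unfolding Q_def by blast
    qed
    then obtain \<delta> k0 A where A0: "\<And>j. Q j (\<delta> j) (k0 j) (A j)" by metis
    note A0 = A0[unfolded Q_def]
    have \<delta>: "\<And>j. \<delta> j > 0" using A0 by blast
    have A: "A j k \<in> sets (P k)" "measure (P k) (A j k) \<ge> 1 - \<kappa> * (1/2)^Suc j"
      "\<omega> \<in> A j k \<Longrightarrow> Y k \<omega> 0 = c" "\<omega> \<in> A j k \<Longrightarrow> modulus_le T (Y k \<omega>) (\<delta> j) (1 / real (Suc j))"
      if "k \<ge> k0 j" "1 \<le> k" for j k \<omega> using A0 that by blast+
    \<comment> \<open>From \<open>k0 0\<close> on, \<open>0 \<in> J k\<close>, so that the good
      event includes the condition on the starting point.\<close>
    define k1 where "k1 = max 1 (k0 0)"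
    define J where "J k = {j. j \<le> k \<and> k0 j \<le> k}" for k
    define B where "B k = space (P k) - (\<Union>j\<in>J k. space (P k) - A j k)" for k
    have "1 \<le> k \<and> B k \<in> sets (P k) \<and> measure (P k) (B k) \<ge> 1 - \<kappa> \<and>
      (\<forall>\<omega>\<in>B k. Y k \<omega> \<in> almost_modulus_class T c \<delta> k0 k)" if k: "k \<ge> k1" for k
    proof -
      have k: "k \<ge> 1" "0 \<in> J k" using k by (auto simp: k1_def J_def)
      interpret prob_space "P k" by (rule P[OF k(1)])
      have fin: "finite (J k)" by (auto simp: J_def)
      have s: "(\<Union>j\<in>J k. space (P k) - A j k) \<in> sets (P k)"
        using fin A(1) k by (intro sets.finite_UN) (auto simp: J_def)
      have "prob (\<Union>j\<in>J k. space (P k) - A j k) \<le> (\<Sum>j\<in>J k. prob (space (P k) - A j k))"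
        using fin A(1) k by (intro finite_measure_subadditive_finite) (auto simp: J_def)
      also have "\<dots> \<le> (\<Sum>j\<in>J k. \<kappa> * (1/2)^Suc j)"
      proof (rule sum_mono)
        fix j assume "j \<in> J k"
        then have j: "k0 j \<le> k" by (simp add: J_def)
        show "prob (space (P k) - A j k) \<le> \<kappa> * (1/2)^Suc j"
          using prob_compl[OF A(1)[OF j k(1)]] A(2)[OF j k(1)] by simp
      qed
      also have "\<dots> \<le> (\<Sum>j\<in>{..k}. \<kappa> * (1/2)^Suc j)"
        using \<kappa> by (intro sum_mono2) (auto simp: J_def)
      also have "\<dots> = \<kappa> * (1 - (1/2)^Suc k)" by (induction k) (auto simp: field_simps)
      also have "\<dots> \<le> \<kappa>" using \<kappa> by (simp add: algebra_simps)
      finally have "prob (B k) \<ge> 1 - \<kappa>" unfolding B_def using prob_compl[OF s] by simp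
      moreover have "Y k \<omega> \<in> almost_modulus_class T c \<delta> k0 k" if w: "\<omega> \<in> B k" for \<omega>
      proof -
        have wA: "\<omega> \<in> A j k" if "j \<in> J k" for j using w that by (auto simp: B_def)
        have "\<omega> \<in> space (P k)" using w by (simp add: B_def)
        then have "Y k \<omega> \<in> cadlag_paths T" using measurable_space[OF Y[OF k(1)]] by simp
        moreover have "Y k \<omega> 0 = c" using A(3)[OF _ k(1) wA[OF k(2)]] k(2) by (simp add: J_def)
        moreover have "modulus_le T (Y k \<omega>) (\<delta> j) (1 / real (Suc j))" if "j \<in> J k" for j
          using A(4)[OF _ k(1) wA[OF that]] that by (simp add: J_def)
        ultimately show ?thesis by (simp add: almost_modulus_class_def J_def)
      qed
      moreover have "B k \<in> sets (P k)" unfolding B_def using s by blast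
      ultimately show ?thesis using k(1) by blast
    qed
    then show ?thesis using \<delta> by blast
  qed
  have tight: "\<exists>K. compactin ?X K \<and> (\<forall>k\<in>{1..}. measure (?N k) K \<ge> 1 - \<eta>)" if \<eta>: "\<eta> > 0" for \<eta>
  proof -
    have "\<eta>/2 > 0" using \<eta> by simp
    from ev[OF this] obtain \<delta> k0 k1 A where \<delta>: "\<And>j. \<delta> j > 0" and
      A: "\<And>k. k \<ge> k1 \<Longrightarrow> 1 \<le> k \<and> A k \<in> sets (P k) \<and> measure (P k) (A k) \<ge> 1 - \<eta>/2"
      "\<And>k \<omega>. k \<ge> k1 \<Longrightarrow> \<omega> \<in> A k \<Longrightarrow> Y k \<omega> \<in> almost_modulus_class T c \<delta> k0 k" by metis
    have "\<forall>k. \<exists>K. 1 \<le> k \<longrightarrow> compactin ?X K \<and> measure (P k) (Y k -` K \<inter> space (P k)) \<ge> 1 - \<eta>/2"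
      using single[OF _ \<open>\<eta>/2 > 0\<close>] by blast
    then obtain K where K: "\<And>k. 1 \<le> k \<Longrightarrow> compactin ?X (K k)" "\<And>k. 1 \<le> k \<Longrightarrow> measure (P k) (Y k -` K k \<inter> space (P k)) \<ge> 1 - \<eta>/2"
      by metis
    let ?W = "\<lambda>k. ?X closure_of (almost_modulus_class T c \<delta> k0 k)"
    \<comment> \<open>The closure of the almost class makes its intersection with the compact
      \<open>K k\<close> compact. Below \<open>k1\<close> the set for the single law is taken as it
      is; index 0 lies outside the family and gets the empty set.\<close>
    define K' where "K' k = (if k < 1 then {} else if k < k1 then K k else ?W k \<inter> K k)" for k
    have K'c: "compactin ?X (K' k)" for k
      unfolding K'_def using K(1)[of k] by (auto intro: closed_Int_compactin)
    have Cc: "compactin ?X (modulus_class T c \<delta>)" by (rule compactin_modulus_class[OF T proper c \<delta>])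
    let ?K = "modulus_class T c \<delta> \<union> (\<Union>k. K' k)"
    have Kc: "compactin ?X ?K"
      unfolding X
    proof (rule Sk.compactin_Un_shrinking)
      fix r :: real assume r: "r > 0"
      then have "r/2 > 0" by simp
      from almost_modulus_class_near[where \<delta> = \<delta> and ?k0.0 = k0, OF T proper c \<delta> this] obtain k2 where
        k2: "\<And>k x. k \<ge> k2 \<Longrightarrow> x \<in> almost_modulus_class T c \<delta> k0 k \<Longrightarrow> \<exists>y\<in>modulus_class T c \<delta>. skorokhod_dist T x y < r/2"
        by blast
      have "\<exists>y\<in>modulus_class T c \<delta>. skorokhod_dist T y x < r" if k: "k \<ge> max 1 (max k1 k2)" and x: "x \<in> K' k" for k x
      proof -
        have "x \<in> ?W k" using x k by (auto simp: K'_def split: if_splits)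
        then have xD: "x \<in> cadlag_paths T" and "\<exists>w\<in>almost_modulus_class T c \<delta> k0 k. w \<in> Sk.mball x (r/2)"
          using \<open>r/2 > 0\<close> unfolding X Sk.metric_closure_of by blast+
        then obtain w where w: "w \<in> almost_modulus_class T c \<delta> k0 k" "w \<in> cadlag_paths T" "skorokhod_dist T x w < r/2" by auto
        obtain y where y: "y \<in> modulus_class T c \<delta>" "skorokhod_dist T w y < r/2" using k2[OF _ w(1)] k by auto
        have "y \<in> cadlag_paths T" using y continuous_paths_subset_cadlag by (auto simp: modulus_class_def)
        then have "skorokhod_dist T x y < r" using Sk.triangle[OF xD w(2)] w(3) y(2) by fastforce
        then show ?thesis using y by (auto simp: Sk.commute)
      qed
      then show "\<exists>k0. \<forall>k\<ge>k0. \<forall>x\<in>K' k. \<exists>y\<in>modulus_class T c \<delta>. skorokhod_dist T y x < r" by blast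
    qed (use Cc K'c in \<open>auto simp: X\<close>)
    then have "closedin ?X ?K" unfolding X by (rule compactin_imp_closedin[OF Sk.Hausdorff_space_mtopology])
    then have Ks: "?K \<in> sets (borel_of ?X)" by (rule closedin_borel_of)
    have "measure (?N k) ?K \<ge> 1 - \<eta>" if k: "k \<ge> 1" for k
    proof -
      interpret prob_space "P k" by (rule P[OF k])
      have m: "measure (?N k) ?K = prob (Y k -` ?K \<inter> space (P k))" by (rule measure_distr[OF Y[OF k] Ks])
      have Kks: "Y k -` K k \<inter> space (P k) \<in> sets (P k)"
      proof -
        have "closedin ?X (K k)" using K(1)[OF k] unfolding X by (rule compactin_imp_closedin[OF Sk.Hausdorff_space_mtopology])
        then show ?thesis using measurable_sets[OF Y[OF k] closedin_borel_of] by blast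
      qed
      have YKs: "Y k -` ?K \<inter> space (P k) \<in> sets (P k)" by (rule measurable_sets[OF Y[OF k] Ks])
      show ?thesis
      proof (cases "k < k1")
        case True
        then have "K k \<subseteq> ?K" using k by (auto simp: K'_def)
        then have "prob (Y k -` K k \<inter> space (P k)) \<le> prob (Y k -` ?K \<inter> space (P k))"
          by (intro finite_measure_mono YKs) blast
        then show ?thesis using K(2)[OF k] m \<eta> by linarith
      next
        case False
        then have k1: "k \<ge> k1" by simp
        have Ak: "A k \<in> sets (P k)" "prob (A k) \<ge> 1 - \<eta>/2" using A(1)[OF k1] by auto
        have sub: "A k \<inter> (Y k -` K k \<inter> space (P k)) \<subseteq> Y k -` ?K \<inter> space (P k)"
        proof
          fix \<omega> assume w: "\<omega> \<in> A k \<inter> (Y k -` K k \<inter> space (P k))"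
          have "almost_modulus_class T c \<delta> k0 k \<subseteq> ?W k" by (rule closure_of_subset) (auto simp: almost_modulus_class_def)
          then have "Y k \<omega> \<in> K' k" using A(2)[OF k1] w k1 k by (auto simp: K'_def)
          then show "\<omega> \<in> Y k -` ?K \<inter> space (P k)" using w by blast
        qed
        have "prob (space (P k) - A k \<inter> (Y k -` K k \<inter> space (P k))) \<le> prob ((space (P k) - A k) \<union> (space (P k) - (Y k -` K k \<inter> space (P k))))"
          using Ak Kks by (intro finite_measure_mono) auto
        also have "\<dots> \<le> prob (space (P k) - A k) + prob (space (P k) - (Y k -` K k \<inter> space (P k)))"
          using Ak Kks by (intro measure_Un_le) auto
        also have "\<dots> \<le> \<eta>"
          using prob_compl[OF Ak(1)] prob_compl[OF Kks] Ak(2) K(2)[OF k] by simp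
        finally have "prob (A k \<inter> (Y k -` K k \<inter> space (P k))) \<ge> 1 - \<eta>"
          using prob_compl[of "A k \<inter> (Y k -` K k \<inter> space (P k))"] Ak Kks by auto
        also have "prob (A k \<inter> (Y k -` K k \<inter> space (P k))) \<le> prob (Y k -` ?K \<inter> space (P k))"
          by (intro finite_measure_mono sub YKs)
        finally show ?thesis using m by simp
      qed
    qed
    then show ?thesis using Kc by auto
  qed
  have "prob_space (?N k) \<and> sets (?N k) = sets (borel_of ?X)" if "k \<ge> 1" for k
    using prob_space.prob_space_distr[OF P[OF that] Y[OF that]] by simp
  then have "tight_family ?X {1..} ?N" using tight unfolding tight_family_def by auto
  moreover have "measure \<mu> (continuous_paths T) = 1" if \<mu>: "weak_limit_point ?X {1..} ?N \<mu>" for \<mu>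
  proof -
    interpret \<mu>: prob_space \<mu> using \<mu> by (simp add: weak_limit_point_def)
    have s: "continuous_paths T \<in> sets \<mu>"
      using \<mu> closedin_borel_of[OF closedin_continuous_paths] by (simp add: weak_limit_point_def)
    have "1 \<le> measure \<mu> (continuous_paths T) + \<kappa>" if \<kappa>: "\<kappa> > 0" for \<kappa>
    proof -
      from ev[OF \<kappa>] obtain \<delta> k0 k1 A where \<delta>: "\<And>j. \<delta> j > 0" and
        A: "\<And>k. k \<ge> k1 \<Longrightarrow> 1 \<le> k \<and> A k \<in> sets (P k) \<and> measure (P k) (A k) \<ge> 1 - \<kappa>"
        "\<And>k \<omega>. k \<ge> k1 \<Longrightarrow> \<omega> \<in> A k \<Longrightarrow> Y k \<omega> \<in> almost_modulus_class T c \<delta> k0 k" by metis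
      have "1 - \<kappa> \<le> measure \<mu> (modulus_class T c \<delta>)"
        by (rule weak_limit_measure_le[OF T proper c \<delta> P Y _ _ A(2) \<mu>]) (use A(1) in auto)
      also have "\<dots> \<le> measure \<mu> (continuous_paths T)"
        by (intro \<mu>.finite_measure_mono s) (auto simp: modulus_class_def)
      finally show ?thesis by simp
    qed
    then have "1 \<le> measure \<mu> (continuous_paths T)" by (rule field_le_epsilon)
    then show ?thesis using \<mu>.prob_le_1 by (intro antisym) auto
  qed
  ultimately show ?thesis unfolding C_tight_def by blast
qed

end

section \<open>Reparametrised step paths\<close>

text \<open>Bounding the slopes from below as well as from above survives pointwise limits, whereas
  a limit of mere time changes may jump or be constant on an interval.\<close>

definition bilipschitz_on :: "real \<Rightarrow> real \<Rightarrow> (real \<Rightarrow> real) \<Rightarrow> bool" where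
  "bilipschitz_on T L g \<longleftrightarrow> (\<forall>s\<in>{0..T}. \<forall>t\<in>{0..T}. s \<le> t \<longrightarrow> t - s \<le> L * (g t - g s) \<and> g t - g s \<le> L * (t - s))"

definition reparams :: "real \<Rightarrow> real \<Rightarrow> (real \<Rightarrow> 'a) \<Rightarrow> (real \<Rightarrow> 'a) set" where
  "reparams T L x = (\<lambda>g. restrict (x \<circ> g) {0..T}) ` {g. bilipschitz_on T L g \<and> g 0 = 0 \<and> g T = T}"

lemma bilipschitz_time_change:
  assumes T: "0 < T" and L: "0 < L" and g: "bilipschitz_on T L g" "g 0 = 0" "g T = T"
  shows "g \<in> time_changes T"
proof -
  have bl: "t - s \<le> L * (g t - g s)" "g t - g s \<le> L * (t - s)"
    if "s \<in> {0..T}" "t \<in> {0..T}" "s \<le> t" for s t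
    using g(1) that unfolding bilipschitz_on_def by blast+
  have sm: "g s < g t" if "s \<in> {0..T}" "t \<in> {0..T}" "s < t" for s t
  proof -
    have "0 < L * (g t - g s)" using bl(1)[OF that(1,2)] that(3) by simp
    then show ?thesis using L by (simp add: zero_less_mult_iff)
  qed
  have "continuous_on {0..T} g"
    unfolding continuous_on_iff
  proof (intro ballI allI impI)
    fix t e :: real assume t: "t \<in> {0..T}" and e: "e > 0"
    have "dist (g s) (g t) < e" if s: "s \<in> {0..T}" "dist s t < e / L" for s
    proof -
      have lt: "L * \<bar>s - t\<bar> < e" using s(2) L by (simp add: dist_real_def field_simps)
      have "\<bar>g s - g t\<bar> \<le> L * \<bar>s - t\<bar>"
      proof (cases "s \<le> t")
        case True
        then show ?thesis using bl(2)[OF s(1) t True] sm[OF s(1) t] by (cases "s = t") (auto simp: abs_if)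
      next
        case False
        then show ?thesis using bl(2)[OF t s(1)] sm[OF t s(1)] by (auto simp: abs_if)
      qed
      then show ?thesis using lt by (simp add: dist_real_def)
    qed
    then show "\<exists>d>0. \<forall>s\<in>{0..T}. dist s t < d \<longrightarrow> dist (g s) (g t) < e" using e L by (intro exI[of _ "e/L"]) auto
  qed
  then have "\<exists>x\<ge>0. x \<le> T \<and> g x = y" if "y \<in> {0..T}" for y
    using that T g(2,3) by (intro IVT') auto
  then have "{0..T} \<subseteq> g ` {0..T}" by (force simp: image_iff)
  moreover have "g t \<in> {0..T}" if "t \<in> {0..T}" for t
    using sm[of 0 t] sm[of t T] that T g(2,3) by (cases "t = 0"; cases "t = T") auto
  ultimately have "g ` {0..T} = {0..T}" by blast
  then show ?thesis using sm by (auto simp: time_changes_def strict_mono_on_def)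
qed

text \<open>The map takes each breakpoint \<open>t i\<close> to \<open>s i\<close>. It serves two
  purposes: moving the jumps of a step path onto a grid, and making all its cells equally
  long.\<close>

lemma piecewise_linear_time_change:
  fixes t s :: "nat \<Rightarrow> real"
  assumes t: "strict_mono t" "t 0 = 0" "t m = T" and s: "strict_mono s" "s 0 = 0" "s m = T" and m: "m > 0"
  obtains g L where "g \<in> time_changes T" "0 < L" "bilipschitz_on T L g" "g 0 = 0" "g T = T"
    "\<And>i u. i < m \<Longrightarrow> t i \<le> u \<Longrightarrow> u < t (Suc i) \<Longrightarrow> s i \<le> g u \<and> g u < s (Suc i)"
    "\<And>e u. (\<And>i. i \<le> m \<Longrightarrow> \<bar>s i - t i\<bar> \<le> e) \<Longrightarrow> u \<in> {0..T} \<Longrightarrow> \<bar>g u - u\<bar> \<le> e"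
proof -
  \<comment> \<open>\<open>c i u\<close> is the length of the part of the \<open>i\<close>-th cell
    to the left of \<open>u\<close>. Writing \<open>g\<close> as a sum of slope times length makes
    both Lipschitz bounds termwise.\<close>
  define c where "c i u = max (t i) (min u (t (Suc i))) - t i" for i u
  define a where "a i = (s (Suc i) - s i) / (t (Suc i) - t i)" for i
  define g where "g u = (\<Sum>i<m. a i * c i u)" for u
  have tS: "t i < t (Suc i)" and sS: "s i < s (Suc i)" for i using t s by (auto simp: strict_mono_Suc_iff)
  have tle: "i \<le> j \<Longrightarrow> t i \<le> t j" for i j using t(1) by (simp add: strict_mono_less_eq)
  have T: "0 < T" using t m by (metis strict_mono_less)
  have a0: "a i > 0" for i using tS sS by (simp add: a_def)
  have c_mono: "u \<le> v \<Longrightarrow> c i u \<le> c i v" for i u v by (auto simp: c_def)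
  have c_sum: "(\<Sum>i<k. c i u) = min u (t k)" if "0 \<le> u" for u k
  proof (induction k)
    case 0 then show ?case using that t by simp
  next
    case (Suc k) then show ?case using tS[of k] by (auto simp: c_def)
  qed
  have piece: "g u = s i + a i * (u - t i)" if i: "i < m" and u: "t i \<le> u" "u \<le> t (Suc i)" for i u
  proof -
    have "(\<Sum>j<k. a j * c j u) = (if k \<le> i then s k else s i + a i * (u - t i))" for k
    proof (induction k)
      case 0 then show ?case using s by simp
    next
      case (Suc k)
      consider "k < i" | "k = i" | "k > i" by linarith
      then show ?case
      proof cases
        case 1
        then have "c k u = t (Suc k) - t k" using tle[of "Suc k" i] u(1) tS[of k] by (auto simp: c_def)
        then have "a k * c k u = s (Suc k) - s k" using tS[of k] by (simp add: a_def)
        then show ?thesis using Suc.IH 1 by simp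
      next
        case 2
        then have "c k u = u - t k" using u by (auto simp: c_def)
        then show ?thesis using Suc.IH 2 by simp
      next
        case 3
        then have "c k u = 0" using tle[of "Suc i" k] u(2) tS[of k] by (auto simp: c_def)
        then show ?thesis using Suc.IH 3 by simp
      qed
    qed
    then show ?thesis using i by (simp add: g_def)
  qed
  have at: "a i * (t (Suc i) - t i) = s (Suc i) - s i" for i using tS[of i] by (simp add: a_def)
  have g0: "g 0 = 0" using piece[of 0 0] m t s tS[of 0] by simp
  have gT: "g T = T" using piece[of "m - 1" T] m t s tS[of "m - 1"] at[of "m - 1"] by simp
  \<comment> \<open>A sum in place of a maximum; it dominates every slope and every inverse
    slope.\<close>
  define L where "L = (\<Sum>i<m. a i + 1 / a i)"
  have La: "a i \<le> L" "1 / a i \<le> L" if "i < m" for i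
  proof -
    have "a i + 1 / a i \<le> L" unfolding L_def using that a0 by (intro member_le_sum) (auto simp: less_imp_le)
    moreover have "a i > 0" "1 / a i > 0" using a0 by auto
    ultimately show "a i \<le> L" "1 / a i \<le> L" by linarith+
  qed
  have L: "L > 0" using La(1)[OF m] a0[of 0] by linarith
  have bl: "bilipschitz_on T L g"
    unfolding bilipschitz_on_def
  proof (intro ballI impI)
    fix u v assume u: "u \<in> {0..T}" and v: "v \<in> {0..T}" and uv: "u \<le> v"
    have c: "(\<Sum>i<m. c i v - c i u) = v - u" using c_sum[of u m] c_sum[of v m] u v t by (simp add: sum_subtractf)
    have g: "g v - g u = (\<Sum>i<m. a i * (c i v - c i u))" by (simp add: g_def sum_subtractf right_diff_distrib)
    have "g v - g u \<le> (\<Sum>i<m. L * (c i v - c i u))"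
      unfolding g using La c_mono[OF uv] by (intro sum_mono mult_right_mono) auto
    also have "\<dots> = L * (v - u)" using c by (simp add: sum_distrib_left[symmetric])
    finally have 1: "g v - g u \<le> L * (v - u)" .
    have "v - u = (\<Sum>i<m. 1 * (c i v - c i u))" using c by simp
    also have "\<dots> \<le> (\<Sum>i<m. (L * a i) * (c i v - c i u))"
    proof (intro sum_mono mult_right_mono)
      fix i assume "i \<in> {..<m}"
      then have "1 / a i \<le> L" using La by simp
      then show "1 \<le> L * a i" using a0[of i] by (simp add: field_simps)
      show "0 \<le> c i v - c i u" using c_mono[OF uv] by simp
    qed
    also have "\<dots> = L * (g v - g u)" unfolding g by (simp add: sum_distrib_left mult.assoc)
    finally show "v - u \<le> L * (g v - g u) \<and> g v - g u \<le> L * (v - u)" using 1 by simp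
  qed
  have in_piece: "s i \<le> g u \<and> g u < s (Suc i)" if "i < m" "t i \<le> u" "u < t (Suc i)" for i u
  proof -
    have "a i * (u - t i) < a i * (t (Suc i) - t i)" using that a0 by simp
    moreover have "0 \<le> a i * (u - t i)" using that a0[of i] by simp
    ultimately show ?thesis using piece[of i u] that at[of i] by simp
  qed
  have find: "\<exists>i<k. t i \<le> u \<and> u \<le> t (Suc i)" if "0 \<le> u" "u \<le> t k" "k > 0" for u k
    using that
  proof (induction k)
    case (Suc k)
    show ?case
    proof (cases "k > 0 \<and> u \<le> t k")
      case True
      then show ?thesis using Suc by (meson less_Suc_eq)
    next
      case False
      then have "t k \<le> u" using Suc.prems t by (cases "k = 0") auto
      then show ?thesis using Suc.prems by blast
    qed
  qed simp
  have near: "\<bar>g u - u\<bar> \<le> e" if e: "\<And>i. i \<le> m \<Longrightarrow> \<bar>s i - t i\<bar> \<le> e" and u: "u \<in> {0..T}" for e u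
  proof -
    obtain i where i: "i < m" "t i \<le> u" "u \<le> t (Suc i)" using find[of u m] u t m by auto
    \<comment> \<open>On one cell \<open>g u - u\<close> is a convex combination of the errors at
      the two ends.\<close>
    define \<theta> where "\<theta> = (u - t i) / (t (Suc i) - t i)"
    have \<theta>: "0 \<le> \<theta>" "\<theta> \<le> 1" using i tS[of i] by (auto simp: \<theta>_def)
    have u_eq: "u - t i = \<theta> * (t (Suc i) - t i)" using tS[of i] by (simp add: \<theta>_def)
    have "g u - u = s i + \<theta> * (a i * (t (Suc i) - t i)) - (t i + \<theta> * (t (Suc i) - t i))"
      using piece[OF i] u_eq by (simp add: algebra_simps)
    also have "\<dots> = (1 - \<theta>) * (s i - t i) + \<theta> * (s (Suc i) - t (Suc i))"
      unfolding at by (simp add: algebra_simps)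
    finally have "\<bar>g u - u\<bar> \<le> \<bar>(1 - \<theta>) * (s i - t i)\<bar> + \<bar>\<theta> * (s (Suc i) - t (Suc i))\<bar>" by (metis abs_triangle_ineq)
    also have "\<dots> = (1 - \<theta>) * \<bar>s i - t i\<bar> + \<theta> * \<bar>s (Suc i) - t (Suc i)\<bar>" using \<theta> by (simp add: abs_mult)
    also have "\<dots> \<le> (1 - \<theta>) * e + \<theta> * e" using \<theta> e i by (intro add_mono mult_left_mono) auto
    finally show ?thesis by (simp add: algebra_simps)
  qed
  show ?thesis
    using that[OF bilipschitz_time_change[OF T L bl g0 gT] L bl g0 gT] in_piece near by blast
qed

context Metric_space
begin

lemma cadlag_reparam:
  assumes x: "x \<in> cadlag_paths T" and g: "g \<in> time_changes T"
  shows "restrict (x \<circ> g) {0..T} \<in> cadlag_paths T"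
proof -
  have gm: "\<And>a b. a \<in> {0..T} \<Longrightarrow> b \<in> {0..T} \<Longrightarrow> a < b \<Longrightarrow> g a < g b"
    and im: "g ` {0..T} = {0..T}" using g by (auto simp: time_changes_def strict_mono_on_def)
  have gI: "g t \<in> {0..T}" if "t \<in> {0..T}" for t using im that by blast
  have r: "\<forall>\<^sub>F s in at_right t. Q (g s)" if t: "t \<in> {0..<T}" and Q: "\<forall>\<^sub>F s in at_right (g t). Q s" for t Q
  proof -
    obtain b where b: "b > g t" "\<And>y. g t < y \<Longrightarrow> y < b \<Longrightarrow> Q y" using Q by (auto simp: eventually_at_right_field)
    obtain \<delta> where \<delta>: "\<delta> > 0" "\<And>s. s \<in> {0..T} \<Longrightarrow> \<bar>s - t\<bar> < \<delta> \<Longrightarrow> \<bar>g s - g t\<bar> < b - g t"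
      using time_change_continuous[OF g, of t "b - g t"] b t by auto
    have "Q (g s)" if "t < s" "s < min T (t + \<delta>)" for s
      using b(2)[of "g s"] \<delta>(2)[of s] gm[of t s] that t by auto
    then show ?thesis using t \<delta> unfolding eventually_at_right_field by (intro exI[of _ "min T (t + \<delta>)"]) auto
  qed
  have l: "\<forall>\<^sub>F s in at_left t. Q (g s)" if t: "t \<in> {0<..T}" and Q: "\<forall>\<^sub>F s in at_left (g t). Q s" for t Q
  proof -
    obtain b where b: "b < g t" "\<And>y. b < y \<Longrightarrow> y < g t \<Longrightarrow> Q y" using Q by (auto simp: eventually_at_left_field)
    obtain \<delta> where \<delta>: "\<delta> > 0" "\<And>s. s \<in> {0..T} \<Longrightarrow> \<bar>s - t\<bar> < \<delta> \<Longrightarrow> \<bar>g s - g t\<bar> < g t - b"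
      using time_change_continuous[OF g, of t "g t - b"] b t by auto
    have "Q (g s)" if "s < t" "s > max 0 (t - \<delta>)" for s
      using b(2)[of "g s"] \<delta>(2)[of s] gm[of s t] that t by auto
    then show ?thesis using t \<delta> unfolding eventually_at_left_field by (intro exI[of _ "max 0 (t - \<delta>)"]) auto
  qed
  let ?z = "restrict (x \<circ> g) {0..T}"
  have xM: "x t \<in> M" if "t \<in> {0..T}" for t using x that by (auto simp: cadlag_paths_def)
  have "limitin mtopology ?z (?z t) (at_right t)" if t: "t \<in> {0..<T}" for t
  proof -
    have gt: "g t \<in> {0..<T}" using gI[of t] gI[of T] gm[of t T] t by auto
    then have lim: "limitin mtopology x (x (g t)) (at_right (g t))" using x by (auto simp: cadlag_paths_def)
    have ev: "\<forall>\<^sub>F s in at_right t. s \<in> {0..T}"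
      using t by (auto simp: eventually_at_right_field intro!: exI[of _ T])
    show ?thesis
      unfolding limitin_metric
    proof (intro conjI allI impI)
      show "?z t \<in> M" using t gI xM by auto
      fix e :: real assume "e > 0"
      then have "\<forall>\<^sub>F s in at_right (g t). x s \<in> M \<and> d (x s) (x (g t)) < e" using lim by (auto simp: limitin_metric)
      from r[OF t this] ev show "\<forall>\<^sub>F s in at_right t. ?z s \<in> M \<and> d (?z s) (?z t) < e"
        by eventually_elim (use t in auto)
    qed
  qed
  moreover have "\<exists>l. limitin mtopology ?z l (at_left t)" if t: "t \<in> {0<..T}" for t
  proof -
    have gt: "g t \<in> {0<..T}" using gI[of t] gI[of 0] gm[of 0 t] t by auto
    then obtain l' where lim: "limitin mtopology x l' (at_left (g t))" using x unfolding cadlag_paths_def by blast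
    have ev: "\<forall>\<^sub>F s in at_left t. s \<in> {0..T}"
      using t by (auto simp: eventually_at_left_field intro!: exI[of _ 0])
    have "limitin mtopology ?z l' (at_left t)"
      unfolding limitin_metric
    proof (intro conjI allI impI)
      show "l' \<in> M" using lim limitin_mspace by blast
      fix e :: real assume "e > 0"
      then have "\<forall>\<^sub>F s in at_left (g t). x s \<in> M \<and> d (x s) l' < e" using lim by (auto simp: limitin_metric)
      from l[OF t this] ev show "\<forall>\<^sub>F s in at_left t. ?z s \<in> M \<and> d (?z s) l' < e"
        by eventually_elim auto
    qed
    then show ?thesis by blast
  qed
  moreover have "?z \<in> {0..T} \<rightarrow>\<^sub>E M" using gI xM by auto
  ultimately show ?thesis unfolding cadlag_paths_def by blast
qed

text \<open>With \<open>g'\<close> inverse to \<open>g\<close>, the time change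
  \<open>g' \<circ> h\<close> carries one path onto the other without any error in space, whatever
  the jumps of \<open>x\<close>. The error in time is at most \<open>L\<close> times the distance of
  \<open>h\<close> and \<open>g\<close>, since \<open>g'\<close> has Lipschitz constant
  \<open>L\<close>.\<close>

lemma skorokhod_close_reparam:
  assumes x: "x \<in> cadlag_paths T" and g: "g \<in> time_changes T" "bilipschitz_on T L g" "0 < L"
    and h: "h \<in> time_changes T" and near: "\<And>t. t \<in> {0..T} \<Longrightarrow> \<bar>h t - g t\<bar> \<le> e"
  shows "skorokhod_close T (restrict (x \<circ> h) {0..T}) (restrict (x \<circ> g) {0..T}) (L * \<bar>e\<bar>)"
proof -
  obtain g' where g': "g' \<in> time_changes T" "\<And>t. t \<in> {0..T} \<Longrightarrow> g (g' t) = t"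
    using time_change_inverse[OF g(1)] by blast
  have hI: "h t \<in> {0..T}" and g'I: "g' t \<in> {0..T}" if "t \<in> {0..T}" for t
    using h g'(1) that unfolding time_changes_def by blast+
  have "\<bar>(g' \<circ> h) t - t\<bar> \<le> L * \<bar>e\<bar> \<and> d (restrict (x \<circ> h) {0..T} t) (restrict (x \<circ> g) {0..T} ((g' \<circ> h) t)) \<le> L * \<bar>e\<bar>"
    if t: "t \<in> {0..T}" for t
  proof -
    define u where "u = g' (h t)"
    have u: "u \<in> {0..T}" "g u = h t" using g'I[OF hI[OF t]] g'(2)[OF hI[OF t]] by (auto simp: u_def)
    have "\<bar>u - t\<bar> \<le> L * \<bar>g u - g t\<bar>"
    proof (cases "u \<le> t")
      case True
      then have "t - u \<le> L * (g t - g u)" using g(2) u(1) t unfolding bilipschitz_on_def by blast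
      also have "\<dots> \<le> L * \<bar>g u - g t\<bar>" using g(3) by simp
      finally show ?thesis using True by simp
    next
      case False
      then have "u - t \<le> L * (g u - g t)" using g(2) u(1) t unfolding bilipschitz_on_def by (meson linear)
      also have "\<dots> \<le> L * \<bar>g u - g t\<bar>" using g(3) by simp
      finally show ?thesis using False by simp
    qed
    also have "\<dots> \<le> L * \<bar>e\<bar>" using near[OF t] u(2) g(3) by simp
    finally have 1: "\<bar>u - t\<bar> \<le> L * \<bar>e\<bar>" .
    have "x (h t) \<in> M" using x hI[OF t] by (auto simp: cadlag_paths_def)
    then show ?thesis using 1 u t g(3) by (simp add: u_def)
  qed
  then show ?thesis unfolding skorokhod_close_def using time_change_compose[OF h g'(1)] by blast
qed

text \<open>\<open>x\<close> may jump, so the paths themselves are not equicontinuous. Arzela-Ascoli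
  is applied to the time changes, and their uniform convergence suffices by
  \<open>skorokhod_close_reparam\<close>.\<close>

lemma compactin_reparam:
  assumes T: "0 < T" and L: "0 < L" and x: "x \<in> cadlag_paths T"
  shows "compactin (skorokhod_topology T) (reparams T L x)"
proof -
  let ?\<Phi> = "\<lambda>g. restrict (x \<circ> g) {0..T}" and ?G = "{g. bilipschitz_on T L g \<and> g 0 = 0 \<and> g T = T}"
  interpret Sk: Metric_space "cadlag_paths T" "skorokhod_dist T" by (rule Metric_space_skorokhod)
  have tc: "g \<in> time_changes T" if "g \<in> ?G" for g using that bilipschitz_time_change[OF T L] by blast
  have \<Phi>D: "?\<Phi> g \<in> cadlag_paths T" if "g \<in> ?G" for g using cadlag_reparam[OF x tc[OF that]] .
  have "\<exists>l r. l \<in> ?\<Phi> ` ?G \<and> strict_mono r \<and> limitin Sk.mtopology (z \<circ> r) l sequentially"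
    if z: "range z \<subseteq> ?\<Phi> ` ?G" for z :: "nat \<Rightarrow> _"
  proof -
    have "\<forall>n. \<exists>g. g \<in> ?G \<and> z n = ?\<Phi> g" using z by (auto simp: image_subset_iff)
    from choice[OF this] obtain h where "\<forall>n. h n \<in> ?G \<and> z n = ?\<Phi> (h n)" by blast
    then have h: "h n \<in> ?G" "z n = ?\<Phi> (h n)" for n by blast+
    have bl: "t - s \<le> L * (h n t - h n s)" "h n t - h n s \<le> L * (t - s)"
      if "s \<in> {0..T}" "t \<in> {0..T}" "s \<le> t" for s t n
      using h(1)[of n] that unfolding bilipschitz_on_def by blast+
    have md: "\<exists>\<delta>>0. \<exists>N. \<forall>n\<ge>N. \<forall>s\<in>{0..T}. \<forall>t\<in>{0..T}. \<bar>s - t\<bar> \<le> \<delta> \<longrightarrow> dist (h n s) (h n t) \<le> e"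
      if "e > 0" for e
    proof -
      have "dist (h n s) (h n t) \<le> e" if st: "s \<in> {0..T}" "t \<in> {0..T}" "\<bar>s - t\<bar> \<le> e / L" for n s t
      proof -
        have le: "L * \<bar>s - t\<bar> \<le> e" using st(3) L by (simp add: field_simps)
        have "\<bar>h n s - h n t\<bar> \<le> L * \<bar>s - t\<bar>"
        proof (cases "s \<le> t")
          case True
          have "0 \<le> L * (h n t - h n s)" using bl(1)[OF st(1,2) True, of n] True by linarith
          then have "h n s \<le> h n t" using L by (simp add: zero_le_mult_iff)
          then show ?thesis using bl(2)[OF st(1,2) True, of n] True by simp
        next
          case False
          then have ts: "t \<le> s" by simp
          have "0 \<le> L * (h n s - h n t)" using bl(1)[OF st(2,1) ts, of n] ts by linarith
          then have "h n t \<le> h n s" using L by (simp add: zero_le_mult_iff)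
          then show ?thesis using bl(2)[OF st(2,1) ts, of n] ts by simp
        qed
        then show ?thesis using le by (simp add: dist_real_def)
      qed
      then show ?thesis using that L by (intro exI[of _ "e / L"]) auto
    qed
    have pr: "compactin Met_TC.mtopology (Met_TC.mcball a B)" for a B :: real by simp
    obtain r :: "nat \<Rightarrow> nat" and g where r: "strict_mono r"
      and u: "\<And>e. e > 0 \<Longrightarrow> \<exists>N. \<forall>n\<ge>N. \<forall>t\<in>{0..T}. dist (h (r n) t) (g t) \<le> e"
    proof (rule Met_TC.asymptotic_Arzela_Ascoli[of T "0::real" h])
      show "h n 0 = 0" for n using h(1) by simp
      show "compactin Met_TC.mtopology (Met_TC.mcball a B)" for a B :: real by (rule pr)
      show "\<exists>\<delta>>0. \<exists>N. \<forall>n\<ge>N. \<forall>s\<in>{0..T}. \<forall>t\<in>{0..T}. \<bar>s - t\<bar> \<le> \<delta> \<longrightarrow> dist (h n s) (h n t) \<le> e"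
        if "e > 0" for e by (rule md[OF that])
    qed (use T in blast)+
    have lim: "(\<lambda>n. h (r n) t) \<longlonglongrightarrow> g t" if "t \<in> {0..T}" for t
      unfolding lim_sequentially
    proof (intro allI impI)
      fix e :: real assume "e > 0"
      then obtain N where "\<forall>n\<ge>N. \<forall>t\<in>{0..T}. dist (h (r n) t) (g t) \<le> e/2" using u[of "e/2"] by auto
      then show "\<exists>N. \<forall>n\<ge>N. dist (h (r n) t) (g t) < e" using that \<open>e > 0\<close> by (intro exI[of _ N]) fastforce
    qed
    have gG: "g \<in> ?G"
    proof (intro CollectI conjI)
      show "g 0 = 0" using LIMSEQ_unique[OF lim[of 0], of 0] h(1) T by simp
      show "g T = T" using LIMSEQ_unique[OF lim[of T], of T] h(1) T by simp
      show "bilipschitz_on T L g"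
        unfolding bilipschitz_on_def
      proof (intro ballI impI conjI)
        fix s t assume st: "s \<in> {0..T}" "t \<in> {0..T}" "s \<le> t"
        have l: "(\<lambda>n. h (r n) t - h (r n) s) \<longlonglongrightarrow> g t - g s" using lim st by (intro tendsto_diff) auto
        show "t - s \<le> L * (g t - g s)"
          by (rule LIMSEQ_le_const[OF tendsto_mult_left[OF l, of L]]) (use bl st in auto)
        show "g t - g s \<le> L * (t - s)"
          by (rule LIMSEQ_le_const2[OF l]) (use bl st in auto)
      qed
    qed
    have "limitin Sk.mtopology (z \<circ> r) (?\<Phi> g) sequentially"
      unfolding Sk.limitin_metric eventually_sequentially
    proof (intro conjI allI impI)
      show "?\<Phi> g \<in> cadlag_paths T" by (rule \<Phi>D[OF gG])
      fix e :: real assume e: "e > 0"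
      then have e2: "e / (2 * L) > 0" using L by simp
      from u[OF this] obtain N where N: "\<And>n t. n \<ge> N \<Longrightarrow> t \<in> {0..T} \<Longrightarrow> dist (h (r n) t) (g t) \<le> e / (2 * L)" by blast
      have "skorokhod_dist T (?\<Phi> (h (r n))) (?\<Phi> g) < e" if n: "n \<ge> N" for n
      proof -
        have "skorokhod_close T (?\<Phi> (h (r n))) (?\<Phi> g) (L * \<bar>e / (2 * L)\<bar>)"
          using gG N[OF n] by (intro skorokhod_close_reparam[OF x tc[OF gG] _ L tc[OF h(1)]]) (auto simp: dist_real_def)
        moreover have "L * \<bar>e / (2 * L)\<bar> = e / 2" using L e by simp
        ultimately have "skorokhod_close T (?\<Phi> (h (r n))) (?\<Phi> g) (e / 2)" by (simp only:)
        moreover have "0 < e / 2" "e / 2 < e" using e by auto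
        ultimately show ?thesis
          unfolding skorokhod_dist_less_iff[OF \<Phi>D[OF h(1)] \<Phi>D[OF gG]] by blast
      qed
      then show "\<exists>N. \<forall>n\<ge>N. (z \<circ> r) n \<in> cadlag_paths T \<and> skorokhod_dist T ((z \<circ> r) n) (?\<Phi> g) < e"
        using h \<Phi>D by (intro exI[of _ N]) auto
    qed
    then show ?thesis using r gG by blast
  qed
  moreover have "?\<Phi> ` ?G \<subseteq> cadlag_paths T" using \<Phi>D by blast
  ultimately show ?thesis unfolding skorokhod_topology_def Sk.compactin_sequentially reparams_def by blast
qed

end

section \<open>Step paths and their sampling on uniform grids\<close>

lemma partition_find:
  fixes t :: "nat \<Rightarrow> real"
  assumes "t 0 \<le> u" "u < t m"
  obtains i where "i < m" "t i \<le> u" "u < t (Suc i)"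
proof -
  have "\<exists>i<m. t i \<le> u \<and> u < t (Suc i)" using assms
  proof (induction m)
    case (Suc m)
    show ?case
    proof (cases "u < t m")
      case True
      then show ?thesis using Suc by (meson less_Suc_eq)
    next
      case False
      then show ?thesis using Suc.prems by (intro exI[of _ m]) auto
    qed
  qed simp
  then show ?thesis using that by blast
qed

text \<open>The last entry of \<open>vs\<close> is the value at the single time \<open>T\<close>.\<close>

definition grid_path :: "real \<Rightarrow> 'a list \<Rightarrow> real \<Rightarrow> 'a" where
  "grid_path T vs = restrict (\<lambda>u. vs ! nat \<lfloor>u * real (length vs - 1) / T\<rfloor>) {0..T}"

lemma grid_path_piece:
  assumes "0 < T" "i < m" "length vs = Suc m" "real i * T / real m \<le> u" "u < real (Suc i) * T / real m"
  shows "grid_path T vs u = vs ! i"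
proof -
  have "real i \<le> u * real m / T" "u * real m / T < real i + 1" using assms by (auto simp: field_simps)
  then have "\<lfloor>u * real m / T\<rfloor> = int i" by (intro floor_unique) auto
  moreover have "u \<in> {0..T}"
  proof -
    have "0 \<le> real i * T / real m" using assms by simp
    moreover have "real (Suc i) * T / real m \<le> T" using assms by (simp add: divide_le_eq mult.commute)
    ultimately show ?thesis using assms(4,5) unfolding atLeastAtMost_iff by linarith
  qed
  ultimately show ?thesis using assms(3) by (simp add: grid_path_def)
qed

lemma grid_path_end: "0 < T \<Longrightarrow> length vs = Suc m \<Longrightarrow> grid_path T vs T = vs ! m"
  by (simp add: grid_path_def)

context Metric_space
begin

lemma cadlag_step:
  fixes t :: "nat \<Rightarrow> real"
  assumes x: "x \<in> {0..T} \<rightarrow>\<^sub>E M" and t: "t 0 = 0" "t m = T"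
    and const: "\<And>i u. i < m \<Longrightarrow> t i \<le> u \<Longrightarrow> u < t (Suc i) \<Longrightarrow> x u = x (t i)"
    and tI: "\<And>i. i \<le> m \<Longrightarrow> t i \<in> {0..T}"
  shows "x \<in> cadlag_paths T"
proof -
  have lim: "limitin mtopology x l F" if "\<forall>\<^sub>F s in F. x s = l" "l \<in> M" for l F
    unfolding limitin_metric using that by (auto elim: eventually_mono)
  have "limitin mtopology x (x u) (at_right u)" if u: "u \<in> {0..<T}" for u
  proof -
    obtain i where i: "i < m" "t i \<le> u" "u < t (Suc i)" using partition_find[of t u m] u t by auto
    have "\<forall>\<^sub>F s in at_right u. x s = x u"
      unfolding eventually_at_right_field
    proof (intro exI[of _ "t (Suc i)"] conjI allI impI)
      fix s assume "u < s" "s < t (Suc i)"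
      then show "x s = x u" using const[OF i] const[OF i(1), of s] i by simp
    qed (rule i(3))
    then show ?thesis by (rule lim) (use u x in auto)
  qed
  moreover have "\<exists>l. limitin mtopology x l (at_left u)" if u: "u \<in> {0<..T}" for u
  proof -
    \<comment> \<open>A left limit asks for a cell that is open on the left and closed on the right,
      unlike those of \<open>partition_find\<close>.\<close>
    have "\<exists>i<m. t i < u \<and> u \<le> t (Suc i)" if "0 < u" "u \<le> t m" for m
      using that
    proof (induction m)
      case 0 then show ?case using t(1) by auto
    next
      case (Suc m)
      show ?case
      proof (cases "u \<le> t m")
        case True
        then obtain i where "i < m" "t i < u" "u \<le> t (Suc i)" using Suc by blast
        then show ?thesis by (intro exI[of _ i]) auto
      next
        case False
        then show ?thesis using Suc.prems by (intro exI[of _ m]) auto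
      qed
    qed
    from this[of m] obtain i where i: "i < m" "t i < u" "u \<le> t (Suc i)" using u t(2) by auto
    have "\<forall>\<^sub>F s in at_left u. x s = x (t i)"
      unfolding eventually_at_left_field using i by (intro exI[of _ "t i"]) (auto intro: const[OF i(1)])
    then have "limitin mtopology x (x (t i)) (at_left u)" by (rule lim) (use tI[of i] i x in auto)
    then show ?thesis by blast
  qed
  ultimately show ?thesis using x by (auto simp: cadlag_paths_def)
qed

lemma cadlag_grid_path:
  assumes T: "0 < T" and vs: "set vs \<subseteq> M" "length vs = Suc m" "m > 0"
  shows "grid_path T vs \<in> cadlag_paths T"
proof (rule cadlag_step[of _ _ "\<lambda>i. real i * T / real m" m])
  have "nat \<lfloor>u * real m / T\<rfloor> < Suc m" if "u \<in> {0..T}" for u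
  proof -
    have "u * real m / T \<le> real m" using that T by (auto simp: divide_le_eq mult.commute intro: mult_right_mono)
    then have "\<lfloor>u * real m / T\<rfloor> \<le> int m" by linarith
    then show ?thesis by linarith
  qed
  then show "grid_path T vs \<in> {0..T} \<rightarrow>\<^sub>E M"
    using vs by (auto simp: grid_path_def subset_iff)
  show "grid_path T vs u = grid_path T vs (real i * T / real m)"
    if "i < m" "real i * T / real m \<le> u" "u < real (Suc i) * T / real m" for i u
    using grid_path_piece[OF T that(1) vs(2) that(2,3)] grid_path_piece[OF T that(1) vs(2), of "real i * T / real m"] T that(1)
    by (simp add: divide_strict_right_mono)
  show "real i * T / real m \<in> {0..T}" if "i \<le> m" for i
    using that T vs(3) by (auto simp: divide_le_eq mult.commute)
qed (use vs in auto)

text \<open>The gap is required past \<open>m\<close> too; this makes \<open>t\<close> strictly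
  monotone as a whole sequence, as \<open>piecewise_linear_time_change\<close> asks. The size
  \<open>\<gamma>\<close> of the gap tells how fine a grid must be to separate the cells.\<close>

definition step_partition :: "real \<Rightarrow> (real \<Rightarrow> 'a) \<Rightarrow> (nat \<Rightarrow> real) \<Rightarrow> nat \<Rightarrow> real \<Rightarrow> bool" where
  "step_partition T x t m \<gamma> \<longleftrightarrow> m > 0 \<and> \<gamma> > 0 \<and> (\<forall>i. t i + \<gamma> \<le> t (Suc i)) \<and> t 0 = 0 \<and> t m = T \<and>
     (\<forall>i u. i < m \<longrightarrow> t i \<le> u \<longrightarrow> u < t (Suc i) \<longrightarrow> x u = x (t i))"

text \<open>Since distinct values of the path are \<open>r\<close> apart, a one-sided limit forces
  the path to be constant on that side near the given time. Bisection turns this local statement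
  into finitely many jump times.\<close>

lemma cadlag_discrete_step:
  assumes T: "0 < T" and x: "x \<in> cadlag_paths T" and r: "r > 0"
    and disc: "\<And>s t. s \<in> {0..T} \<Longrightarrow> t \<in> {0..T} \<Longrightarrow> x s \<noteq> x t \<Longrightarrow> r \<le> d (x s) (x t)"
  shows "\<exists>t m \<gamma>. step_partition T x t m \<gamma>"
proof -
  \<comment> \<open>\<open>S\<close> contains all times at which the path may change between
    \<open>a\<close> and \<open>b\<close>. The clipping to \<open>{0..T}\<close> admits intervals
    that stick out of it, as they occur in \<open>Bolzano\<close>.\<close>
  define Q where "Q a b S \<longleftrightarrow> (\<forall>u v. max 0 a \<le> u \<longrightarrow> u < v \<longrightarrow> v \<le> min T b \<longrightarrow> S \<inter> {u<..v} = {} \<longrightarrow> x u = x v)" for a b S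
  have xM: "x t \<in> M" if "t \<in> {0..T}" for t using x that by (auto simp: cadlag_paths_def)
  have "\<exists>S. finite S \<and> Q 0 T S"
  proof (rule Bolzano[of 0 T "\<lambda>a b. \<exists>S. finite S \<and> Q a b S"])
    show "0 \<le> T" using T by simp
    fix a b c assume "\<exists>S. finite S \<and> Q a b S" "\<exists>S. finite S \<and> Q b c S" "a \<le> b" "b \<le> c"
    then obtain S1 S2 where S: "finite S1" "Q a b S1" "finite S2" "Q b c S2" by blast
    have "Q a c (insert b (S1 \<union> S2))"
      unfolding Q_def
    proof (intro allI impI)
      fix u v assume uv: "max 0 a \<le> u" "u < v" "v \<le> min T c" "insert b (S1 \<union> S2) \<inter> {u<..v} = {}"
      then have "b \<le> u \<or> v < b" by auto
      then show "x u = x v"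
      proof
        assume "b \<le> u"
        then show ?thesis using S(4)[unfolded Q_def, rule_format, of u v] uv by auto
      next
        assume "v < b"
        then show ?thesis using S(2)[unfolded Q_def, rule_format, of u v] uv by auto
      qed
    qed
    then show "\<exists>S. finite S \<and> Q a c S" using S by (intro exI[of _ "insert b (S1 \<union> S2)"]) auto
  next
    fix p assume p: "0 \<le> p" "p \<le> T"
    have right: "\<exists>e>0. \<forall>u v. p \<le> u \<longrightarrow> u < v \<longrightarrow> v < p + e \<longrightarrow> v \<le> T \<longrightarrow> x u = x v"
    proof (cases "p < T")
      case True
      then have "limitin mtopology x (x p) (at_right p)" using x p by (auto simp: cadlag_paths_def)
      then have "\<forall>\<^sub>F s in at_right p. x s \<in> M \<and> d (x s) (x p) < r" using r by (auto simp: limitin_metric)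
      then obtain b where b: "b > p" "\<And>s. p < s \<Longrightarrow> s < b \<Longrightarrow> d (x s) (x p) < r" by (auto simp: eventually_at_right_field)
      have *: "x s = x p" if "p \<le> s" "s < b" "s \<le> T" for s
      proof (rule ccontr)
        assume ne: "x s \<noteq> x p"
        then have "p < s" using that by (cases "s = p") auto
        then show False using disc[of s p] b(2)[of s] that p ne by auto
      qed
      have "x u = x v" if "p \<le> u" "u < v" "v < p + (b - p)" "v \<le> T" for u v
      proof -
        have "x u = x p" "x v = x p" using that by (intro *; simp)+
        then show ?thesis by simp
      qed
      then show ?thesis using b(1) by (intro exI[of _ "b - p"]) simp
    qed (auto intro!: exI[of _ 1])
    \<comment> \<open>The left limit need not be a value of the path, so two values are compared
      with each other, each within \<open>r/2\<close> of the limit.\<close>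
    have left: "\<exists>e>0. \<forall>u v. p - e < u \<longrightarrow> u < v \<longrightarrow> v < p \<longrightarrow> 0 \<le> u \<longrightarrow> x u = x v"
    proof (cases "0 < p")
      case True
      then obtain l where l: "limitin mtopology x l (at_left p)" using x p unfolding cadlag_paths_def by fastforce
      then have lM: "l \<in> M" using limitin_mspace by blast
      have "\<forall>\<^sub>F s in at_left p. x s \<in> M \<and> d (x s) l < r/2"
        using l half_gt_zero[OF r] unfolding limitin_metric by blast
      then obtain b where b: "b < p" "\<And>s. b < s \<Longrightarrow> s < p \<Longrightarrow> d (x s) l < r/2" by (auto simp: eventually_at_left_field)
      have "x u = x v" if "p - (p - b) < u" "u < v" "v < p" "0 \<le> u" for u v
      proof (rule ccontr)
        assume "x u \<noteq> x v"
        then have "r \<le> d (x u) (x v)" using disc that p by auto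
        also have "\<dots> \<le> d (x u) l + d l (x v)" using that p by (intro triangle xM lM) auto
        also have "\<dots> < r" using b(2)[of u] b(2)[of v] that by (simp add: commute)
        finally show False by simp
      qed
      then show ?thesis using b(1) by (intro exI[of _ "p - b"]) simp
    qed (auto intro!: exI[of _ 1])
    obtain e1 e2 where e: "e1 > 0" "\<And>u v. p \<le> u \<Longrightarrow> u < v \<Longrightarrow> v < p + e1 \<Longrightarrow> v \<le> T \<Longrightarrow> x u = x v"
      "e2 > 0" "\<And>u v. p - e2 < u \<Longrightarrow> u < v \<Longrightarrow> v < p \<Longrightarrow> 0 \<le> u \<Longrightarrow> x u = x v"
      using left right by metis
    have "Q a b {p}" if ab: "a \<le> p \<and> p \<le> b \<and> b - a < min e1 e2" for a b
      unfolding Q_def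
    proof (intro allI impI)
      fix u v assume uv: "max 0 a \<le> u" "u < v" "v \<le> min T b" "{p} \<inter> {u<..v} = {}"
      then have "p \<le> u \<or> v < p" by auto
      then show "x u = x v" using uv ab e(2)[of u v] e(4)[of u v] by auto
    qed
    then show "\<exists>e>0. \<forall>a b. a \<le> p \<and> p \<le> b \<and> b - a < e \<longrightarrow> (\<exists>S. finite S \<and> Q a b S)"
      using e(1,3) by (intro exI[of _ "min e1 e2"]) (auto intro!: exI[of _ "{p}"])
  qed
  then obtain S where S: "finite S" "Q 0 T S" by blast
  define xs where "xs = sorted_list_of_set (insert 0 (insert T (S \<inter> {0..T})))"
  define m where "m = length xs - 1"
  \<comment> \<open>Past \<open>m\<close> the sequence continues with unit steps; this is why
    \<open>\<gamma>\<close> is also kept at most 1.\<close>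
  define t where "t i = (if i \<le> m then xs ! i else T + real (i - m))" for i
  have set: "set xs = insert 0 (insert T (S \<inter> {0..T}))"
    unfolding xs_def by (rule set_sorted_list_of_set) (use S in simp)
  have sorted: "sorted_wrt (<) xs" unfolding xs_def by (rule strict_sorted_list_of_set)
  have "card (set xs) \<le> length xs" by (rule card_length)
  moreover have "card {0, T} \<le> card (set xs)" by (rule card_mono) (use S(1) in \<open>auto simp: set\<close>)
  ultimately have len: "length xs = Suc m" "m > 0" using T by (auto simp: m_def)
  have lt: "xs ! i < xs ! j" if "i < j" "j \<le> m" for i j using sorted_wrt_nth_less[OF sorted] that len by simp
  have mem: "xs ! i \<in> {0..T}" if "i \<le> m" for i
    using nth_mem[of i xs] that len T unfolding set by auto
  have idx: "\<exists>i\<le>m. xs ! i = s" if "s \<in> set xs" for s using that len by (metis in_set_conv_nth less_Suc_eq_le)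
  have x0: "xs ! 0 = 0"
  proof -
    obtain i where i: "i \<le> m" "xs ! i = 0" using idx[of 0] set by auto
    then show ?thesis using lt[of 0 i] mem[of 0] by (cases "i = 0") auto
  qed
  have xT: "xs ! m = T"
  proof -
    obtain i where i: "i \<le> m" "xs ! i = T" using idx[of T] set by auto
    then show ?thesis using lt[of i m] mem[of m] by (cases "i = m") auto
  qed
  define \<gamma> where "\<gamma> = Min (insert 1 ((\<lambda>i. xs ! Suc i - xs ! i) ` {..<m}))"
  have \<gamma>: "\<gamma> > 0" using lt by (auto simp: \<gamma>_def)
  have \<gamma>le: "\<gamma> \<le> 1" "\<And>i. i < m \<Longrightarrow> \<gamma> \<le> xs ! Suc i - xs ! i" unfolding \<gamma>_def by (auto intro!: Min_le)
  have gap: "t i + \<gamma> \<le> t (Suc i)" for i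
  proof -
    consider "i < m" | "i = m" | "i > m" by linarith
    then show ?thesis
    proof cases
      case 1 then show ?thesis using \<gamma>le(2)[of i] by (simp add: t_def)
    next
      case 2 then show ?thesis using \<gamma>le(1) xT by (simp add: t_def)
    next
      case 3 then show ?thesis using \<gamma>le(1) by (simp add: t_def Suc_diff_le)
    qed
  qed
  have "x u = x (t i)" if i: "i < m" and u: "t i \<le> u" "u < t (Suc i)" for i u
  proof (cases "u = t i")
    case False
    have ti: "t i \<in> {0..T}" "t (Suc i) \<in> {0..T}" using mem i by (auto simp: t_def)
    have "S \<inter> {t i<..u} = {}"
    proof (rule ccontr)
      assume "S \<inter> {t i<..u} \<noteq> {}"
      then obtain s where "s \<in> S \<inter> {t i<..u}" by blast
      then have s: "s \<in> S" "t i < s" "s \<le> u" by auto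
      then have "s \<in> set xs" using ti u unfolding set by auto
      then obtain j where j: "j \<le> m" "xs ! j = s" using idx by blast
      have "i < j" using lt[of j i] s(2) j i by (cases i j rule: linorder_cases) (auto simp: t_def)
      then have "xs ! Suc i \<le> xs ! j" using lt[of "Suc i" j] j by (cases "Suc i = j") auto
      then show False using s(3) u(2) i j by (simp add: t_def)
    qed
    then have "x (t i) = x u" using S(2)[unfolded Q_def, rule_format, of "t i" u] u ti False by auto
    then show ?thesis by simp
  qed simp
  moreover have "t 0 = 0" "t m = T" using x0 xT by (auto simp: t_def)
  ultimately have "step_partition T x t m \<gamma>" unfolding step_partition_def using len(2) \<gamma> gap by blast
  then show ?thesis by blast
qed

text \<open>Sampling delays each change of the path to a grid point. Once the grid is finer than the
  shortest cell, the delayed times are still strictly increasing, so a time change with error at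
  most the grid width makes the two paths agree exactly.\<close>

lemma grid_path_tendsto:
  assumes T: "0 < T" and x: "x \<in> cadlag_paths T" and r: "r > 0"
    and disc: "\<And>s t. s \<in> {0..T} \<Longrightarrow> t \<in> {0..T} \<Longrightarrow> x s \<noteq> x t \<Longrightarrow> r \<le> d (x s) (x t)" and e: "e > 0"
  shows "\<exists>N. \<forall>n\<ge>N. skorokhod_dist T x (grid_path T (map (\<lambda>i. x (real i * T / real n)) [0..<Suc n])) < e"
proof -
  obtain t m \<gamma> where "step_partition T x t m \<gamma>" using cadlag_discrete_step[OF T x r disc] by blast
  then have m: "m > 0" and \<gamma>: "\<gamma> > 0" and gap: "\<And>i. t i + \<gamma> \<le> t (Suc i)" and t0: "t 0 = 0" and tm: "t m = T"
    and const: "\<And>i u. i < m \<Longrightarrow> t i \<le> u \<Longrightarrow> u < t (Suc i) \<Longrightarrow> x u = x (t i)"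
    unfolding step_partition_def by blast+
  have tmono: "strict_mono t" unfolding strict_mono_Suc_iff using gap \<gamma> by (smt (verit))
  obtain N where N: "real N > T / \<gamma>" "real N > 2 * T / e" using reals_Archimedean2[of "max (T / \<gamma>) (2 * T / e)"] by auto
  have "skorokhod_dist T x (grid_path T (map (\<lambda>i. x (real i * T / real n)) [0..<Suc n])) < e" if n: "n \<ge> N" for n
  proof -
    have n1: "real n > T / \<gamma>" "real n > 2 * T / e" using N n by linarith+
    have "T / \<gamma> > 0" using T \<gamma> by simp
    then have n0: "n > 0" using n1 by linarith
    \<comment> \<open>The ceiling, because a change at \<open>t i\<close> is noticed by the first
      sample taken at or after \<open>t i\<close>.\<close>
    define s where "s i = of_int \<lceil>real n * t i / T\<rceil> * T / real n" for i
    let ?vs = "map (\<lambda>i. x (real i * T / real n)) [0..<Suc n]"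
    have sceil: "s i * real n / T = of_int \<lceil>real n * t i / T\<rceil>" for i using T n0 by (simp add: s_def)
    have "s i < s (Suc i)" for i
    proof -
      have "1 \<le> real n * \<gamma> / T" using n1(1) T \<gamma> by (simp add: field_simps)
      moreover have "real n * (t i + \<gamma>) / T \<le> real n * t (Suc i) / T"
        using gap[of i] T by (intro divide_right_mono mult_left_mono) auto
      ultimately have "real n * t i / T + 1 \<le> real n * t (Suc i) / T" by (simp add: add_divide_distrib distrib_left)
      then have "\<lceil>real n * t i / T\<rceil> < \<lceil>real n * t (Suc i) / T\<rceil>" by linarith
      then show ?thesis using T n0 unfolding s_def by (intro divide_strict_right_mono mult_strict_right_mono) auto
    qed
    then have smono: "strict_mono s" by (simp add: strict_mono_Suc_iff)
    have s0: "s 0 = 0" using t0 by (simp add: s_def)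
    have sm: "s m = T" using tm T n0 by (simp add: s_def)
    have near: "\<bar>s i - t i\<bar> \<le> T / real n" for i
    proof -
      have "\<bar>of_int \<lceil>real n * t i / T\<rceil> - real n * t i / T\<bar> \<le> 1" by linarith
      then have "\<bar>of_int \<lceil>real n * t i / T\<rceil> - real n * t i / T\<bar> * (T / real n) \<le> 1 * (T / real n)"
        using T by (intro mult_right_mono) auto
      moreover have "s i - t i = (of_int \<lceil>real n * t i / T\<rceil> - real n * t i / T) * (T / real n)"
        using T n0 by (simp add: s_def field_simps)
      ultimately show ?thesis using T by (simp add: abs_mult)
    qed
    obtain g and L :: real where g: "g \<in> time_changes T" "g T = T"
      and gp: "\<And>i u. i < m \<Longrightarrow> t i \<le> u \<Longrightarrow> u < t (Suc i) \<Longrightarrow> s i \<le> g u \<and> g u < s (Suc i)"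
      and gn: "\<And>e u. (\<And>i. i \<le> m \<Longrightarrow> \<bar>s i - t i\<bar> \<le> e) \<Longrightarrow> u \<in> {0..T} \<Longrightarrow> \<bar>g u - u\<bar> \<le> e"
      by (rule piecewise_linear_time_change[OF tmono t0 tm smono s0 sm m]) blast
    have eq: "x u = grid_path T ?vs (g u)" if u: "u \<in> {0..T}" for u
    proof (cases "u = T")
      case True
      have "grid_path T ?vs T = ?vs ! n" by (rule grid_path_end[OF T]) simp
      also have "\<dots> = x (real n * T / real n)" by (simp only: nth_map_upt diff_zero add_0 lessI)
      finally show ?thesis using True g(2) n0 by simp
    next
      case False
      then obtain i where i: "i < m" "t i \<le> u" "u < t (Suc i)" using partition_find[of t u m] u t0 tm by auto
      have gu: "s i \<le> g u" "g u < s (Suc i)" using gp[OF i] by auto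
      \<comment> \<open>\<open>j\<close> is the grid cell of \<open>g u\<close>. As
        \<open>s i\<close> and \<open>s (Suc i)\<close> are grid points, the left end of this cell
        lies between \<open>t i\<close> and \<open>t (Suc i)\<close>, and the sample taken there has
        the value \<open>x u\<close>.\<close>
      define j where "j = nat \<lfloor>g u * real n / T\<rfloor>"
      have guI: "g u \<in> {0..T}" using g(1) u unfolding time_changes_def by blast
      then have f: "real j \<le> g u * real n / T" "g u * real n / T < real j + 1" using T unfolding j_def by auto
      have "of_int \<lceil>real n * t i / T\<rceil> \<le> g u * real n / T"
        unfolding sceil[symmetric] using gu T by (intro divide_right_mono mult_right_mono) auto
      then have "of_int \<lceil>real n * t i / T\<rceil> < (of_int (int j + 1) :: real)" using f by simp
      then have "\<lceil>real n * t i / T\<rceil> \<le> int j" by (simp only: of_int_less_iff)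
      then have j1: "real n * t i / T \<le> real j" by linarith
      have "g u * real n / T < of_int \<lceil>real n * t (Suc i) / T\<rceil>"
        unfolding sceil[symmetric] using gu T n0 by (intro divide_strict_right_mono mult_strict_right_mono) auto
      then have "(of_int (int j) :: real) < of_int \<lceil>real n * t (Suc i) / T\<rceil>" using f by simp
      then have "int j < \<lceil>real n * t (Suc i) / T\<rceil>" by (simp only: of_int_less_iff)
      then have "of_int (int j) < real n * t (Suc i) / T" by (simp only: less_ceiling_iff)
      then have j2: "real j < real n * t (Suc i) / T" by simp
      have tj: "t i \<le> real j * T / real n" "real j * T / real n < t (Suc i)"
        using j1 j2 T n0 by (auto simp: field_simps)
      have "t (Suc i) \<le> T" using i tmono tm by (metis Suc_leI strict_mono_less_eq)
      then have "real n * t (Suc i) / T \<le> real n * T / T" using T by (intro divide_right_mono mult_left_mono) auto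
      then have jn: "j < n" using j2 T by simp
      have "grid_path T ?vs (g u) = ?vs ! j"
        by (rule grid_path_piece[OF T jn]) (use f T n0 in \<open>auto simp: field_simps\<close>)
      also have "\<dots> = x (real j * T / real n)" using jn by (simp add: nth_append del: upt_Suc)
      also have "\<dots> = x u" using const[OF i(1) tj] const[OF i] by simp
      finally show ?thesis by simp
    qed
    have xM: "x t \<in> M" if "t \<in> {0..T}" for t using x that by (auto simp: cadlag_paths_def)
    have "set ?vs \<subseteq> M"
      using n0 T by (auto intro!: xM simp: divide_le_eq mult.commute simp del: upt_Suc)
    then have vsD: "grid_path T ?vs \<in> cadlag_paths T" using cadlag_grid_path[OF T, of ?vs n] n0 by simp
    have "skorokhod_close T x (grid_path T ?vs) (T / real n)"
      unfolding skorokhod_close_def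
    proof (intro bexI[OF _ g(1)] ballI conjI)
      fix u assume u: "u \<in> {0..T}"
      show "\<bar>g u - u\<bar> \<le> T / real n" by (rule gn[OF near u])
      show "d (x u) (grid_path T ?vs (g u)) \<le> T / real n" using eq[OF u] xM[OF u] T by simp
    qed
    moreover have "T / real n < e" using n1(2) n0 e T by (simp add: field_simps)
    moreover have "T / real n > 0" using T n0 by simp
    ultimately show ?thesis unfolding skorokhod_dist_less_iff[OF x vsD] by blast
  qed
  then show ?thesis by blast
qed

text \<open>Stretching the cells to equal length leaves a grid path, given by a finite list of
  values, while the jump times go into the time change. So countably many lists, with countably many
  bounds \<open>L\<close>, account for all paths.\<close>

lemma cadlag_discrete_reparam:
  assumes T: "0 < T" and x: "x \<in> cadlag_paths T" and r: "r > 0"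
    and disc: "\<And>s t. s \<in> {0..T} \<Longrightarrow> t \<in> {0..T} \<Longrightarrow> x s \<noteq> x t \<Longrightarrow> r \<le> d (x s) (x t)"
  obtains vs L where "length vs \<ge> 2" "set vs \<subseteq> x ` {0..T}" "L > 0"
    "x \<in> reparams T L (grid_path T vs)"
proof -
  obtain t m \<gamma> where "step_partition T x t m \<gamma>" using cadlag_discrete_step[OF T x r disc] by blast
  then have m: "m > 0" and \<gamma>: "\<gamma> > 0" and gap: "\<And>i. t i + \<gamma> \<le> t (Suc i)" and t0: "t 0 = 0" and tm: "t m = T"
    and const: "\<And>i u. i < m \<Longrightarrow> t i \<le> u \<Longrightarrow> u < t (Suc i) \<Longrightarrow> x u = x (t i)"
    unfolding step_partition_def by blast+
  have tmono: "strict_mono t" unfolding strict_mono_Suc_iff using gap \<gamma> by (smt (verit))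
  define s where "s i = real i * T / real m" for i
  have smono: "strict_mono s" unfolding strict_mono_Suc_iff s_def using T m by (simp add: divide_strict_right_mono)
  have s0: "s 0 = 0" "s m = T" using m by (auto simp: s_def)
  obtain g L where g: "g \<in> time_changes T" "0 < L" "bilipschitz_on T L g" "g 0 = 0" "g T = T"
    and gp: "\<And>i u. i < m \<Longrightarrow> t i \<le> u \<Longrightarrow> u < t (Suc i) \<Longrightarrow> s i \<le> g u \<and> g u < s (Suc i)"
    by (rule piecewise_linear_time_change[OF tmono t0 tm smono s0 m]) blast
  define vs where "vs = map (\<lambda>i. x (t i)) [0..<Suc m]"
  have len: "length vs = Suc m" by (simp add: vs_def)
  have vs_nth: "vs ! i = x (t i)" if "i \<le> m" for i using that unfolding vs_def by (simp del: upt_Suc)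
  have tI: "t i \<in> {0..T}" if "i \<le> m" for i
    using that tmono t0 tm by (metis atLeastAtMost_iff le0 strict_mono_less_eq)
  have "x u = grid_path T vs (g u)" if u: "u \<in> {0..T}" for u
  proof (cases "u = T")
    case True
    then show ?thesis using g(5) grid_path_end[OF T len] vs_nth[of m] tm by simp
  next
    case False
    then obtain i where i: "i < m" "t i \<le> u" "u < t (Suc i)" using partition_find[of t u m] u t0 tm by auto
    have "grid_path T vs (g u) = vs ! i"
      using gp[OF i] by (intro grid_path_piece[OF T i(1) len]) (auto simp: s_def)
    then show ?thesis using const[OF i] vs_nth[of i] i by simp
  qed
  then have "x = restrict (grid_path T vs \<circ> g) {0..T}"
    using x by (auto simp: cadlag_paths_def PiE_def extensional_def)
  moreover have "set vs \<subseteq> x ` {0..T}" unfolding vs_def using tI by (auto simp del: upt_Suc)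
  moreover have "length vs \<ge> 2" using len m by simp
  ultimately show ?thesis using that[of vs L] g unfolding reparams_def by blast
qed

section \<open>Measurability and tightness of a single law on step paths\<close>

text \<open>An open set need not depend on finitely many coordinates. But \<open>Y\<close> is the
  limit of its samples on uniform grids, which take countably many values and do depend on finitely
  many coordinates.\<close>

lemma measurable_skorokhod:
  assumes T: "0 < T" and V: "countable V" "V \<subseteq> M" and r: "r > 0" "\<And>x y. x \<in> V \<Longrightarrow> y \<in> V \<Longrightarrow> x \<noteq> y \<Longrightarrow> r \<le> d x y"
    and Y: "\<And>\<omega>. \<omega> \<in> space P \<Longrightarrow> Y \<omega> \<in> cadlag_paths T"
    and meas: "\<And>t. t \<in> {0..T} \<Longrightarrow> (\<lambda>\<omega>. Y \<omega> t) \<in> measurable P (count_space V)"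
  shows "Y \<in> measurable P (borel_of (skorokhod_topology T))"
proof -
  interpret Sk: Metric_space "cadlag_paths T" "skorokhod_dist T" by (rule Metric_space_skorokhod)
  have YV: "Y \<omega> t \<in> V" if "\<omega> \<in> space P" "t \<in> {0..T}" for \<omega> t
    using measurable_space[OF meas[OF that(2)] that(1)] by simp
  define sk where "sk n \<omega> = map (\<lambda>i. Y \<omega> (real i * T / real n)) [0..<Suc n]" for n \<omega>
  have grid: "real i * T / real n \<in> {0..T}" if "i \<le> n" for i n
    using that T by (cases "n = 0") (auto simp: divide_le_eq mult.commute)
  \<comment> \<open>Every set \<open>F\<close> is admissible, because only countably many lists of
    values occur.\<close>
  have sk_meas: "{\<omega> \<in> space P. grid_path T (sk n \<omega>) \<in> F} \<in> sets P" for n F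
  proof -
    have "{\<omega> \<in> space P. sk n \<omega> = vs} \<in> sets P" if vs: "vs \<in> lists V" for vs
    proof (cases "length vs = Suc n")
      case True
      have "{\<omega> \<in> space P. sk n \<omega> = vs} = (\<Inter>i\<in>{..n}. (\<lambda>\<omega>. Y \<omega> (real i * T / real n)) -` {vs ! i} \<inter> space P)"
        using True by (auto simp: sk_def list_eq_iff_nth_eq less_Suc_eq_le simp del: upt_Suc)
      also have "\<dots> \<in> sets P"
        using vs True by (intro sets.finite_INT measurable_sets[OF meas] grid) (auto simp: nth_mem less_Suc_eq_le)
      finally show ?thesis .
    next
      case False
      then have "{\<omega> \<in> space P. sk n \<omega> = vs} = {}" by (auto simp: sk_def)
      then show ?thesis by (simp only: sets.empty_sets)
    qed
    then have "(\<Union>vs\<in>{vs \<in> lists V. grid_path T vs \<in> F}. {\<omega> \<in> space P. sk n \<omega> = vs}) \<in> sets P"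
      using V by (intro sets.countable_UN') (auto intro: countable_subset[OF _ countable_lists[OF V(1)]])
    moreover have "{\<omega> \<in> space P. grid_path T (sk n \<omega>) \<in> F} = (\<Union>vs\<in>{vs \<in> lists V. grid_path T vs \<in> F}. {\<omega> \<in> space P. sk n \<omega> = vs})"
      using grid YV by (auto simp: sk_def simp del: upt_Suc)
    ultimately show ?thesis by simp
  qed
  have conv: "\<exists>N. \<forall>n\<ge>N. skorokhod_dist T (Y \<omega>) (grid_path T (sk n \<omega>)) < e" if w: "\<omega> \<in> space P" and "e > 0" for \<omega> e
    unfolding sk_def by (rule grid_path_tendsto[OF T Y[OF w] r(1) _ that(2)]) (use r(2) YV[OF w] in blast)
  have skD: "grid_path T (sk n \<omega>) \<in> cadlag_paths T" if "\<omega> \<in> space P" "n > 0" for n \<omega>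
  proof (rule cadlag_grid_path[OF T _ _ that(2)])
    show "set (sk n \<omega>) \<subseteq> M" using YV[OF that(1) grid] V(2) by (auto simp: sk_def less_Suc_eq_le simp del: upt_Suc)
  qed (simp add: sk_def)
  show ?thesis
  proof (rule measurable_sigma_sets[OF sets_borel_of])
    show "{U. openin (skorokhod_topology T) U} \<subseteq> Pow (topspace (skorokhod_topology T))" using openin_subset by blast
    show "Y \<in> space P \<rightarrow> topspace (skorokhod_topology T)" using Y by simp
    fix U assume "U \<in> {U. openin (skorokhod_topology T) U}"
    then have U: "openin Sk.mtopology U" by (simp add: skorokhod_topology_def)
    \<comment> \<open>The points of depth at least \<open>1 / real (Suc j)\<close> in
      \<open>U\<close>. The limit of the samples is in \<open>U\<close> exactly if, for some
      \<open>j\<close>, the samples are finally in \<open>F j\<close>.\<close>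
    define F where "F j = {z. Sk.mball z (1 / real (Suc j)) \<subseteq> U}" for j
    have "Y -` U \<inter> space P = (\<Union>j. \<Union>N. \<Inter>n\<in>{N..}. {\<omega> \<in> space P. grid_path T (sk n \<omega>) \<in> F j})" (is "?A = ?B")
    proof (intro equalityI subsetI)
      fix \<omega> assume w: "\<omega> \<in> ?A"
      then obtain e where e: "e > 0" "Sk.mball (Y \<omega>) e \<subseteq> U" using U unfolding Sk.openin_mtopology by blast
      then have "e/2 > 0" by simp
      then obtain j where j: "1 / real (Suc j) < e/2" by (metis nat_approx_posE)
      obtain N where N: "\<And>n. n \<ge> N \<Longrightarrow> skorokhod_dist T (Y \<omega>) (grid_path T (sk n \<omega>)) < e/2" using conv[of \<omega>, OF _ \<open>e/2 > 0\<close>] w by blast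
      have "grid_path T (sk n \<omega>) \<in> F j" if n: "n \<ge> Suc N" for n
        unfolding F_def
      proof (intro CollectI subsetI)
        fix z assume z: "z \<in> Sk.mball (grid_path T (sk n \<omega>)) (1 / real (Suc j))"
        have "skorokhod_dist T (Y \<omega>) z \<le> skorokhod_dist T (Y \<omega>) (grid_path T (sk n \<omega>)) + skorokhod_dist T (grid_path T (sk n \<omega>)) z"
          using z w Y by (intro Sk.triangle) auto
        also have "\<dots> < e" using z N[of n] n j by auto
        finally show "z \<in> U" using e z w Y by auto
      qed
      then show "\<omega> \<in> ?B" using w by (intro UN_I[of j] UN_I[of "Suc N"]) auto
    next
      fix \<omega> assume "\<omega> \<in> ?B"
      then obtain j N where w: "\<omega> \<in> space P" "\<And>n. n \<ge> N \<Longrightarrow> grid_path T (sk n \<omega>) \<in> F j" by auto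
      have "1 / real (Suc j) > 0" by simp
      from conv[OF w(1) this] obtain N' where N': "\<And>n. n \<ge> N' \<Longrightarrow> skorokhod_dist T (Y \<omega>) (grid_path T (sk n \<omega>)) < 1 / real (Suc j)" by blast
      \<comment> \<open>\<open>Suc\<close> keeps \<open>n\<close> positive, as \<open>skD\<close>
        demands.\<close>
      define n where "n = Suc (max N N')"
      have "Y \<omega> \<in> Sk.mball (grid_path T (sk n \<omega>)) (1 / real (Suc j))"
        using N'[of n] skD[OF w(1), of n] Y[OF w(1)] by (auto simp: n_def Sk.commute)
      moreover have "n \<ge> N" by (simp add: n_def)
      ultimately have "Y \<omega> \<in> U" using w(2)[of n] unfolding F_def by blast
      then show "\<omega> \<in> ?A" using w by simp
    qed
    moreover have "?B \<in> sets P" by (intro sets.countable_UN sets.countable_INT' sk_meas image_subsetI) auto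
    ultimately show "?A \<in> sets P" by simp
  qed
qed

text \<open>Countably many compact sets of reparametrised grid paths cover all paths; by continuity
  from below finitely many of them carry nearly all of the mass.\<close>

lemma discrete_law_tight:
  assumes T: "0 < T" and V: "countable V" "V \<subseteq> M" and r: "r > 0" "\<And>x y. x \<in> V \<Longrightarrow> y \<in> V \<Longrightarrow> x \<noteq> y \<Longrightarrow> r \<le> d x y"
    and P: "prob_space P"
    and Y: "\<And>\<omega>. \<omega> \<in> space P \<Longrightarrow> Y \<omega> \<in> cadlag_paths T"
    and meas: "\<And>t. t \<in> {0..T} \<Longrightarrow> (\<lambda>\<omega>. Y \<omega> t) \<in> measurable P (count_space V)" and e: "e > 0"
  shows "\<exists>K. compactin (skorokhod_topology T) K \<and> measure P (Y -` K \<inter> space P) \<ge> 1 - e"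
proof -
  interpret prob_space P by (rule P)
  interpret Sk: Metric_space "cadlag_paths T" "skorokhod_dist T" by (rule Metric_space_skorokhod)
  have Ym: "Y \<in> measurable P (borel_of (skorokhod_topology T))"
    by (rule measurable_skorokhod[OF T V r Y meas])
  have YV: "Y \<omega> t \<in> V" if "\<omega> \<in> space P" "t \<in> {0..T}" for \<omega> t
    using measurable_space[OF meas[OF that(2)] that(1)] by simp
  define I where "I = {vs \<in> lists V. length vs \<ge> 2} \<times> (UNIV :: nat set)"
  define K :: "'a list \<times> nat \<Rightarrow> (real \<Rightarrow> 'a) set" where "K = (\<lambda>(vs, L). reparams T (real (Suc L)) (grid_path T vs))"
  have Kc: "compactin (skorokhod_topology T) (K p)" if p: "p \<in> I" for p
  proof -
    obtain vs L where vs: "p = (vs, L)" "set vs \<subseteq> V" "length vs \<ge> 2" using p by (auto simp: I_def)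
    have "grid_path T vs \<in> cadlag_paths T" using cadlag_grid_path[OF T, of vs "length vs - 1"] vs V by auto
    then show ?thesis unfolding K_def vs(1) case_prod_conv by (intro compactin_reparam[OF T]) auto
  qed
  have disc: "r \<le> d (Y \<omega> s) (Y \<omega> t)" if "\<omega> \<in> space P" "s \<in> {0..T}" "t \<in> {0..T}" "Y \<omega> s \<noteq> Y \<omega> t" for \<omega> s t
    using that r(2) YV by blast
  have cover: "\<exists>p\<in>I. Y \<omega> \<in> K p" if w: "\<omega> \<in> space P" for \<omega>
  proof -
    obtain vs L where vs: "length vs \<ge> 2" "set vs \<subseteq> Y \<omega> ` {0..T}" "L > 0"
      "Y \<omega> \<in> reparams T L (grid_path T vs)"
      by (rule cadlag_discrete_reparam[OF T Y[OF w] r(1) disc[OF w]]) blast+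
    obtain N :: nat where N: "L \<le> real N" using real_arch_simple by blast
    \<comment> \<open>Rounding \<open>L\<close> up needs \<open>0 \<le> g t - g s\<close>, which
      follows from the first of the two inequalities itself.\<close>
    have "bilipschitz_on T (real (Suc N)) g" if g: "bilipschitz_on T L g" for g
      unfolding bilipschitz_on_def
    proof (intro ballI impI)
      fix s t assume st: "s \<in> {0..T}" "t \<in> {0..T}" "s \<le> t"
      have b: "t - s \<le> L * (g t - g s)" "g t - g s \<le> L * (t - s)" using g st unfolding bilipschitz_on_def by blast+
      have "0 \<le> L * (g t - g s)" using b st by linarith
      then have "0 \<le> g t - g s" using vs(3) by (simp add: zero_le_mult_iff)
      then have "L * (g t - g s) \<le> real (Suc N) * (g t - g s)" using N by (intro mult_right_mono) auto
      moreover have "L * (t - s) \<le> real (Suc N) * (t - s)" using N st by (intro mult_right_mono) auto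
      ultimately show "t - s \<le> real (Suc N) * (g t - g s) \<and> g t - g s \<le> real (Suc N) * (t - s)" using b by linarith
    qed
    then have "Y \<omega> \<in> K (vs, N)" unfolding K_def case_prod_conv using vs(4) unfolding reparams_def by blast
    moreover have "(vs, N) \<in> I" using vs YV[OF w] by (auto simp: I_def)
    ultimately show ?thesis by blast
  qed
  obtain \<omega>0 where "\<omega>0 \<in> space P" using not_empty by blast
  then have I: "I \<noteq> {}" "countable I"
    using cover V(1) by (auto simp: I_def intro: countable_subset[OF _ countable_lists[OF V(1)]])
  define A where "A n = (\<Union>i\<le>n. K (from_nat_into I i))" for n
  have KcI: "compactin (skorokhod_topology T) (K (from_nat_into I i))" for i
    by (rule Kc[OF from_nat_into[OF I(1)]])
  have Ac: "compactin (skorokhod_topology T) (A n)" for n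
    unfolding A_def using KcI by (intro compactin_Union) auto
  have As: "Y -` A n \<inter> space P \<in> sets P" for n
  proof -
    have "closedin (skorokhod_topology T) (A n)"
      using Ac[of n] unfolding skorokhod_topology_def by (rule compactin_imp_closedin[OF Sk.Hausdorff_space_mtopology])
    then show ?thesis using measurable_sets[OF Ym closedin_borel_of] by blast
  qed
  have "incseq (\<lambda>n. Y -` A n \<inter> space P)" unfolding incseq_def A_def by fastforce
  then have "(\<lambda>n. prob (Y -` A n \<inter> space P)) \<longlonglongrightarrow> prob (\<Union>n. Y -` A n \<inter> space P)"
    using As by (intro finite_Lim_measure_incseq) auto
  moreover have "(\<Union>n. Y -` A n \<inter> space P) = space P"
  proof (intro equalityI subsetI)
    fix \<omega> assume w: "\<omega> \<in> space P"
    then obtain p where p: "p \<in> I" "Y \<omega> \<in> K p" using cover by blast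
    obtain i where "from_nat_into I i = p" using from_nat_into_surj[OF I(2) p(1)] by blast
    then show "\<omega> \<in> (\<Union>n. Y -` A n \<inter> space P)" using p w by (auto simp: A_def)
  qed auto
  ultimately have "(\<lambda>n. prob (Y -` A n \<inter> space P)) \<longlonglongrightarrow> 1" by (simp add: prob_space)
  then have "\<forall>\<^sub>F n in sequentially. prob (Y -` A n \<inter> space P) > 1 - e" using e by (intro order_tendstoD) auto
  then obtain n where "prob (Y -` A n \<inter> space P) > 1 - e" by (auto simp: eventually_sequentially)
  then show ?thesis using Ac[of n] by (intro exI[of _ "A n"]) auto
qed

end

section \<open>The lattice graph and its jump rates\<close>

lemma mesh_pos [simp]: "mesh k > 0" "mesh k \<ge> 0" "mesh k \<noteq> 0" "\<bar>mesh k\<bar> = mesh k"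
  by (simp_all add: mesh_def)

lemma lattice_finite: "finite {z \<in> lattice k. norm z \<le> R}"
proof -
  define N where "N = \<lceil>R / mesh k\<rceil>"
  have "{z \<in> lattice k. norm z \<le> R} \<subseteq> (\<lambda>(a, b). vector [of_int a * mesh k, of_int b * mesh k]) ` ({-N..N} \<times> {-N..N})"
  proof
    fix z assume z: "z \<in> {z \<in> lattice k. norm z \<le> R}"
    then have "\<forall>i. \<exists>n::int. z $ i = of_int n * mesh k" by (simp add: lattice_def)
    then obtain n where n: "\<And>i. z $ i = of_int (n i) * mesh k" by metis
    have "n i \<in> {-N..N}" for i
    proof -
      have "\<bar>z $ i\<bar> \<le> R" using component_le_norm_cart[of z i] z by simp
      then have "\<bar>of_int (n i)\<bar> * mesh k \<le> R" using n[of i] by (simp add: abs_mult)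
      then have "\<bar>of_int (n i)\<bar> \<le> R / mesh k" by (simp add: pos_le_divide_eq)
      then show ?thesis unfolding N_def atLeastAtMost_iff by linarith
    qed
    then show "z \<in> (\<lambda>(a, b). vector [of_int a * mesh k, of_int b * mesh k]) ` ({-N..N} \<times> {-N..N})"
      by (intro image_eqI[of _ _ "(n 1, n 2)"]) (auto simp: vec_eq_iff forall_2 n)
  qed
  then show ?thesis by (rule finite_subset) auto
qed

lemma countable_lattice: "countable (lattice k)"
proof -
  have "lattice k = (\<Union>n::nat. {z \<in> lattice k. norm z \<le> real n})"
    using real_arch_simple by auto
  moreover have "countable (\<Union>n::nat. {z \<in> lattice k. norm z \<le> real n})"
    by (intro countable_UN countable_finite lattice_finite countableI_type)
  ultimately show ?thesis by (simp only:)
qed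

lemma countable_vertices: "countable (vertices \<epsilon> k)"
proof -
  have "line_vertices k = (\<lambda>n::nat. Line (real n * mesh k)) ` {1..}" by (auto simp: line_vertices_def)
  then show ?thesis
    unfolding vertices_def plane_vertices_def
    by (auto intro: countable_subset[OF _ countable_lattice])
qed

lemma vertices_subset_E_space: "vertices \<epsilon> k \<subseteq> E_space \<epsilon>"
  unfolding vertices_def plane_vertices_def line_vertices_def E_space_def
  by (auto intro!: imageI mult_pos_pos)

lemma Star_vertex [simp]: "Star \<in> vertices \<epsilon> k"
  by (simp add: vertices_def)

lemma Plane_vertex [simp]: "Plane z \<in> vertices \<epsilon> k \<longleftrightarrow> z \<in> lattice k \<and> norm z > \<epsilon>"
  by (auto simp: vertices_def plane_vertices_def line_vertices_def)

lemma Line_vertex: "Line r \<in> vertices \<epsilon> k \<longleftrightarrow> (\<exists>n\<ge>1. r = real n * mesh k)"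
  by (auto simp: vertices_def plane_vertices_def line_vertices_def)

lemma edge_vertices: "edge \<epsilon> k x y \<Longrightarrow> x \<in> vertices \<epsilon> k \<and> y \<in> vertices \<epsilon> k \<and> x \<noteq> y"
proof (induction rule: edge.induct)
  case line_star
  then show ?case by (auto simp: Line_vertex intro: exI[of _ 1])
next
  case (line_line n)
  have "mesh k \<noteq> 0" using mesh_pos(1)[of k] by linarith
  moreover have "\<exists>m\<ge>1. real n * mesh k = real m * mesh k" using line_line by (intro exI[of _ n]) simp
  moreover have "\<exists>m\<ge>1. real (n + 1) * mesh k = real m * mesh k"
    by (intro exI[of _ "n + 1"]) simp
  ultimately show ?case unfolding Line_vertex by simp
next
  case (plane_plane u v)
  then show ?case using mesh_pos(1)[of k] by auto
qed auto

lemma adjacent_sym: "adjacent \<epsilon> k x y \<longleftrightarrow> adjacent \<epsilon> k y x"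
  by (auto simp: adjacent_def)

lemma adjacent_vertices: "adjacent \<epsilon> k x y \<Longrightarrow> x \<in> vertices \<epsilon> k \<and> y \<in> vertices \<epsilon> k \<and> x \<noteq> y"
  unfolding adjacent_def using edge_vertices by blast

lemma adjacent_Plane: "adjacent \<epsilon> k (Plane u) y \<Longrightarrow>
    y = Star \<or> (\<exists>v\<in>lattice k - cball 0 \<epsilon>. y = Plane v \<and> norm (u - v) = mesh k)"
  unfolding adjacent_def by (auto elim!: edge.cases simp: norm_minus_commute)

lemma adjacent_Line: "adjacent \<epsilon> k (Line r) y \<Longrightarrow>
    y = Star \<or> y = Line (r + mesh k) \<or> y = Line (r - mesh k)"
  unfolding adjacent_def by (auto elim!: edge.cases simp: algebra_simps)

lemma adjacent_Star: "adjacent \<epsilon> k Star y \<Longrightarrow>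
    y = Line (mesh k) \<or> (\<exists>u\<in>lattice k. y = Plane u \<and> norm u > \<epsilon> \<and> norm u \<le> \<epsilon> + mesh k)"
proof -
  assume "adjacent \<epsilon> k Star y"
  then have "edge \<epsilon> k y Star" unfolding adjacent_def by (auto elim: edge.cases)
  then show ?thesis
  proof cases
    case (plane_star u v)
    then have "norm u \<le> \<epsilon> + mesh k" using norm_triangle_ineq[of "u - v" v] by auto
    then show ?thesis using plane_star by auto
  qed auto
qed

definition nbrs :: "real \<Rightarrow> nat \<Rightarrow> point \<Rightarrow> point set" where
  "nbrs \<epsilon> k x = {y. adjacent \<epsilon> k x y}"

lemma finite_nbrs: "finite (nbrs \<epsilon> k x)"
proof (cases x)
  case Star
  have "nbrs \<epsilon> k x \<subseteq> insert (Line (mesh k)) (Plane ` {z \<in> lattice k. norm z \<le> \<epsilon> + mesh k})"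
    using adjacent_Star unfolding nbrs_def Star by fastforce
  then show ?thesis by (rule finite_subset) (simp add: lattice_finite)
next
  case (Plane u)
  have "nbrs \<epsilon> k x \<subseteq> insert Star (Plane ` {z \<in> lattice k. norm z \<le> norm u + mesh k})"
  proof
    fix y assume "y \<in> nbrs \<epsilon> k x"
    then consider "y = Star" | v where "v \<in> lattice k" "y = Plane v" "norm (u - v) = mesh k"
      using adjacent_Plane[of \<epsilon> k u y] unfolding nbrs_def Plane by blast
    then show "y \<in> insert Star (Plane ` {z \<in> lattice k. norm z \<le> norm u + mesh k})"
    proof cases
      case 2
      have "norm v \<le> norm u + norm (u - v)"
        using norm_triangle_ineq[of u "v - u"] by (simp add: norm_minus_commute)
      then show ?thesis using 2 by (auto intro!: imageI)
    qed simp
  qed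
  then show ?thesis by (rule finite_subset) (simp add: lattice_finite)
next
  case (Line r)
  have "nbrs \<epsilon> k x \<subseteq> {Star, Line (r + mesh k), Line (r - mesh k)}"
    using adjacent_Line unfolding nbrs_def Line by blast
  then show ?thesis by (rule finite_subset) auto
qed

lemma deg_nbrs: "deg \<epsilon> k x = card (nbrs \<epsilon> k x)"
  by (simp add: deg_def nbrs_def)

text \<open>An isolated vertex would have mass 0 and spoil the division in \<open>rate\<close>. The
  delicate case is a lattice point next to the disk.\<close>

lemma deg_pos:
  assumes x: "x \<in> vertices \<epsilon> k" shows "deg \<epsilon> k x > 0"
proof -
  have "nbrs \<epsilon> k x \<noteq> {}"
  proof (cases x)
    case Star
    then have "Line (mesh k) \<in> nbrs \<epsilon> k x" by (auto simp: nbrs_def adjacent_def intro: edge.line_star)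
    then show ?thesis by blast
  next
    case (Line r)
    then obtain n where n: "n \<ge> 1" "r = real n * mesh k" using x by (auto simp: Line_vertex)
    then have "Line (real (n + 1) * mesh k) \<in> nbrs \<epsilon> k x"
      using edge.line_line[OF n(1), of \<epsilon> k] Line by (simp add: nbrs_def adjacent_def)
    then show ?thesis by blast
  next
    case (Plane z)
    then have z: "z \<in> lattice k" "norm z > \<epsilon>" using x by auto
    \<comment> \<open>Moving so that the first coordinate grows in absolute value does not decrease
      the norm; hence the whole segment to \<open>w\<close> avoids the disk.\<close>
    define \<sigma> :: real where "\<sigma> = (if z $ 1 \<ge> 0 then 1 else -1)"
    define w where "w = z + axis 1 (\<sigma> * mesh k)"
    have seg: "norm (z + axis 1 (c * \<sigma>)) > \<epsilon>" if "c \<ge> 0" for c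
    proof -
      have "0 \<le> c * (\<sigma> * z $ 1)" using that by (auto simp: \<sigma>_def)
      then have "(z $ 1)\<^sup>2 \<le> (z $ 1 + c * \<sigma>)\<^sup>2" by (simp add: power2_sum algebra_simps)
      then have "norm z \<le> norm (z + axis 1 (c * \<sigma>))"
        unfolding norm_vec_def L2_set_def sum_2 by (simp add: axis_def)
      then show ?thesis using z by simp
    qed
    have "w \<in> lattice k"
      unfolding lattice_def
    proof (intro CollectI allI)
      fix i :: 2
      obtain n :: int where n: "z $ i = of_int n * mesh k" using z by (auto simp: lattice_def)
      have "w $ i = of_int (n + (if i = 1 then (if z $ 1 \<ge> 0 then 1 else -1) else 0)) * mesh k"
        using n by (auto simp: w_def axis_def \<sigma>_def algebra_simps)
      then show "\<exists>n::int. w $ i = of_int n * mesh k" by blast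
    qed
    moreover have "norm (z - w) = mesh k"
      by (simp add: w_def norm_vec_def L2_set_def sum_2 axis_def \<sigma>_def)
    moreover have "closed_segment z w \<inter> cball 0 \<epsilon> = {}"
    proof -
      have "p \<notin> cball 0 \<epsilon>" if p: "p \<in> closed_segment z w" for p
      proof -
        obtain u where u: "0 \<le> u" "u \<le> 1" "p = (1 - u) *\<^sub>R z + u *\<^sub>R w" using p by (auto simp: in_segment)
        have "p = z + axis 1 ((u * mesh k) * \<sigma>)"
          unfolding u(3) w_def by (auto simp: vec_eq_iff axis_def algebra_simps)
        moreover have "0 \<le> u * mesh k" using u(1) by simp
        ultimately have "norm p > \<epsilon>" using seg[of "u * mesh k"] by simp
        then show ?thesis by simp
      qed
      then show ?thesis by blast
    qed
    moreover have "norm w > \<epsilon>" using seg[of "mesh k"] by (simp add: w_def mult.commute less_imp_le)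
    ultimately have "edge \<epsilon> k (Plane z) (Plane w)" using z by (intro edge.plane_plane) auto
    then have "Plane w \<in> nbrs \<epsilon> k x" by (simp add: nbrs_def adjacent_def Plane)
    then show ?thesis by blast
  qed
  then show ?thesis unfolding deg_nbrs using finite_nbrs by (simp add: card_gt_0_iff)
qed

lemma mass_pos:
  assumes "x \<in> vertices \<epsilon> k" shows "mass \<epsilon> k x > 0"
proof -
  have d: "real (deg \<epsilon> k x) \<ge> 1" using deg_pos[OF assms] by linarith
  show ?thesis
  proof (cases x)
    case Star
    have "0 \<le> mesh k ^ 2 / 4 * (real (deg \<epsilon> k x) - 1)" using d by simp
    moreover have "mesh k / 2 > 0" by simp
    ultimately show ?thesis unfolding Star mass.simps by linarith
  next
    case (Plane z)
    have "0 < mesh k ^ 2 / 4 * real (deg \<epsilon> k (Plane z))" using d unfolding Plane by (intro mult_pos_pos) auto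
    then show ?thesis unfolding Plane mass.simps .
  next
    case (Line r)
    have "0 < mesh k / 2 * real (deg \<epsilon> k (Line r))" using d unfolding Line by (intro mult_pos_pos) auto
    then show ?thesis unfolding Line mass.simps .
  qed
qed

section \<open>Conductances, jump rates and energies of indicators\<close>

text \<open>Normalised so that the energy is half the sum over oriented edges, hence twice the
  coefficients \<open>1 / 8\<close> and \<open>2 ^ k / 4\<close>. No edge belongs to both sets,
  since these have only the vertex \<open>Star\<close> in common.\<close>

definition conduct :: "real \<Rightarrow> nat \<Rightarrow> point \<Rightarrow> point \<Rightarrow> real" where
  "conduct \<epsilon> k x y =
     (if (x, y) \<in> oriented_edges \<epsilon> k (plane_vertices \<epsilon> k \<union> {Star}) then 1 / 4 else 0) +
     (if (x, y) \<in> oriented_edges \<epsilon> k (line_vertices k \<union> {Star}) then 2 ^ k / 2 else 0)"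

text \<open>The off-diagonal entries of the generator of the chain symmetric with respect to
  \<open>mass\<close>.\<close>

definition rate :: "real \<Rightarrow> nat \<Rightarrow> point \<Rightarrow> point \<Rightarrow> real" where
  "rate \<epsilon> k x y = conduct \<epsilon> k x y / mass \<epsilon> k x"

lemma conduct_Plane: "y \<in> nbrs \<epsilon> k (Plane z) \<Longrightarrow> conduct \<epsilon> k (Plane z) y = 1 / 4"
  using adjacent_Plane[of \<epsilon> k z y] adjacent_vertices[of \<epsilon> k "Plane z" y]
  by (auto simp: conduct_def oriented_edges_def nbrs_def vertices_def plane_vertices_def line_vertices_def)

lemma conduct_Line: "y \<in> nbrs \<epsilon> k (Line r) \<Longrightarrow> conduct \<epsilon> k (Line r) y = 2 ^ k / 2"
  using adjacent_Line[of \<epsilon> k r y] adjacent_vertices[of \<epsilon> k "Line r" y]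
  by (auto simp: conduct_def oriented_edges_def nbrs_def vertices_def plane_vertices_def line_vertices_def)

text \<open>The masses are built so that the total rate is the same at all vertices,
  \<open>Star\<close> included. This bounds the generator for fixed \<open>k\<close> without any
  knowledge of the graph near the disk.\<close>

lemma sum_rate:
  assumes x: "x \<in> vertices \<epsilon> k"
  shows "(\<Sum>y\<in>nbrs \<epsilon> k x. rate \<epsilon> k x y) = 4 ^ k"
proof -
  have four: "(4::real) ^ k = 2 ^ k * 2 ^ k" by (simp flip: power_mult_distrib)
  have h: "4 ^ k * mesh k ^ 2 = 1" "2 ^ k * mesh k = 1"
    unfolding four by (simp_all add: mesh_def power2_eq_square)
  have "(\<Sum>y\<in>nbrs \<epsilon> k x. conduct \<epsilon> k x y) = 4 ^ k * mass \<epsilon> k x"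
  proof (cases x)
    case (Plane z)
    have "(\<Sum>y\<in>nbrs \<epsilon> k x. conduct \<epsilon> k x y) = real (deg \<epsilon> k x) * (1/4)"
      unfolding deg_nbrs using conduct_Plane Plane by (subst sum.cong[OF refl, of _ _ "\<lambda>_. 1/4"]) auto
    also have "\<dots> = 4 ^ k * mass \<epsilon> k x" using h(1) by (simp add: Plane)
    finally show ?thesis .
  next
    case (Line r)
    have "(\<Sum>y\<in>nbrs \<epsilon> k x. conduct \<epsilon> k x y) = real (deg \<epsilon> k x) * (2 ^ k/2)"
      unfolding deg_nbrs using conduct_Line Line by (subst sum.cong[OF refl, of _ _ "\<lambda>_. 2 ^ k/2"]) auto
    also have "\<dots> = 2 ^ k * (2 ^ k * mesh k) / 2 * real (deg \<epsilon> k x)" unfolding h(2) by simp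
    also have "\<dots> = 4 ^ k * mass \<epsilon> k x"
      by (simp add: Line flip: power_mult_distrib)
    finally show ?thesis .
  next
    case Star
    \<comment> \<open>Exactly one edge at \<open>Star\<close> leads to the half line and has the
      large conductance; it accounts for the term \<open>deg \<epsilon> k Star - 1\<close> in the
      mass.\<close>
    have L: "Line (mesh k) \<in> nbrs \<epsilon> k Star" by (auto simp: nbrs_def adjacent_def intro: edge.line_star)
    have c1: "conduct \<epsilon> k Star (Line (mesh k)) = 2 ^ k / 2"
      using conduct_Line[of Star \<epsilon> k "mesh k"] L
      by (auto simp: nbrs_def conduct_def oriented_edges_def adjacent_sym)
    have c2: "conduct \<epsilon> k Star y = 1 / 4" if y: "y \<in> nbrs \<epsilon> k Star - {Line (mesh k)}" for y
    proof -
      obtain u where u: "y = Plane u" using adjacent_Star[of \<epsilon> k y] y unfolding nbrs_def by blast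
      then have "conduct \<epsilon> k y Star = 1 / 4" using conduct_Plane[of Star \<epsilon> k u] y by (simp add: nbrs_def adjacent_sym)
      then show ?thesis by (auto simp: conduct_def oriented_edges_def adjacent_sym)
    qed
    have "(\<Sum>y\<in>nbrs \<epsilon> k Star. conduct \<epsilon> k Star y) = 2 ^ k / 2 + (\<Sum>y\<in>nbrs \<epsilon> k Star - {Line (mesh k)}. conduct \<epsilon> k Star y)"
      unfolding c1[symmetric] by (rule sum.remove[OF finite_nbrs L])
    also have "\<dots> = 2 ^ k / 2 + real (card (nbrs \<epsilon> k Star - {Line (mesh k)})) * (1/4)"
      by (subst sum.cong[OF refl c2]) auto
    also have "real (card (nbrs \<epsilon> k Star - {Line (mesh k)})) = real (deg \<epsilon> k Star) - 1"
      using deg_pos[OF Star_vertex, of \<epsilon> k] L finite_nbrs by (simp add: deg_nbrs card_Diff_singleton of_nat_diff)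
    also have "2 ^ k / 2 + (real (deg \<epsilon> k Star) - 1) * (1/4) = (2 ^ k * (2 ^ k * mesh k)) / 2 + 4 ^ k * mesh k ^ 2 * (real (deg \<epsilon> k Star) - 1) * (1/4)"
      unfolding h by simp
    also have "\<dots> = 4 ^ k * mass \<epsilon> k Star" unfolding mass.simps four by (simp add: field_simps)
    finally show ?thesis using Star by simp
  qed
  then show ?thesis
    unfolding rate_def using mass_pos[OF x] by (simp flip: sum_divide_distrib)
qed

text \<open>The energies of indicators of one and of two points suffice to read off the jump rates.\<close>

definition edges_at :: "real \<Rightarrow> nat \<Rightarrow> point set \<Rightarrow> point set \<Rightarrow> (point \<times> point) set" where
  "edges_at \<epsilon> k W S = {p \<in> oriented_edges \<epsilon> k W. fst p \<in> S \<or> snd p \<in> S}"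

lemma finite_edges_at: "finite S \<Longrightarrow> finite (edges_at \<epsilon> k W S)"
proof -
  assume S: "finite S"
  have "edges_at \<epsilon> k W S \<subseteq> Sigma S (nbrs \<epsilon> k) \<union> prod.swap ` Sigma S (nbrs \<epsilon> k)"
    by (force simp: edges_at_def oriented_edges_def nbrs_def adjacent_sym)
  then show ?thesis
    by (rule finite_subset) (use S finite_nbrs in \<open>auto intro: finite_SigmaI\<close>)
qed

lemma dirichlet_sum_finite:
  assumes S: "finite S" and f: "\<And>x. x \<notin> S \<Longrightarrow> f x = (0::real)"
  shows "(\<Sum>\<^sub>\<infinity>(a, b)\<in>oriented_edges \<epsilon> k W. (f a - f b)\<^sup>2) = (\<Sum>p\<in>edges_at \<epsilon> k W S. (f (fst p) - f (snd p))\<^sup>2)"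
proof -
  have "(\<Sum>\<^sub>\<infinity>p\<in>oriented_edges \<epsilon> k W. (f (fst p) - f (snd p))\<^sup>2) = (\<Sum>\<^sub>\<infinity>p\<in>edges_at \<epsilon> k W S. (f (fst p) - f (snd p))\<^sup>2)"
  proof (rule infsum_cong_neutral)
    fix p assume "p \<in> oriented_edges \<epsilon> k W - edges_at \<epsilon> k W S"
    then have "fst p \<notin> S" "snd p \<notin> S" by (auto simp: edges_at_def)
    then show "(f (fst p) - f (snd p))\<^sup>2 = 0" by (simp add: f)
  qed (auto simp: edges_at_def)
  then show ?thesis by (simp only: case_prod_unfold infsum_finite[OF finite_edges_at[OF S]])
qed

lemma edges_at_neq: "p \<in> edges_at \<epsilon> k W S \<Longrightarrow> fst p \<noteq> snd p"
  using adjacent_vertices by (auto simp: edges_at_def oriented_edges_def)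

lemma dirichlet_sum_point:
  "(\<Sum>\<^sub>\<infinity>(a, b)\<in>oriented_edges \<epsilon> k W. (indicator {x} a - indicator {x} b :: real)\<^sup>2) =
     2 * real (card {y \<in> nbrs \<epsilon> k x. (x, y) \<in> oriented_edges \<epsilon> k W})"
proof -
  let ?N = "{y \<in> nbrs \<epsilon> k x. (x, y) \<in> oriented_edges \<epsilon> k W}"
  have F: "edges_at \<epsilon> k W {x} = Pair x ` ?N \<union> (\<lambda>y. (y, x)) ` ?N"
    by (auto simp: edges_at_def oriented_edges_def nbrs_def adjacent_sym)
  have xN: "x \<notin> ?N" using adjacent_vertices by (auto simp: nbrs_def)
  have "(\<Sum>\<^sub>\<infinity>(a, b)\<in>oriented_edges \<epsilon> k W. (indicator {x} a - indicator {x} b :: real)\<^sup>2) =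
      (\<Sum>p\<in>edges_at \<epsilon> k W {x}. (indicator {x} (fst p) - indicator {x} (snd p) :: real)\<^sup>2)"
    by (rule dirichlet_sum_finite) auto
  also have "\<dots> = (\<Sum>p\<in>edges_at \<epsilon> k W {x}. 1)"
  proof (rule sum.cong[OF refl])
    fix p assume p: "p \<in> edges_at \<epsilon> k W {x}"
    then have "fst p = x \<and> snd p \<noteq> x \<or> fst p \<noteq> x \<and> snd p = x"
      using edges_at_neq[OF p] by (auto simp: edges_at_def)
    then show "(indicator {x} (fst p) - indicator {x} (snd p) :: real)\<^sup>2 = 1" by auto
  qed
  also have "\<dots> = real (card (edges_at \<epsilon> k W {x}))" by simp
  also have "card (edges_at \<epsilon> k W {x}) = card (Pair x ` ?N) + card ((\<lambda>y. (y, x)) ` ?N)"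
    unfolding F by (rule card_Un_disjoint) (use finite_nbrs[of \<epsilon> k x] xN in auto)
  also have "\<dots> = 2 * card ?N" by (simp add: card_image inj_on_def)
  finally show ?thesis by simp
qed

text \<open>Polarisation: the sums differ only at an edge joining \<open>x\<close> and
  \<open>y\<close>, where the indicator of the pair is constant while each single indicator
  contributes 1. The two orientations make 4.\<close>

lemma dirichlet_sum_pair:
  assumes xy: "x \<noteq> y"
  shows "(\<Sum>\<^sub>\<infinity>(a, b)\<in>oriented_edges \<epsilon> k W. (indicator {x, y} a - indicator {x, y} b :: real)\<^sup>2) =
     (\<Sum>\<^sub>\<infinity>(a, b)\<in>oriented_edges \<epsilon> k W. (indicator {x} a - indicator {x} b)\<^sup>2) +
     (\<Sum>\<^sub>\<infinity>(a, b)\<in>oriented_edges \<epsilon> k W. (indicator {y} a - indicator {y} b)\<^sup>2) -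
     (if (x, y) \<in> oriented_edges \<epsilon> k W then 4 else 0)"
proof -
  let ?F = "edges_at \<epsilon> k W {x, y}"
  let ?D = "\<lambda>S p. (indicator S (fst p) - indicator S (snd p) :: real)\<^sup>2"
  let ?X = "\<lambda>p. if p \<in> {(x, y), (y, x)} then 2 else (0::real)"
  have red: "(\<Sum>\<^sub>\<infinity>(a, b)\<in>oriented_edges \<epsilon> k W. (indicator S a - indicator S b :: real)\<^sup>2) = sum (?D S) ?F"
    if "S \<subseteq> {x, y}" for S
    by (rule dirichlet_sum_finite) (use that in \<open>auto simp: indicator_def\<close>)
  have fin: "finite ?F" by (rule finite_edges_at) simp
  have "sum (?D {x, y}) ?F = (\<Sum>p\<in>?F. ?D {x} p + ?D {y} p - ?X p)"
  proof (rule sum.cong[OF refl])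
    fix p assume "p \<in> ?F"
    then have "fst p \<noteq> snd p" by (rule edges_at_neq)
    then show "?D {x, y} p = ?D {x} p + ?D {y} p - ?X p"
      using xy by (cases p) (auto simp: indicator_def)
  qed
  also have "\<dots> = sum (?D {x}) ?F + sum (?D {y}) ?F - sum ?X ?F"
    by (simp only: sum.distrib sum_subtractf)
  also have "sum ?X ?F = (\<Sum>p\<in>?F \<inter> {(x, y), (y, x)}. 2)"
    using fin by (simp only: sum.inter_restrict)
  also have "?F \<inter> {(x, y), (y, x)} = (if (x, y) \<in> oriented_edges \<epsilon> k W then {(x, y), (y, x)} else {})"
    by (auto simp: edges_at_def oriented_edges_def adjacent_sym)
  also have "(\<Sum>p\<in>(if (x, y) \<in> oriented_edges \<epsilon> k W then {(x, y), (y, x)} else {}). 2) =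
      (if (x, y) \<in> oriented_edges \<epsilon> k W then 4 else (0::real))"
    using xy by auto
  finally show ?thesis by (simp only: red[of "{x, y}"] red[of "{x}"] red[of "{y}"] subset_refl subset_insertI insertI1 insertI2 insert_subset empty_subsetI simp_thms)
qed

lemma energy_point:
  assumes x: "x \<in> vertices \<epsilon> k"
  shows "energy \<epsilon> k (indicator {x}) = 4 ^ k * mass \<epsilon> k x"
proof -
  have "energy \<epsilon> k (indicator {x}) = (\<Sum>y\<in>nbrs \<epsilon> k x. conduct \<epsilon> k x y)"
    unfolding energy_def dirichlet_sum_point conduct_def sum.distrib
    using finite_nbrs[of \<epsilon> k x] by (simp add: sum.If_cases Int_def)
  also have "\<dots> = mass \<epsilon> k x * (\<Sum>y\<in>nbrs \<epsilon> k x. rate \<epsilon> k x y)"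
    using mass_pos[OF x] by (simp add: rate_def flip: sum_divide_distrib)
  finally show ?thesis using sum_rate[OF x] by simp
qed

lemma energy_pair:
  assumes "x \<noteq> y"
  shows "energy \<epsilon> k (indicator {x, y}) = energy \<epsilon> k (indicator {x}) + energy \<epsilon> k (indicator {y}) - 2 * conduct \<epsilon> k x y"
  unfolding energy_def dirichlet_sum_pair[OF assms] conduct_def by (simp add: algebra_simps)

section \<open>Generator bounds for the semigroup\<close>

lemma speed_integral_finite:
  assumes S: "finite S" "S \<subseteq> vertices \<epsilon> k" and g: "\<And>x. x \<in> vertices \<epsilon> k \<Longrightarrow> x \<notin> S \<Longrightarrow> g x = (0::real)"
  shows "integrable (speed \<epsilon> k) g" "(\<integral>x. g x \<partial>speed \<epsilon> k) = (\<Sum>x\<in>S. mass \<epsilon> k x * g x)"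
proof -
  let ?V = "vertices \<epsilon> k"
  have nn: "AE x in count_space ?V. 0 \<le> mass \<epsilon> k x"
    using mass_pos by (auto simp: AE_count_space less_imp_le)
  have sub: "{a \<in> ?V. mass \<epsilon> k a * g a \<noteq> 0} \<subseteq> S" using g by auto
  then have fin: "finite {a \<in> ?V. mass \<epsilon> k a * g a \<noteq> 0}" using S(1) finite_subset by blast
  have "integrable (count_space ?V) (\<lambda>x. mass \<epsilon> k x *\<^sub>R g x)"
  proof (rule integrableI_bounded)
    have "{a \<in> ?V. 0 < ennreal (norm (mass \<epsilon> k a *\<^sub>R g a))} \<subseteq> {a \<in> ?V. mass \<epsilon> k a * g a \<noteq> 0}" by auto
    then have "finite {a \<in> ?V. 0 < ennreal (norm (mass \<epsilon> k a *\<^sub>R g a))}" using fin finite_subset by blast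
    then show "(\<integral>\<^sup>+ a. ennreal (norm (mass \<epsilon> k a *\<^sub>R g a)) \<partial>count_space ?V) < \<infinity>"
      by (subst nn_integral_count_space) (auto simp: less_top[symmetric])
  qed simp
  then show "integrable (speed \<epsilon> k) g"
    unfolding speed_def point_measure_def by (subst integrable_density) (use nn in auto)
  have "(\<integral>x. g x \<partial>speed \<epsilon> k) = (\<integral>x. mass \<epsilon> k x *\<^sub>R g x \<partial>count_space ?V)"
    unfolding speed_def point_measure_def by (rule integral_density) (use nn in auto)
  also have "\<dots> = (\<Sum>a | a \<in> ?V \<and> mass \<epsilon> k a * g a \<noteq> 0. mass \<epsilon> k a * g a)"
    using lebesgue_integral_count_space_finite_support[of ?V "\<lambda>x. mass \<epsilon> k x *\<^sub>R g x"] fin by simp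
  also have "\<dots> = (\<Sum>x\<in>S. mass \<epsilon> k x * g x)"
    using S sub by (intro sum.mono_neutral_left) auto
  finally show "(\<integral>x. g x \<partial>speed \<epsilon> k) = (\<Sum>x\<in>S. mass \<epsilon> k x * g x)" .
qed

lemma integrable_pmf_bounded:
  fixes f :: "'a \<Rightarrow> real"
  shows "(\<And>x. \<bar>f x\<bar> \<le> B) \<Longrightarrow> integrable (measure_pmf p) f"
  by (rule measure_pmf.integrable_const_bound[where B = B]) auto

lemma expectation_indicator_pair:
  assumes "x \<noteq> y"
  shows "measure_pmf.expectation p (indicator {x, y}) = pmf p x + pmf p y"
  using assms by (subst integral_measure_pmf_real[of "{x, y}"]) (auto simp: indicator_def)

lemma expectation_bind_pmf:
  fixes f :: "'a \<Rightarrow> real"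
  assumes f: "\<And>x. 0 \<le> f x" "\<And>x. f x \<le> 1"
  shows "measure_pmf.expectation (bind_pmf p q) f = measure_pmf.expectation p (\<lambda>x. measure_pmf.expectation (q x) f)"
proof -
  have i: "integrable (measure_pmf r) f" for r
    by (rule integrable_pmf_bounded[of _ 1]) (use f in auto)
  have b: "0 \<le> measure_pmf.expectation r f" "measure_pmf.expectation r f \<le> 1" for r
    using f i[of r] measure_pmf.integral_le_const[of r f 1] by auto
  have i2: "integrable (measure_pmf p) (\<lambda>x. measure_pmf.expectation (q x) f)"
    by (rule integrable_pmf_bounded[of _ 1]) (use b in auto)
  have "ennreal (measure_pmf.expectation (bind_pmf p q) f) = (\<integral>\<^sup>+ x. ennreal (f x) \<partial>measure_pmf (bind_pmf p q))"
    using nn_integral_eq_integral[OF i] f by simp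
  also have "\<dots> = (\<integral>\<^sup>+ x. \<integral>\<^sup>+ y. ennreal (f y) \<partial>measure_pmf (q x) \<partial>measure_pmf p)" by simp
  also have "\<dots> = (\<integral>\<^sup>+ x. ennreal (measure_pmf.expectation (q x) f) \<partial>measure_pmf p)"
    using nn_integral_eq_integral[OF i] f by simp
  also have "\<dots> = ennreal (measure_pmf.expectation p (\<lambda>x. measure_pmf.expectation (q x) f))"
    by (rule nn_integral_eq_integral[OF i2]) (use b in auto)
  finally show ?thesis using b by (simp add: integral_nonneg)
qed

text \<open>Only upper bounds for right difference quotients are at hand, so there is no mean value
  theorem to apply. Instead, with a slope \<open>e\<close> to spare, the last time at which
  \<open>w\<close> lies below the line of slope \<open>e\<close> from its initial value cannot come
  before \<open>t\<close>.\<close>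

lemma dini_nonincreasing:
  fixes w :: "real \<Rightarrow> real"
  assumes cont: "continuous_on {0..} w"
    and dini: "\<And>t e. t \<ge> 0 \<Longrightarrow> e > 0 \<Longrightarrow> \<forall>\<^sub>F s in at_right 0. w (t + s) \<le> w t + e * s"
    and t: "t \<ge> 0"
  shows "w t \<le> w 0"
proof (rule field_le_epsilon)
  fix e0 :: real assume "e0 > 0"
  define e where "e = e0 / (t + 1)"
  have e: "e > 0" using \<open>e0 > 0\<close> t by (simp add: e_def)
  define A where "A = {s \<in> {0..t}. w s - e * s \<le> w 0}"
  have "continuous_on {0..t} (\<lambda>s. w s - e * s)"
    by (intro continuous_intros continuous_on_subset[OF cont]) auto
  then have "closed ({0..t} \<inter> (\<lambda>s. w s - e * s) -` {..w 0})" by (intro continuous_closed_preimage) auto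
  moreover have "{0..t} \<inter> (\<lambda>s. w s - e * s) -` {..w 0} = A" by (auto simp: A_def)
  ultimately have "closed A" by simp
  moreover have A0: "0 \<in> A" using t by (simp add: A_def)
  moreover have bdd: "bdd_above A" by (auto simp: A_def intro: bdd_aboveI[of _ t])
  ultimately have S: "Sup A \<in> A" by (intro closed_contains_Sup) auto
  have "Sup A = t"
  proof (rule ccontr)
    assume "Sup A \<noteq> t"
    then have lt: "0 \<le> Sup A" "Sup A < t" using S by (auto simp: A_def)
    from dini[OF lt(1) e] have "\<forall>\<^sub>F s in at_right 0. w (Sup A + s) \<le> w (Sup A) + e * s" .
    then obtain b where b: "b > 0" "\<And>s. 0 < s \<Longrightarrow> s < b \<Longrightarrow> w (Sup A + s) \<le> w (Sup A) + e * s"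
      by (auto simp: eventually_at_right_field)
    define s where "s = min (b/2) (t - Sup A)"
    have s: "0 < s" "s < b" "Sup A + s \<le> t" using b lt by (auto simp: s_def)
    have "w (Sup A + s) - e * (Sup A + s) \<le> w (Sup A) - e * Sup A" using b(2)[OF s(1,2)] by (simp add: algebra_simps)
    also have "\<dots> \<le> w 0" using S by (simp add: A_def)
    finally have "Sup A + s \<in> A" using s lt by (simp add: A_def)
    then have "Sup A + s \<le> Sup A" using bdd by (rule cSup_upper)
    then show False using s by simp
  qed
  then have "w t \<le> w 0 + e * t" using S by (simp add: A_def)
  also have "e * t \<le> e0" using \<open>e0 > 0\<close> t by (simp add: e_def field_simps)
  finally show "w t \<le> w 0 + e0" by simp
qed

text \<open>A one-sided form of \<open>(L f) x \<le> b\<close> for the generator \<open>L\<close> of \<open>K\<close>, which needs no differentiability at \<open>x\<close>.\<close>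

definition generator_le :: "(real \<Rightarrow> 'a \<Rightarrow> 'a pmf) \<Rightarrow> ('a \<Rightarrow> real) \<Rightarrow> real \<Rightarrow> 'a \<Rightarrow> bool" where
  "generator_le K f b x \<longleftrightarrow>
     (\<forall>e>0. \<forall>\<^sub>F s in at_right 0. measure_pmf.expectation (K s x) f \<le> f x + s * (b + e))"

section \<open>The walk semigroup: jump rates, Lipschitz bound and growth of expectations\<close>

context
  fixes \<epsilon> :: real and k :: nat and K
  assumes K: "walk_semigroup \<epsilon> k K"
begin

lemma K_zero: "x \<in> vertices \<epsilon> k \<Longrightarrow> K 0 x = return_pmf x"
  using K by (simp add: walk_semigroup_def)

lemma K_vertices: "t \<ge> 0 \<Longrightarrow> x \<in> vertices \<epsilon> k \<Longrightarrow> y \<in> set_pmf (K t x) \<Longrightarrow> y \<in> vertices \<epsilon> k"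
  using K by (auto simp: walk_semigroup_def)

lemma K_add: "s \<ge> 0 \<Longrightarrow> t \<ge> 0 \<Longrightarrow> x \<in> vertices \<epsilon> k \<Longrightarrow> K (s + t) x = bind_pmf (K s x) (K t)"
  using K by (auto simp: walk_semigroup_def)

lemma K_symmetric:
  "t \<ge> 0 \<Longrightarrow> x \<in> vertices \<epsilon> k \<Longrightarrow> y \<in> vertices \<epsilon> k \<Longrightarrow>
     mass \<epsilon> k x * pmf (K t x) y = mass \<epsilon> k y * pmf (K t y) x"
  using K unfolding walk_semigroup_def by blast

lemma K_energy:
  assumes S: "finite S" "S \<subseteq> vertices \<epsilon> k"
  shows "((\<lambda>t. (\<Sum>x\<in>S. mass \<epsilon> k x * (1 - measure_pmf.expectation (K t x) (indicator S))) / t)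
    \<longlongrightarrow> energy \<epsilon> k (indicator S)) (at_right 0)"
proof -
  have "integrable (speed \<epsilon> k) (\<lambda>x. (indicator S x :: real)\<^sup>2)"
    by (rule speed_integral_finite(1)[OF S]) auto
  then have "((\<lambda>t. (\<integral>x. (indicator S x - measure_pmf.expectation (K t x) (indicator S)) * indicator S x \<partial>speed \<epsilon> k) / t)
      \<longlongrightarrow> energy \<epsilon> k (indicator S)) (at_right 0)"
    using K unfolding walk_semigroup_def by blast
  moreover have "(\<integral>x. (indicator S x - measure_pmf.expectation (K t x) (indicator S)) * indicator S x \<partial>speed \<epsilon> k) =
      (\<Sum>x\<in>S. mass \<epsilon> k x * (1 - measure_pmf.expectation (K t x) (indicator S)))" for t
    by (subst speed_integral_finite(2)[OF S]) auto
  ultimately show ?thesis by simp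
qed

lemma holding_rate:
  assumes x: "x \<in> vertices \<epsilon> k"
  shows "((\<lambda>t. (1 - pmf (K t x) x) / t) \<longlongrightarrow> 4 ^ k) (at_right 0)"
proof -
  have "((\<lambda>t. mass \<epsilon> k x * (1 - pmf (K t x) x) / t) \<longlongrightarrow> 4 ^ k * mass \<epsilon> k x) (at_right 0)"
    using K_energy[of "{x}"] x by (simp add: energy_point[OF x] measure_pmf_single)
  then have "((\<lambda>t. (mass \<epsilon> k x * (1 - pmf (K t x) x) / t) / mass \<epsilon> k x) \<longlongrightarrow> (4 ^ k * mass \<epsilon> k x) / mass \<epsilon> k x) (at_right 0)"
    by (intro tendsto_intros) (use mass_pos[OF x] in auto)
  then show ?thesis using mass_pos[OF x] by simp
qed

text \<open>Polarising the form at the indicators of \<open>{x}\<close>, \<open>{y}\<close> and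
  \<open>{x, y}\<close> isolates \<open>pmf (K t x) y\<close> and \<open>pmf (K t y) x\<close>;
  weighted with the masses the two are equal, which explains the factor 2.\<close>

lemma jump_rate:
  assumes x: "x \<in> vertices \<epsilon> k" and y: "y \<in> vertices \<epsilon> k" and xy: "x \<noteq> y"
  shows "((\<lambda>t. pmf (K t x) y / t) \<longlongrightarrow> rate \<epsilon> k x y) (at_right 0)"
proof -
  define E where "E S t = (\<Sum>x\<in>S. mass \<epsilon> k x * (1 - measure_pmf.expectation (K t x) (indicator S))) / t" for S t
  have l: "((\<lambda>t. (E {x} t + E {y} t - E {x, y} t) / (2 * mass \<epsilon> k x)) \<longlongrightarrow>
      (energy \<epsilon> k (indicator {x}) + energy \<epsilon> k (indicator {y}) - energy \<epsilon> k (indicator {x, y})) / (2 * mass \<epsilon> k x)) (at_right 0)"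
    using mass_pos[OF x] K_energy[of "{x}"] K_energy[of "{y}"] K_energy[of "{x, y}"] x y unfolding E_def
    by (intro tendsto_intros) auto
  have "(energy \<epsilon> k (indicator {x}) + energy \<epsilon> k (indicator {y}) - energy \<epsilon> k (indicator {x, y})) / (2 * mass \<epsilon> k x) = rate \<epsilon> k x y"
    unfolding energy_pair[OF xy] rate_def using mass_pos[OF x] by simp
  moreover have "\<forall>\<^sub>F t in at_right 0. (E {x} t + E {y} t - E {x, y} t) / (2 * mass \<epsilon> k x) = pmf (K t x) y / t"
    using eventually_at_right_less[of 0]
  proof eventually_elim
    fix t :: real assume t: "0 < t"
    have "E {x} t + E {y} t - E {x, y} t = (mass \<epsilon> k x * pmf (K t x) y + mass \<epsilon> k y * pmf (K t y) x) / t"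
      using xy unfolding E_def expectation_indicator_pair[OF xy]
      by (simp add: measure_pmf_single diff_divide_distrib[symmetric] add_divide_distrib[symmetric] algebra_simps)
    also have "mass \<epsilon> k y * pmf (K t y) x = mass \<epsilon> k x * pmf (K t x) y" using K_symmetric[of t x y] t x y by simp
    finally show "(E {x} t + E {y} t - E {x, y} t) / (2 * mass \<epsilon> k x) = pmf (K t x) y / t"
      using mass_pos[OF x] t by (simp add: field_simps)
  qed
  ultimately show ?thesis using l by (simp add: tendsto_cong)
qed

text \<open>By the semigroup law the probability of being at the starting point is
  supermultiplicative in time. Bernoulli's inequality thus reduces time \<open>t\<close> to time
  \<open>t / n\<close>, where \<open>holding_rate\<close> applies: a limit at 0 becomes a bound for
  all times, uniform in \<open>x\<close>.\<close>

lemma holding_bound: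
  assumes x: "x \<in> vertices \<epsilon> k" and t: "t \<ge> 0"
  shows "1 - pmf (K t x) x \<le> 4 ^ k * t"
proof (cases "t = 0")
  case True
  then show ?thesis using K_zero[OF x] by simp
next
  case False
  then have t: "t > 0" using t by simp
  have mult: "pmf (K s x) x * pmf (K u x) x \<le> pmf (K (s + u) x) x" if "s \<ge> 0" "u \<ge> 0" for s u
  proof -
    have "pmf (K s x) x * pmf (K u x) x = (\<integral>y. indicator {x} y * pmf (K u y) x \<partial>K s x)"
      by (subst integral_measure_pmf_real[of "{x}"]) (auto simp: indicator_def split: if_splits)
    also have "\<dots> \<le> (\<integral>y. pmf (K u y) x \<partial>K s x)"
      by (intro integral_mono integrable_pmf_bounded[of _ 1]) (auto simp: indicator_def pmf_le_1)
    also have "\<dots> = pmf (K (s + u) x) x" unfolding K_add[OF that x] pmf_bind ..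
    finally show ?thesis .
  qed
  have pow: "pmf (K s x) x ^ n \<le> pmf (K (real n * s) x) x" if s: "s \<ge> 0" for s n
  proof (induction n)
    case 0 then show ?case using K_zero[OF x] by simp
  next
    case (Suc n)
    have "pmf (K s x) x ^ Suc n \<le> pmf (K (real n * s) x) x * pmf (K s x) x"
      unfolding power_Suc2 by (rule mult_right_mono[OF Suc pmf_nonneg])
    also have "\<dots> \<le> pmf (K (real n * s + s) x) x" using s by (intro mult) auto
    finally show ?case by (simp add: algebra_simps)
  qed
  have le: "1 - pmf (K t x) x \<le> t * ((1 - pmf (K (t / real (Suc n)) x) x) / (t / real (Suc n)))" for n
  proof -
    let ?p = "pmf (K (t / real (Suc n)) x) x"
    have "1 + real (Suc n) * (?p - 1) \<le> (1 + (?p - 1)) ^ Suc n"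
      by (rule Bernoulli_inequality) (simp add: pmf_nonneg)
    also have "\<dots> \<le> pmf (K t x) x" using pow[of "t / real (Suc n)" "Suc n"] t by simp
    finally have "1 - pmf (K t x) x \<le> real (Suc n) * (1 - ?p)" by (simp add: algebra_simps)
    also have "\<dots> = t * ((1 - ?p) / (t / real (Suc n)))" using t by simp
    finally show ?thesis .
  qed
  have "(\<lambda>n. t / real (Suc n)) \<longlonglongrightarrow> 0" by (rule LIMSEQ_Suc[OF lim_const_over_n])
  then have "filterlim (\<lambda>n. t / real (Suc n)) (at_right 0) sequentially"
    by (rule tendsto_imp_filterlim_at_right) (use t in auto)
  from filterlim_compose[OF holding_rate[OF x] this]
  have "(\<lambda>n. t * ((1 - pmf (K (t / real (Suc n)) x) x) / (t / real (Suc n)))) \<longlonglongrightarrow> t * 4 ^ k"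
    by (intro tendsto_mult tendsto_const)
  from LIMSEQ_le_const[OF this, of "1 - pmf (K t x) x"] le show ?thesis by (auto simp: mult.commute)
qed

lemma K_integrable: "(\<And>x. 0 \<le> f x) \<Longrightarrow> (\<And>x. f x \<le> (1::real)) \<Longrightarrow> integrable (measure_pmf (K t x)) f"
  by (rule integrable_pmf_bounded[of _ 1]) auto

text \<open>\<open>f\<close> changes by at most 1, and only if the walk is no longer at
  \<open>x\<close>.\<close>

lemma semigroup_lipschitz:
  assumes f: "\<And>x. 0 \<le> f x" "\<And>x. f x \<le> (1::real)" and x: "x \<in> vertices \<epsilon> k" and t: "t \<ge> 0"
  shows "\<bar>measure_pmf.expectation (K t x) f - f x\<bar> \<le> 4 ^ k * t"
proof -
  have "measure_pmf.expectation (K t x) f - f x = measure_pmf.expectation (K t x) (\<lambda>y. f y - f x)"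
    using K_integrable[OF f] by simp
  also have "\<bar>\<dots>\<bar> \<le> measure_pmf.expectation (K t x) (\<lambda>y. \<bar>f y - f x\<bar>)"
    by (rule integral_abs_bound)
  also have "\<dots> \<le> measure_pmf.expectation (K t x) (\<lambda>y. 1 - indicator {x} y)"
  proof (rule integral_mono)
    show "integrable (measure_pmf (K t x)) (\<lambda>y. \<bar>f y - f x\<bar>)" using K_integrable[OF f] by simp
    show "integrable (measure_pmf (K t x)) (\<lambda>y. 1 - indicator {x} y :: real)"
      by (rule integrable_pmf_bounded[of _ 1]) (auto simp: indicator_def)
    fix y show "\<bar>f y - f x\<bar> \<le> 1 - indicator {x} y" using f[of x] f[of y] by (auto simp: indicator_def)
  qed
  also have "\<dots> = 1 - pmf (K t x) x"
    by (subst Bochner_Integration.integral_diff) (auto simp: measure_pmf_single intro!: integrable_pmf_bounded[of _ 1])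
  also have "\<dots> \<le> 4 ^ k * t" by (rule holding_bound[OF x t])
  finally show ?thesis .
qed

text \<open>The expectation of \<open>f\<close> grows at a rate of at most \<open>C\<close> times
  the probability of \<open>S\<close>; this is the integrated form. A linear bound for
  \<open>S\<close> with \<open>A = 0\<close> produces a quadratic one for \<open>f\<close>.\<close>

lemma semigroup_growth:
  assumes f: "\<And>x. 0 \<le> f x" "\<And>x. f x \<le> (1::real)" and C: "C \<ge> 0"
    and gen: "\<And>y. y \<in> vertices \<epsilon> k \<Longrightarrow> generator_le K f (C * indicator S y) y"
    and x: "x \<in> vertices \<epsilon> k" and S: "\<And>t. t \<ge> 0 \<Longrightarrow> measure (measure_pmf (K t x)) S \<le> A + D * t"
    and AD: "D \<ge> 0" and t: "t \<ge> 0"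
  shows "measure_pmf.expectation (K t x) f \<le> f x + C * (A * t + D * t\<^sup>2 / 2)"
proof -
  define u where "u t = measure_pmf.expectation (K t x) f" for t
  define p where "p s y = measure_pmf.expectation (K s y) f" for s y
  \<comment> \<open>The excess of the difference quotient over the bound claimed for it. At each
    vertex it vanishes in the limit, but not uniformly; the bound \<open>4 ^ k\<close> from
    \<open>plip\<close> permits dominated convergence.\<close>
  define F where "F s y = max 0 ((p s y - f y) / s - C * indicator S y)" for s y
  have p: "0 \<le> p s y" "p s y \<le> 1" for s y
    using f K_integrable[OF f] measure_pmf.integral_le_const[of "K s y" f 1] by (auto simp: p_def)
  have p_int: "integrable (measure_pmf q) (p s)" for q s
    by (rule integrable_pmf_bounded[of _ 1]) (use p in auto)
  have CK: "u (t + s) = measure_pmf.expectation (K t x) (p s)" if "t \<ge> 0" "s \<ge> 0" for t s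
    unfolding u_def p_def K_add[OF that x] by (rule expectation_bind_pmf[OF f])
  have V: "AE y in measure_pmf (K t x). y \<in> vertices \<epsilon> k" if "t \<ge> 0" for t
    using K_vertices[OF that x] by (auto simp: AE_measure_pmf_iff)
  have plip: "\<bar>p s y - f y\<bar> \<le> 4 ^ k * s" if "y \<in> vertices \<epsilon> k" "s \<ge> 0" for s y
    unfolding p_def by (rule semigroup_lipschitz[OF f that])
  have fi: "integrable (measure_pmf q) f" for q
    by (rule integrable_pmf_bounded[of _ 1]) (use f in auto)
  have ulip: "\<bar>u (t + s) - u t\<bar> \<le> 4 ^ k * s" if "t \<ge> 0" "s \<ge> 0" for t s
  proof -
    have "u (t + s) - u t = measure_pmf.expectation (K t x) (\<lambda>y. p s y - f y)"
      unfolding CK[OF that] by (simp add: u_def p_int fi)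
    also have "\<bar>\<dots>\<bar> \<le> measure_pmf.expectation (K t x) (\<lambda>y. \<bar>p s y - f y\<bar>)" by (rule integral_abs_bound)
    also have "\<dots> \<le> 4 ^ k * s"
      by (rule measure_pmf.integral_le_const) (use V[OF that(1)] plip that p_int fi in auto)
    finally show ?thesis .
  qed
  have ucont: "continuous_on {0..} u"
    unfolding continuous_on_iff
  proof (intro ballI allI impI)
    fix a e :: real assume a: "a \<in> {0..}" and e: "e > 0"
    have "dist (u b) (u a) < e" if b: "b \<in> {0..}" "dist b a < e / 4 ^ k" for b
    proof -
      have "\<bar>u b - u a\<bar> \<le> 4 ^ k * \<bar>b - a\<bar>"
        using ulip[of a "b - a"] ulip[of b "a - b"] a b(1) by (cases "a \<le> b") (auto simp: abs_minus_commute)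
      also have "\<dots> < e" using b(2) by (simp add: dist_real_def field_simps)
      finally show ?thesis by (simp add: dist_real_def)
    qed
    then show "\<exists>d>0. \<forall>b\<in>{0..}. dist b a < d \<longrightarrow> dist (u b) (u a) < e"
      using e by (intro exI[of _ "e / 4 ^ k"]) auto
  qed
  have F_bound: "F s y \<le> 4 ^ k" if "y \<in> vertices \<epsilon> k" "s > 0" for s y
  proof -
    have "(p s y - f y) / s \<le> 4 ^ k" using plip[of y s] that by (simp add: pos_divide_le_eq)
    moreover have "0 \<le> C * indicator S y" using C by simp
    ultimately show ?thesis by (simp add: F_def)
  qed
  have F_lim: "((\<lambda>s. F s y) \<longlongrightarrow> 0) (at_right 0)" if y: "y \<in> vertices \<epsilon> k" for y
  proof (rule tendstoI)
    fix e :: real assume e: "e > 0"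
    then have "\<forall>\<^sub>F s in at_right 0. p s y \<le> f y + s * (C * indicator S y + e / 2)"
      using gen[OF y] unfolding generator_le_def p_def by (meson half_gt_zero)
    with eventually_at_right_less[of 0] show "\<forall>\<^sub>F s in at_right 0. dist (F s y) 0 < e"
    proof eventually_elim
      fix s :: real assume s: "0 < s" "p s y \<le> f y + s * (C * indicator S y + e / 2)"
      then have "(p s y - f y) / s \<le> C * indicator S y + e / 2" by (simp add: pos_divide_le_eq mult.commute)
      then show "dist (F s y) 0 < e" using e by (auto simp: F_def dist_real_def max_def)
    qed
  qed
  have EF: "((\<lambda>s. measure_pmf.expectation (K t x) (F s)) \<longlongrightarrow> 0) (at_right 0)" if t: "t \<ge> 0" for t
  proof (rule tendsto_at_right_sequentially[of 0 1])
    fix \<sigma> :: "nat \<Rightarrow> real" assume \<sigma>: "\<And>n. 0 < \<sigma> n" "\<sigma> \<longlonglongrightarrow> 0"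
    then have fl: "filterlim \<sigma> (at_right 0) sequentially" by (intro tendsto_imp_filterlim_at_right) auto
    have FL: "(\<lambda>n. F (\<sigma> n) y) \<longlonglongrightarrow> 0" if "y \<in> vertices \<epsilon> k" for y
      by (rule filterlim_compose[OF F_lim[OF that] fl])
    have "(\<lambda>n. measure_pmf.expectation (K t x) (F (\<sigma> n))) \<longlonglongrightarrow> measure_pmf.expectation (K t x) (\<lambda>_. 0)"
    proof (rule integral_dominated_convergence[where w = "\<lambda>_. 4 ^ k"])
      show "AE y in measure_pmf (K t x). (\<lambda>n. F (\<sigma> n) y) \<longlonglongrightarrow> 0"
        by (rule eventually_mono[OF V[OF t] FL])
      show "AE y in measure_pmf (K t x). norm (F (\<sigma> n) y) \<le> 4 ^ k" for n
        using V[OF t] by eventually_elim (use F_bound \<sigma>(1) in \<open>auto simp: F_def\<close>)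
    qed auto
    then show "(\<lambda>n. measure_pmf.expectation (K t x) (F (\<sigma> n))) \<longlonglongrightarrow> 0" by simp
  qed simp
  define w where "w t = u t - C * (A * t + D * t\<^sup>2 / 2)" for t
  have "w t \<le> w 0"
  proof (rule dini_nonincreasing[OF _ _ t])
    show "continuous_on {0..} w" unfolding w_def by (intro continuous_intros ucont) auto
    fix t e :: real assume t: "t \<ge> 0" and e: "e > 0"
    have "\<forall>\<^sub>F s in at_right 0. measure_pmf.expectation (K t x) (F s) < e"
      using EF[OF t] e by (rule order_tendstoD)
    with eventually_at_right_less[of 0] show "\<forall>\<^sub>F s in at_right 0. w (t + s) \<le> w t + e * s"
    proof eventually_elim
      fix s :: real assume s: "0 < s" "measure_pmf.expectation (K t x) (F s) < e"
      have Fi: "integrable (measure_pmf (K t x)) (F s)"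
      proof (rule measure_pmf.integrable_const_bound[where B = "4 ^ k"])
        show "AE y in measure_pmf (K t x). norm (F s y) \<le> 4 ^ k"
          using V[OF t] by eventually_elim (use F_bound s(1) in \<open>auto simp: F_def\<close>)
      qed simp
      have Si: "integrable (measure_pmf (K t x)) (indicator S :: _ \<Rightarrow> real)"
        by (rule integrable_pmf_bounded[of _ 1]) (auto simp: indicator_def)
      have "u (t + s) = measure_pmf.expectation (K t x) (p s)" using CK t s by simp
      also have "\<dots> \<le> measure_pmf.expectation (K t x) (\<lambda>y. f y + s * (C * indicator S y + F s y))"
      proof (rule integral_mono[OF p_int])
        show "integrable (measure_pmf (K t x)) (\<lambda>y. f y + s * (C * indicator S y + F s y))"
          by (intro Bochner_Integration.integrable_add integrable_mult_right fi Fi Si)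
        fix y
        have "(p s y - f y) / s \<le> C * indicator S y + F s y" by (simp add: F_def)
        then show "p s y \<le> f y + s * (C * indicator S y + F s y)"
          using s(1) by (simp add: pos_divide_le_eq mult.commute)
      qed
      also have "\<dots> = u t + s * (C * measure (measure_pmf (K t x)) S + measure_pmf.expectation (K t x) (F s))"
        using fi Fi Si by (simp add: u_def)
      also have "\<dots> \<le> u t + s * (C * (A + D * t) + e)"
        using s S[OF t] C by (intro add_mono mult_left_mono) auto
      \<comment> \<open>The added term completes the increment of \<open>D * t\<^sup>2 / 2\<close>
        between \<open>t\<close> and \<open>t + s\<close>.\<close>
      also have "\<dots> \<le> u t + s * (C * (A + D * t) + e) + C * D * s\<^sup>2 / 2" using C AD by simp
      finally show "w (t + s) \<le> w t + e * s"
        by (simp add: w_def power2_sum algebra_simps add_divide_distrib)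
    qed
  qed
  then show ?thesis using K_zero[OF x] by (simp add: w_def u_def)
qed

text \<open>An expectation cannot exceed the maximum of \<open>f\<close>, so at such a point no jump
  rates have to be known.\<close>

lemma generator_le_max:
  assumes f: "\<And>x. 0 \<le> f x" "\<And>x. f x \<le> (1::real)" and "f x = 1" "b \<ge> 0"
  shows "generator_le K f b x"
  unfolding generator_le_def
proof (intro allI impI)
  fix e :: real assume e: "e > 0"
  have "measure_pmf.expectation (K s x) f \<le> 1" for s
    using f K_integrable[OF f] measure_pmf.integral_le_const[of "K s x" f 1] by auto
  moreover have "0 \<le> s * (b + e)" if "0 < s" for s using that e assms(4) by simp
  ultimately have "measure_pmf.expectation (K s x) f \<le> f x + s * (b + e)" if "0 < s" for s
    using that assms(3) by (smt (verit))
  then show "\<forall>\<^sub>F s in at_right 0. measure_pmf.expectation (K s x) f \<le> f x + s * (b + e)"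
    by (rule eventually_mono[OF eventually_at_right_less])
qed

text \<open>As \<open>1 - f\<close> is nonnegative, all jumps beyond the neighbours may be dropped
  from its expectation. Thus finitely many limits suffice, with no interchange of a limit and an
  infinite sum.\<close>

lemma generator_le_rates:
  assumes f: "\<And>x. 0 \<le> f x" "\<And>x. f x \<le> (1::real)" and x: "x \<in> vertices \<epsilon> k"
    and le: "(\<Sum>y\<in>nbrs \<epsilon> k x. rate \<epsilon> k x y * (f y - f x)) \<le> b"
  shows "generator_le K f b x"
  unfolding generator_le_def
proof (intro allI impI)
  fix e :: real assume e: "e > 0"
  let ?N = "nbrs \<epsilon> k x"
  have xN: "x \<notin> ?N" and NV: "y \<in> ?N \<Longrightarrow> y \<in> vertices \<epsilon> k" for y
    using adjacent_vertices by (auto simp: nbrs_def)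
  define G where "G s = (1 - f x) * ((1 - pmf (K s x) x) / s) - (\<Sum>y\<in>?N. (pmf (K s x) y / s) * (1 - f y))" for s
  have "(G \<longlongrightarrow> (1 - f x) * 4 ^ k - (\<Sum>y\<in>?N. rate \<epsilon> k x y * (1 - f y))) (at_right 0)"
    unfolding G_def using xN NV x by (intro tendsto_intros holding_rate jump_rate) auto
  moreover have "(1 - f x) * 4 ^ k - (\<Sum>y\<in>?N. rate \<epsilon> k x y * (1 - f y)) = (\<Sum>y\<in>?N. rate \<epsilon> k x y * (f y - f x))"
  proof -
    \<comment> \<open>The rates to the neighbours exhaust the holding rate, so the jumps that were
      dropped contribute nothing in the limit.\<close>
    have eq: "(1 - f x) * 4 ^ k = (\<Sum>y\<in>?N. rate \<epsilon> k x y * (1 - f x))"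
      unfolding sum_rate[OF x, symmetric] sum_distrib_left by (simp add: mult.commute)
    show ?thesis unfolding eq sum_subtractf[symmetric] by (rule sum.cong) (auto simp: algebra_simps)
  qed
  ultimately have "\<forall>\<^sub>F s in at_right 0. G s < b + e" using le e by (intro order_tendstoD) auto
  with eventually_at_right_less[of 0]
  show "\<forall>\<^sub>F s in at_right 0. measure_pmf.expectation (K s x) f \<le> f x + s * (b + e)"
  proof eventually_elim
    fix s :: real assume s: "0 < s" "G s < b + e"
    let ?g = "\<lambda>z. indicator (insert x ?N) z * (1 - f z)"
    have "measure_pmf.expectation (K s x) ?g = (\<Sum>z\<in>insert x ?N. ?g z * pmf (K s x) z)"
      using finite_nbrs by (intro integral_measure_pmf_real) (auto simp: indicator_def split: if_splits)
    also have "\<dots> = (1 - f x) * pmf (K s x) x + (\<Sum>y\<in>?N. pmf (K s x) y * (1 - f y))"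
      using xN finite_nbrs by (simp add: mult.commute)
    finally have g: "measure_pmf.expectation (K s x) ?g = (1 - f x) * pmf (K s x) x + (\<Sum>y\<in>?N. pmf (K s x) y * (1 - f y))" .
    have "measure_pmf.expectation (K s x) ?g \<le> measure_pmf.expectation (K s x) (\<lambda>z. 1 - f z)"
    proof (rule integral_mono)
      show "integrable (measure_pmf (K s x)) ?g"
        by (rule integrable_pmf_bounded[of _ 1]) (use f in \<open>auto simp: indicator_def\<close>)
      show "integrable (measure_pmf (K s x)) (\<lambda>z. 1 - f z)" using K_integrable[OF f] by simp
    qed (use f in \<open>auto simp: indicator_def\<close>)
    also have "\<dots> = 1 - measure_pmf.expectation (K s x) f" using K_integrable[OF f] by simp
    finally have "measure_pmf.expectation (K s x) f - f x \<le> (1 - f x) * (1 - pmf (K s x) x) - (\<Sum>y\<in>?N. pmf (K s x) y * (1 - f y))"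
      unfolding g by (simp add: algebra_simps)
    also have "\<dots> = s * G s"
    proof -
      have a: "s * ((1 - f x) * ((1 - pmf (K s x) x) / s)) = (1 - f x) * (1 - pmf (K s x) x)" using s(1) by simp
      have b: "s * (\<Sum>y\<in>?N. (pmf (K s x) y / s) * (1 - f y)) = (\<Sum>y\<in>?N. pmf (K s x) y * (1 - f y))"
        using s(1) by (simp add: sum_distrib_left)
      show ?thesis unfolding G_def right_diff_distrib[of s] a b ..
    qed
    also have "\<dots> \<le> s * (b + e)" using s by simp
    finally show "measure_pmf.expectation (K s x) f \<le> f x + s * (b + e)" by simp
  qed
qed

end

section \<open>Quadratic escape estimates\<close>

lemma rate_nonneg: "x \<in> vertices \<epsilon> k \<Longrightarrow> rate \<epsilon> k x y \<ge> 0"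
  using mass_pos[of x \<epsilon> k] by (auto simp: rate_def conduct_def)

text \<open>The square removes the convex kink at \<open>a\<close>, where the generator of a linear
  ramp would be of order \<open>1 / mesh k\<close>; the concave kink at the cap 1 only helps a bound
  from above. \<open>Q\<close> will be a squared distance, and the bump rises between the levels
  \<open>a\<close> and \<open>a + b\<close>.\<close>

definition bump :: "('a \<Rightarrow> real) \<Rightarrow> real \<Rightarrow> real \<Rightarrow> 'a \<Rightarrow> real" where
  "bump Q a b y = min 1 ((max 0 (Q y - a))\<^sup>2 / b\<^sup>2)"

lemma bump_bounds: "0 \<le> bump Q a b y" "bump Q a b y \<le> 1"
  by (auto simp: bump_def)

lemma bump_eq_1: "b > 0 \<Longrightarrow> Q y \<ge> a + b \<Longrightarrow> bump Q a b y = 1"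
proof -
  assume b: "b > 0" "Q y \<ge> a + b"
  then have "b\<^sup>2 \<le> (max 0 (Q y - a))\<^sup>2" by (intro power_mono) auto
  then show ?thesis using b by (simp add: bump_def)
qed

lemma bump_eq_0: "Q y \<le> a \<Longrightarrow> bump Q a b y = 0"
  by (simp add: bump_def)

lemma bump_less_1: "b > 0 \<Longrightarrow> Q y < a + b \<Longrightarrow> bump Q a b y = (max 0 (Q y - a))\<^sup>2 / b\<^sup>2"
proof -
  assume b: "b > 0" "Q y < a + b"
  then have "(max 0 (Q y - a))\<^sup>2 \<le> b\<^sup>2" by (intro power_mono) auto
  then show ?thesis using b by (simp add: bump_def)
qed

text \<open>The three alternatives are: far away; so close that all neighbours are close too; and, in between,
  a vertex at which the walk moves like simple random walk for the squared distance \<open>Q\<close>.\<close>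

definition good_at :: "real \<Rightarrow> nat \<Rightarrow> (point \<Rightarrow> real) \<Rightarrow> real \<Rightarrow> real \<Rightarrow> point \<Rightarrow> bool" where
  "good_at \<epsilon> k Q c b y \<longleftrightarrow> Q y \<ge> c + 3 * b \<or> (Q y \<le> c \<and> (\<forall>z\<in>nbrs \<epsilon> k y. Q z \<le> c)) \<or>
     ((\<Sum>z\<in>nbrs \<epsilon> k y. rate \<epsilon> k y z * (Q z - Q y)) \<le> 1 \<and>
      (\<Sum>z\<in>nbrs \<epsilon> k y. rate \<epsilon> k y z * (Q z - Q y)\<^sup>2) \<le> 1 + 4 * Q y \<and>
      (\<forall>z\<in>nbrs \<epsilon> k y. \<bar>Q z - Q y\<bar> \<le> b))"

text \<open>A second-order expansion of the squared positive part as an inequality: the kink costs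
  no more than the full square of the increment, and the cap can only lower the value at
  \<open>z\<close>.\<close>

lemma bump_step: "b > 0 \<Longrightarrow> Q y < a + b \<Longrightarrow>
    bump Q a b z - bump Q a b y \<le> (2 * max 0 (Q y - a) * (Q z - Q y) + (Q z - Q y)\<^sup>2) / b\<^sup>2"
proof -
  assume b: "b > 0" "Q y < a + b"
  have pos: "(max 0 (s + e))\<^sup>2 \<le> (max 0 s)\<^sup>2 + 2 * max 0 s * e + e\<^sup>2" for s e :: real
  proof (cases "s \<ge> 0")
    case True
    have "(max 0 (s + e))\<^sup>2 \<le> (s + e)\<^sup>2" by (auto simp: max_def)
    then show ?thesis using True by (simp add: power2_sum)
  next
    case False
    then have "\<bar>max 0 (s + e)\<bar> \<le> \<bar>e\<bar>" by auto
    then have "(max 0 (s + e))\<^sup>2 \<le> e\<^sup>2" by (rule abs_le_square_iff[THEN iffD1])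
    then show ?thesis using False by simp
  qed
  have "bump Q a b z - bump Q a b y \<le> (max 0 (Q z - a))\<^sup>2 / b\<^sup>2 - (max 0 (Q y - a))\<^sup>2 / b\<^sup>2"
    using bump_less_1[of b Q y a, OF b] by (simp add: bump_def)
  also have "\<dots> = ((max 0 ((Q y - a) + (Q z - Q y)))\<^sup>2 - (max 0 (Q y - a))\<^sup>2) / b\<^sup>2" by (simp add: diff_divide_distrib)
  also have "\<dots> \<le> (2 * max 0 (Q y - a) * (Q z - Q y) + (Q z - Q y)\<^sup>2) / b\<^sup>2"
    using pos[of "Q y - a" "Q z - Q y"] by (intro divide_right_mono) auto
  finally show ?thesis .
qed

lemma generator_bump:
  assumes K: "walk_semigroup \<epsilon> k K" and y: "y \<in> vertices \<epsilon> k" and good: "good_at \<epsilon> k Q c b y"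
    and b: "b > 0" and c: "c \<ge> 0" and a: "c \<le> a" "a \<le> c + 2 * b"
  shows "generator_le K (bump Q a b) ((1 + 4 * c + 18 * b) / b\<^sup>2) y"
proof (cases "Q y \<ge> a + b")
  case True
  show ?thesis using b c by (intro generator_le_max[OF K] bump_bounds bump_eq_1 True) auto
next
  case False
  then have Qy: "Q y < a + b" by simp
  let ?C = "(1 + 4 * c + 18 * b) / b\<^sup>2"
  have C: "?C \<ge> 0" using b c by simp
  have "(\<Sum>z\<in>nbrs \<epsilon> k y. rate \<epsilon> k y z * (bump Q a b z - bump Q a b y)) \<le> ?C"
    using good unfolding good_at_def
  proof (elim disjE conjE)
    assume "c + 3 * b \<le> Q y"
    then show ?thesis using Qy a by simp
  next
    assume "Q y \<le> c" "\<forall>z\<in>nbrs \<epsilon> k y. Q z \<le> c"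
    then have "bump Q a b y = 0" "\<And>z. z \<in> nbrs \<epsilon> k y \<Longrightarrow> bump Q a b z = 0" using a by (auto intro!: bump_eq_0)
    then show ?thesis using C by simp
  next
    assume s: "(\<Sum>z\<in>nbrs \<epsilon> k y. rate \<epsilon> k y z * (Q z - Q y)) \<le> 1"
      "(\<Sum>z\<in>nbrs \<epsilon> k y. rate \<epsilon> k y z * (Q z - Q y)\<^sup>2) \<le> 1 + 4 * Q y"
    define m where "m = max 0 (Q y - a)"
    have m: "0 \<le> m" "m \<le> b" using Qy b by (auto simp: m_def)
    have "(\<Sum>z\<in>nbrs \<epsilon> k y. rate \<epsilon> k y z * (bump Q a b z - bump Q a b y)) \<le>
        (\<Sum>z\<in>nbrs \<epsilon> k y. rate \<epsilon> k y z * ((2 * m * (Q z - Q y) + (Q z - Q y)\<^sup>2) / b\<^sup>2))"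
      unfolding m_def by (intro sum_mono mult_left_mono bump_step b Qy rate_nonneg y)
    also have "\<dots> = (2 * m * (\<Sum>z\<in>nbrs \<epsilon> k y. rate \<epsilon> k y z * (Q z - Q y)) +
        (\<Sum>z\<in>nbrs \<epsilon> k y. rate \<epsilon> k y z * (Q z - Q y)\<^sup>2)) / b\<^sup>2"
      by (simp add: sum_distrib_left sum_divide_distrib sum.distrib[symmetric] add_divide_distrib[symmetric] algebra_simps)
    also have "\<dots> \<le> (2 * m * 1 + (1 + 4 * Q y)) / b\<^sup>2"
      using s m by (intro divide_right_mono add_mono mult_left_mono) auto
    \<comment> \<open>Here \<open>m \<le> b\<close> and \<open>Q y < a + b \<le> c + 3 * b\<close>,
      so the numerator is at most \<open>1 + 4 * c + 14 * b\<close>.\<close>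
    also have "\<dots> \<le> ?C" using m Qy a b by (intro divide_right_mono) auto
    finally show ?thesis .
  qed
  then show ?thesis by (intro generator_le_rates[OF K] bump_bounds y)
qed

text \<open>Applying the generator bound twice turns the linear escape estimate into a quadratic one: in order to reach
  the second bump the walk first has to reach the support of its generator.\<close>

lemma escape_quadratic:
  assumes K: "walk_semigroup \<epsilon> k K" and good: "\<And>y. y \<in> vertices \<epsilon> k \<Longrightarrow> good_at \<epsilon> k Q c b y"
    and b: "b > 0" and c: "c \<ge> 0" and x: "x \<in> vertices \<epsilon> k" "Q x \<le> c" and t: "t \<ge> 0"
  shows "measure (measure_pmf (K t x)) {y. Q y \<ge> c + 3 * b} \<le> ((1 + 4 * c + 18 * b) / b\<^sup>2)\<^sup>2 / 2 * t\<^sup>2"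
proof -
  define C where "C = (1 + 4 * c + 18 * b) / b\<^sup>2"
  have C: "C \<ge> 0" using b c by (simp add: C_def)
  \<comment> \<open>\<open>f1\<close> equals 1 on \<open>S\<close>, and \<open>f2\<close> starts to
    rise at \<open>c + 2 * b\<close>. The gap of width \<open>b\<close> between the two levels is at
    least as wide as a single jump of \<open>Q\<close>.\<close>
  define f1 where "f1 = bump Q c b"
  define f2 where "f2 = bump Q (c + 2 * b) b"
  define S where "S = {y. Q y \<ge> c + b}"
  have le_E: "measure (measure_pmf p) A \<le> measure_pmf.expectation p f"
    if "\<And>y. 0 \<le> f y" "\<And>y. f y \<le> (1::real)" "\<And>y. y \<in> A \<Longrightarrow> f y = 1" for p :: "point pmf" and A f
  proof -
    have "measure (measure_pmf p) A = measure_pmf.expectation p (indicator A)" by simp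
    also have "\<dots> \<le> measure_pmf.expectation p f"
      using that by (intro integral_mono integrable_pmf_bounded[of _ 1]) (auto simp: indicator_def)
    finally show ?thesis .
  qed
  have g1: "generator_le K f1 (C * indicator UNIV y) y" if "y \<in> vertices \<epsilon> k" for y
    unfolding f1_def C_def using generator_bump[OF K that good[OF that] b c, of c] b by simp
  have E1: "measure_pmf.expectation (K s x) f1 \<le> C * s" if s: "s \<ge> 0" for s
  proof -
    have "measure_pmf.expectation (K s x) f1 \<le> f1 x + C * (1 * s + 0 * s\<^sup>2 / 2)"
      by (rule semigroup_growth[OF K _ _ C g1 x(1) _ _ s]) (auto simp: f1_def bump_bounds)
    then show ?thesis using bump_eq_0[of Q x c b] x(2) by (simp add: f1_def)
  qed
  have S: "measure (measure_pmf (K s x)) S \<le> 0 + C * s" if s: "s \<ge> 0" for s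
  proof -
    have "measure (measure_pmf (K s x)) S \<le> measure_pmf.expectation (K s x) f1"
      by (rule le_E) (auto simp: f1_def S_def bump_bounds bump_eq_1 b)
    then show ?thesis using E1[OF s] by simp
  qed
  \<comment> \<open>From outside \<open>S\<close> one jump does not reach the region where
    \<open>f2\<close> is positive, so there the generator bound improves from \<open>C\<close> to
    0.\<close>
  have g2: "generator_le K f2 (C * indicator S y) y" if y: "y \<in> vertices \<epsilon> k" for y
  proof (cases "y \<in> S")
    case True
    then show ?thesis unfolding f2_def C_def using generator_bump[OF K y good[OF y] b c, of "c + 2 * b"] b by simp
  next
    case False
    then have Qy: "Q y < c + b" by (simp add: S_def)
    have "Q z \<le> c + 2 * b" if z: "z \<in> nbrs \<epsilon> k y" for z
      using good[OF y] unfolding good_at_def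
    proof (elim disjE conjE)
      assume "\<forall>z\<in>nbrs \<epsilon> k y. Q z \<le> c"
      then show ?thesis using z b by force
    next
      assume "\<forall>z\<in>nbrs \<epsilon> k y. \<bar>Q z - Q y\<bar> \<le> b"
      then have "\<bar>Q z - Q y\<bar> \<le> b" using z by blast
      then show ?thesis using Qy by linarith
    qed (use Qy b in simp)
    then have "(\<Sum>z\<in>nbrs \<epsilon> k y. rate \<epsilon> k y z * (f2 z - f2 y)) \<le> 0"
      using Qy b by (simp add: f2_def bump_eq_0)
    then show ?thesis using False unfolding f2_def by (intro generator_le_rates[OF K] bump_bounds y) auto
  qed
  have "measure (measure_pmf (K t x)) {y. Q y \<ge> c + 3 * b} \<le> measure_pmf.expectation (K t x) f2"
    by (rule le_E) (auto simp: f2_def bump_bounds bump_eq_1 b)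
  also have "\<dots> \<le> f2 x + C * (0 * t + C * t\<^sup>2 / 2)"
    by (rule semigroup_growth[OF K _ _ C g2 x(1) S C t]) (auto simp: f2_def bump_bounds)
  also have "\<dots> = C\<^sup>2 / 2 * t\<^sup>2"
    using bump_eq_0[of Q x "c + 2 * b" b] x(2) b by (simp add: f2_def power2_eq_square)
  finally show ?thesis unfolding C_def .
qed

section \<open>Simple random walk away from the disk\<close>

lemma lattice_add_axis: "z \<in> lattice k \<Longrightarrow> z + axis i (of_int n * mesh k) \<in> lattice k"
  unfolding lattice_def
proof (intro CollectI allI)
  fix j assume "z \<in> {z. \<forall>i. \<exists>n::int. z $ i = of_int n * mesh k}"
  then obtain m :: int where m: "z $ j = of_int m * mesh k" by auto
  have "(z + axis i (of_int n * mesh k)) $ j = of_int (m + (if j = i then n else 0)) * mesh k"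
    using m by (auto simp: axis_def algebra_simps)
  then show "\<exists>l::int. (z + axis i (of_int n * mesh k)) $ j = of_int l * mesh k" by blast
qed

lemma norm_axis_real: "norm (axis i (a::real) :: real^2) = \<bar>a\<bar>"
  unfolding norm_vec_def L2_set_def sum_2 using exhaust_2[of i] by (auto simp: axis_def)

lemma norm2_axis: "(norm (w + axis i (a::real) :: real^2))\<^sup>2 = (norm w)\<^sup>2 + 2 * a * w $ i + a\<^sup>2"
proof -
  have "(norm (v :: real^2))\<^sup>2 = (v $ 1)\<^sup>2 + (v $ 2)\<^sup>2" for v
    by (simp add: norm_vec_def L2_set_def sum_2)
  then show ?thesis using exhaust_2[of i] by (auto simp: axis_def power2_sum)
qed

lemma unit_lattice_step:
  assumes "u \<in> lattice k" "v \<in> lattice k" "norm (u - v) = mesh k"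
  shows "\<exists>i. \<exists>s\<in>{1, -1}. v = u + axis i (s * mesh k)"
proof -
  obtain a where a: "\<And>i. u $ i = of_int (a i) * mesh k" using choice[OF assms(1)[unfolded lattice_def mem_Collect_eq]] by blast
  obtain b where b: "\<And>i. v $ i = of_int (b i) * mesh k" using choice[OF assms(2)[unfolded lattice_def mem_Collect_eq]] by blast
  define n where "n i = b i - a i" for i
  have v: "v $ i = u $ i + of_int (n i) * mesh k" for i unfolding a b n_def by (simp add: algebra_simps)
  have "(norm (u - v))\<^sup>2 = (of_int (n 1) * mesh k)\<^sup>2 + (of_int (n 2) * mesh k)\<^sup>2"
    unfolding norm_vec_def L2_set_def sum_2 by (simp add: v)
  also have "\<dots> = of_int ((n 1)\<^sup>2 + (n 2)\<^sup>2) * (mesh k)\<^sup>2" by (simp add: power_mult_distrib algebra_simps)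
  finally have "of_int ((n 1)\<^sup>2 + (n 2)\<^sup>2) = (1::real)" using assms(3) by simp
  then have sq: "(n 1)\<^sup>2 + (n 2)\<^sup>2 = 1" by linarith
  have "n i \<in> {-1, 0, 1}" for i
  proof -
    have "(n i)\<^sup>2 \<le> 1" using sq exhaust_2[of i] by (smt (verit) zero_le_power2)
    then have "\<bar>n i\<bar> \<le> 1" by (simp add: abs_square_le_1)
    then show ?thesis by auto
  qed
  then have "n 1 \<in> {-1, 0, 1}" "n 2 \<in> {-1, 0, 1}" by blast+
  then consider "n 1 = 0" "n 2 \<in> {1, -1}" | "n 2 = 0" "n 1 \<in> {1, -1}" using sq by fastforce
  then show ?thesis
  proof cases
    case 1
    then show ?thesis by (intro exI[of _ 2] bexI[of _ "of_int (n 2)"]) (auto simp: vec_eq_iff forall_2 v axis_def)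
  next
    case 2
    then show ?thesis by (intro exI[of _ 1] bexI[of _ "of_int (n 1)"]) (auto simp: vec_eq_iff forall_2 v axis_def)
  qed
qed

text \<open>Pairs of a coordinate direction and a signed step length; sums over neighbours become
  double sums.\<close>

definition unit_steps :: "nat \<Rightarrow> (2 \<times> real) set" where
  "unit_steps k = UNIV \<times> {mesh k, - mesh k}"

text \<open>The margin \<open>mesh k\<close> keeps the four lattice neighbours, and the segments to
  them, outside the disk, and it excludes \<open>Star\<close> as a neighbour: such a vertex sees the
  full square lattice.\<close>

lemma nbrs_Plane:
  assumes z: "z \<in> lattice k" "norm z > \<epsilon> + mesh k"
  shows "nbrs \<epsilon> k (Plane z) = (\<lambda>(i, a). Plane (z + axis i a)) ` unit_steps k"
    "inj_on (\<lambda>(i, a). Plane (z + axis i a)) (unit_steps k)"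
proof -
  have far: "norm p > \<epsilon>" if "norm (z - p) \<le> mesh k" for p
    using norm_triangle_ineq2[of z "z - p"] z(2) that by simp
  show "nbrs \<epsilon> k (Plane z) = (\<lambda>(i, a). Plane (z + axis i a)) ` unit_steps k"
  proof (intro equalityI subsetI)
    fix y assume y: "y \<in> nbrs \<epsilon> k (Plane z)"
    then have adj: "adjacent \<epsilon> k (Plane z) y" by (simp add: nbrs_def)
    have "y \<noteq> Star"
    proof
      assume "y = Star"
      then have "norm z \<le> \<epsilon> + mesh k" using adjacent_Star[of \<epsilon> k "Plane z"] adj by (simp add: adjacent_sym)
      then show False using z by simp
    qed
    then obtain v where v: "v \<in> lattice k" "y = Plane v" "norm (z - v) = mesh k" using adjacent_Plane[OF adj] by blast
    then obtain i s where "s \<in> {1, -1}" "v = z + axis i (s * mesh k)" using unit_lattice_step[OF z(1) v(1,3)] by blast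
    then show "y \<in> (\<lambda>(i, a). Plane (z + axis i a)) ` unit_steps k"
      using v(2) by (intro image_eqI[of _ _ "(i, s * mesh k)"]) (auto simp: unit_steps_def)
  next
    fix y assume "y \<in> (\<lambda>(i, a). Plane (z + axis i a)) ` unit_steps k"
    then obtain i a where ia: "a \<in> {mesh k, - mesh k}" "y = Plane (z + axis i a)" by (auto simp: unit_steps_def)
    define v where "v = z + axis i a"
    have "a = of_int 1 * mesh k \<or> a = of_int (-1) * mesh k" using ia(1) by auto
    then have v: "v \<in> lattice k" unfolding v_def using lattice_add_axis[OF z(1)] by blast
    have n: "norm (z - v) = mesh k" using ia(1) by (auto simp: v_def norm_axis_real)
    have seg: "closed_segment z v \<inter> cball 0 \<epsilon> = {}"
    proof -
      have "p \<notin> cball 0 \<epsilon>" if p: "p \<in> closed_segment z v" for p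
      proof -
        have "norm (z - p) \<le> norm (z - v)"
          using segment_bound(1)[OF p] by (simp add: norm_minus_commute)
        then have "norm p > \<epsilon>" using n by (intro far) simp
        then show ?thesis by simp
      qed
      then show ?thesis by blast
    qed
    have "edge \<epsilon> k (Plane z) (Plane v)"
      using z v n seg far[of v] far[of z] by (intro edge.plane_plane) auto
    then show "y \<in> nbrs \<epsilon> k (Plane z)" by (simp add: nbrs_def adjacent_def ia v_def)
  qed
  show "inj_on (\<lambda>(i, a). Plane (z + axis i a)) (unit_steps k)"
  proof (rule inj_onI, clarify)
    fix i j :: 2 and a b assume m: "(i, a) \<in> unit_steps k" "(j, b) \<in> unit_steps k" and eq: "z + axis i a = z + axis j b"
    have nz: "a \<noteq> 0" "b \<noteq> 0" using m by (auto simp: unit_steps_def)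
    have "axis i a $ i = axis j b $ i" using eq by simp
    then have "i = j" "a = b" using nz by (auto simp: axis_def split: if_splits)
    then show "i = j \<and> a = b" by simp
  qed
qed

lemma card_unit_steps: "card (unit_steps k) = 4" "finite (unit_steps k)"
  unfolding unit_steps_def using mesh_pos(1)[of k] by (auto simp: card_cartesian_product)

lemma sum_rate_Plane:
  assumes z: "z \<in> lattice k" "norm z > \<epsilon> + mesh k"
  shows "(\<Sum>y\<in>nbrs \<epsilon> k (Plane z). rate \<epsilon> k (Plane z) y * g y) =
    (\<Sum>i\<in>UNIV. g (Plane (z + axis i (mesh k))) + g (Plane (z + axis i (- mesh k)))) / (4 * (mesh k)\<^sup>2)"
proof -
  have deg: "deg \<epsilon> k (Plane z) = 4"
    unfolding deg_nbrs nbrs_Plane(1)[OF z] by (simp add: card_image nbrs_Plane(2)[OF z] card_unit_steps)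
  have r: "rate \<epsilon> k (Plane z) y = 1 / (4 * (mesh k)\<^sup>2)" if "y \<in> nbrs \<epsilon> k (Plane z)" for y
    unfolding rate_def conduct_Plane[OF that] by (simp add: deg)
  have "(\<Sum>y\<in>nbrs \<epsilon> k (Plane z). rate \<epsilon> k (Plane z) y * g y) = (\<Sum>y\<in>nbrs \<epsilon> k (Plane z). g y / (4 * (mesh k)\<^sup>2))"
    by (rule sum.cong) (auto simp: r)
  also have "\<dots> = (\<Sum>y\<in>nbrs \<epsilon> k (Plane z). g y) / (4 * (mesh k)\<^sup>2)" by (simp add: sum_divide_distrib)
  also have "(\<Sum>y\<in>nbrs \<epsilon> k (Plane z). g y) = (\<Sum>(i, a)\<in>unit_steps k. g (Plane (z + axis i a)))"
    unfolding nbrs_Plane(1)[OF z] by (subst sum.reindex[OF nbrs_Plane(2)[OF z]]) (auto simp: case_prod_unfold o_def)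
  also have "\<dots> = (\<Sum>i\<in>UNIV. \<Sum>a\<in>{mesh k, - mesh k}. g (Plane (z + axis i a)))"
    unfolding unit_steps_def by (rule sum.cartesian_product[symmetric])
  also have "\<dots> = (\<Sum>i\<in>UNIV. g (Plane (z + axis i (mesh k))) + g (Plane (z + axis i (- mesh k))))"
    using mesh_pos(1)[of k] by (intro sum.cong refl) (auto simp: eq_neg_iff_add_eq_0)
  finally show ?thesis .
qed

text \<open>At \<open>n = 1\<close> the lower neighbour would be \<open>Star\<close>.\<close>

lemma nbrs_Line:
  assumes n: "n \<ge> 2" and r: "r = real n * mesh k"
  shows "nbrs \<epsilon> k (Line r) = {Line (r + mesh k), Line (r - mesh k)}"
proof (intro equalityI subsetI)
  fix y assume "y \<in> nbrs \<epsilon> k (Line r)"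
  then have adj: "adjacent \<epsilon> k (Line r) y" by (simp add: nbrs_def)
  have "y \<noteq> Star"
  proof
    assume "y = Star"
    then have "r = mesh k" using adjacent_Star[of \<epsilon> k "Line r"] adj by (auto simp: adjacent_sym)
    then show False using n r by simp
  qed
  then show "y \<in> {Line (r + mesh k), Line (r - mesh k)}" using adjacent_Line[OF adj] by blast
next
  fix y assume y: "y \<in> {Line (r + mesh k), Line (r - mesh k)}"
  have e1: "edge \<epsilon> k (Line r) (Line (r + mesh k))"
    using edge.line_line[of n \<epsilon> k] n unfolding r by (simp add: algebra_simps)
  have "real (n - 1) = real n - 1" using n by (simp add: of_nat_diff)
  then have e2: "edge \<epsilon> k (Line (r - mesh k)) (Line r)"
    using edge.line_line[of "n - 1" \<epsilon> k] n unfolding r by (simp add: algebra_simps)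
  show "y \<in> nbrs \<epsilon> k (Line r)" using y e1 e2 by (auto simp: nbrs_def adjacent_def)
qed

lemma sum_rate_Line:
  assumes n: "n \<ge> 2" and r: "r = real n * mesh k"
  shows "(\<Sum>y\<in>nbrs \<epsilon> k (Line r). rate \<epsilon> k (Line r) y * g y) =
    (g (Line (r + mesh k)) + g (Line (r - mesh k))) / (2 * (mesh k)\<^sup>2)"
proof -
  have ne: "Line (r + mesh k) \<noteq> Line (r - mesh k)" by (simp add: algebra_simps)
  have deg: "deg \<epsilon> k (Line r) = 2"
    unfolding deg_nbrs nbrs_Line[OF n r] using ne by simp
  have "2 ^ k = 1 / mesh k" by (simp add: mesh_def)
  then have rt: "rate \<epsilon> k (Line r) y = 1 / (2 * (mesh k)\<^sup>2)" if "y \<in> nbrs \<epsilon> k (Line r)" for y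
    unfolding rate_def conduct_Line[OF that] by (simp add: deg power2_eq_square)
  have "(\<Sum>y\<in>nbrs \<epsilon> k (Line r). rate \<epsilon> k (Line r) y * g y) = (\<Sum>y\<in>nbrs \<epsilon> k (Line r). g y / (2 * (mesh k)\<^sup>2))"
    by (rule sum.cong) (auto simp: rt)
  also have "\<dots> = (\<Sum>y\<in>nbrs \<epsilon> k (Line r). g y) / (2 * (mesh k)\<^sup>2)" by (simp add: sum_divide_distrib)
  also have "(\<Sum>y\<in>nbrs \<epsilon> k (Line r). g y) = g (Line (r + mesh k)) + g (Line (r - mesh k))"
    unfolding nbrs_Line[OF n r] using ne by simp
  finally show ?thesis .
qed

text \<open>With \<open>h = mesh k\<close> and \<open>w = z - p\<close>, a step \<open>a\<close>
  along axis \<open>i\<close> changes \<open>Q\<close> by \<open>2 * a * w $ i + h\<^sup>2\<close>.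
  In the mean the linear parts cancel and leave drift 1; the second moment is
  \<open>2 * (norm w)\<^sup>2 + h\<^sup>2\<close>. \<open>Q\<close> has to be a squared distance
  only within one step of \<open>z\<close>, which leaves freedom elsewhere.\<close>

lemma good_at_Plane:
  assumes z: "z \<in> lattice k" "norm z > \<epsilon> + mesh k" and h: "mesh k \<le> 1"
    and Q: "\<And>v. norm (z - v) \<le> mesh k \<Longrightarrow> Q (Plane v) = (norm (v - p))\<^sup>2"
    and R: "norm (z - p) \<le> R" "2 * mesh k * R + (mesh k)\<^sup>2 \<le> b"
  shows "good_at \<epsilon> k Q c b (Plane z)"
proof -
  let ?h = "mesh k"
  define w where "w = z - p"
  have Qz: "Q (Plane z) = (norm w)\<^sup>2" using Q[of z] by (simp add: w_def)
  have d: "Q (Plane (z + axis i a)) - Q (Plane z) = 2 * a * w $ i + ?h\<^sup>2" if "a = ?h \<or> a = - ?h" for i a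
  proof -
    have "Q (Plane (z + axis i a)) = (norm (w + axis i a))\<^sup>2"
      using that by (subst Q) (auto simp: norm_axis_real w_def algebra_simps)
    then show ?thesis unfolding Qz norm2_axis using that by auto
  qed
  have w2: "(w $ 1)\<^sup>2 + (w $ 2)\<^sup>2 = (norm w)\<^sup>2" by (simp add: norm_vec_def L2_set_def sum_2)
  have "(\<Sum>y\<in>nbrs \<epsilon> k (Plane z). rate \<epsilon> k (Plane z) y * (Q y - Q (Plane z))) = 1"
    unfolding sum_rate_Plane[OF z] d[OF disjI1[OF refl]] d[OF disjI2[OF refl]] sum_2 by simp
  moreover have "(\<Sum>y\<in>nbrs \<epsilon> k (Plane z). rate \<epsilon> k (Plane z) y * (Q y - Q (Plane z))\<^sup>2) \<le> 1 + 4 * Q (Plane z)"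
  proof -
    have "(\<Sum>y\<in>nbrs \<epsilon> k (Plane z). rate \<epsilon> k (Plane z) y * (Q y - Q (Plane z))\<^sup>2) =
        (\<Sum>i\<in>UNIV. (2 * ?h * w $ i + ?h\<^sup>2)\<^sup>2 + (2 * (- ?h) * w $ i + ?h\<^sup>2)\<^sup>2) / (4 * ?h\<^sup>2)"
      unfolding sum_rate_Plane[OF z] d[OF disjI1[OF refl]] d[OF disjI2[OF refl]] ..
    also have "\<dots> = (8 * ?h\<^sup>2 * ((w $ 1)\<^sup>2 + (w $ 2)\<^sup>2) + 4 * ?h\<^sup>2 * ?h\<^sup>2) / (4 * ?h\<^sup>2)"
      unfolding sum_2 by (simp add: power2_eq_square algebra_simps)
    also have "\<dots> = 2 * (norm w)\<^sup>2 + ?h\<^sup>2" unfolding w2 by (simp add: field_simps)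
    also have "\<dots> \<le> 1 + 4 * Q (Plane z)"
      unfolding Qz using power_le_one[OF mesh_pos(2) h, of 2] zero_le_power2[of "norm w"] by linarith
    finally show ?thesis .
  qed
  moreover have "\<bar>Q y - Q (Plane z)\<bar> \<le> b" if y: "y \<in> nbrs \<epsilon> k (Plane z)" for y
  proof -
    obtain i a where ia: "y = Plane (z + axis i a)" "a = ?h \<or> a = - ?h"
      using y unfolding nbrs_Plane(1)[OF z] by (auto simp: unit_steps_def)
    have "\<bar>w $ i\<bar> \<le> R" using component_le_norm_cart[of w i] R(1) by (simp add: w_def)
    then have "\<bar>2 * a * w $ i\<bar> \<le> 2 * ?h * R" using ia(2) by (auto simp: abs_mult)
    moreover have "\<bar>2 * a * w $ i + ?h\<^sup>2\<bar> \<le> \<bar>2 * a * w $ i\<bar> + ?h\<^sup>2" using abs_triangle_ineq[of "2 * a * w $ i" "?h\<^sup>2"] by simp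
    ultimately show ?thesis using d[OF ia(2), of i] ia(1) R(2) by simp
  qed
  ultimately show ?thesis unfolding good_at_def by auto
qed

text \<open>The same computation in one dimension: drift 1 and second moment
  \<open>4 * w\<^sup>2 + h\<^sup>2\<close>. This is the larger of the two cases and the origin of
  the bound \<open>1 + 4 * Q y\<close> in \<open>good_at\<close>.\<close>

lemma good_at_Line:
  assumes n: "n \<ge> 2" and r: "r = real n * mesh k" and h: "mesh k \<le> 1"
    and Q: "\<And>s. \<bar>r - s\<bar> \<le> mesh k \<Longrightarrow> Q (Line s) = (s - p)\<^sup>2"
    and R: "\<bar>r - p\<bar> \<le> R" "2 * mesh k * R + (mesh k)\<^sup>2 \<le> b"
  shows "good_at \<epsilon> k Q c b (Line r)"
proof -
  let ?h = "mesh k"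
  define w where "w = r - p"
  have Qr: "Q (Line r) = w\<^sup>2" using Q[of r] by (simp add: w_def)
  have d: "Q (Line (r + ?h)) - Q (Line r) = 2 * ?h * w + ?h\<^sup>2" "Q (Line (r - ?h)) - Q (Line r) = - 2 * ?h * w + ?h\<^sup>2"
    unfolding Qr using Q[of "r + ?h"] Q[of "r - ?h"] by (auto simp: w_def power2_eq_square algebra_simps)
  have "(\<Sum>y\<in>nbrs \<epsilon> k (Line r). rate \<epsilon> k (Line r) y * (Q y - Q (Line r))) = 1"
    unfolding sum_rate_Line[OF n r] d by simp
  moreover have "(\<Sum>y\<in>nbrs \<epsilon> k (Line r). rate \<epsilon> k (Line r) y * (Q y - Q (Line r))\<^sup>2) \<le> 1 + 4 * Q (Line r)"
  proof -
    have "(\<Sum>y\<in>nbrs \<epsilon> k (Line r). rate \<epsilon> k (Line r) y * (Q y - Q (Line r))\<^sup>2) =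
        (8 * ?h\<^sup>2 * w\<^sup>2 + 2 * ?h\<^sup>2 * ?h\<^sup>2) / (2 * ?h\<^sup>2)"
      unfolding sum_rate_Line[OF n r] d by (simp add: power2_eq_square algebra_simps)
    also have "\<dots> = 4 * w\<^sup>2 + ?h\<^sup>2" by (simp add: field_simps)
    also have "\<dots> \<le> 1 + 4 * Q (Line r)" unfolding Qr using h by (simp add: power_le_one)
    finally show ?thesis .
  qed
  moreover have "\<bar>Q y - Q (Line r)\<bar> \<le> b" if y: "y \<in> nbrs \<epsilon> k (Line r)" for y
  proof -
    have "\<bar>2 * ?h * w\<bar> \<le> 2 * ?h * R" using R(1) by (simp add: abs_mult w_def)
    then have t: "2 * ?h * w \<le> 2 * ?h * R" "- 2 * ?h * w \<le> 2 * ?h * R" by (auto simp: abs_le_iff)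
    have h2: "0 \<le> ?h\<^sup>2" by simp
    consider "y = Line (r + ?h)" | "y = Line (r - ?h)" using y unfolding nbrs_Line[OF n r] by blast
    then show ?thesis
    proof cases
      case 1
      show ?thesis unfolding 1 d abs_le_iff using t h2 R(2) by linarith
    next
      case 2
      show ?thesis unfolding 2 d abs_le_iff using t h2 R(2) by linarith
    qed
  qed
  ultimately show ?thesis unfolding good_at_def by auto
qed

section \<open>Escape estimates near \<open>Star\<close> and far from it\<close>

lemma rho_le_rad: "rho \<epsilon> x y \<le> rad \<epsilon> x + rad \<epsilon> y"
  by (cases x; cases y) auto

lemma rad_nonneg: "0 \<le> rad \<epsilon> x"
  by (cases x) auto

lemma rad_nbrs:
  assumes x: "x \<in> vertices \<epsilon> k" "rad \<epsilon> x \<le> mesh k" and y: "y \<in> nbrs \<epsilon> k x"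
  shows "rad \<epsilon> y \<le> 2 * mesh k"
proof -
  have adj: "adjacent \<epsilon> k x y" using y by (simp add: nbrs_def)
  then have yV: "y \<in> vertices \<epsilon> k" using adjacent_vertices by blast
  show ?thesis
  proof (cases x)
    case Star
    then show ?thesis using adjacent_Star[of \<epsilon> k y] adj by auto
  next
    case (Plane u)
    then have "y = Star \<or> (\<exists>v. y = Plane v \<and> norm (u - v) = mesh k)" using adjacent_Plane[of \<epsilon> k u y] adj by blast
    then show ?thesis
    proof (elim disjE exE conjE)
      fix v assume v: "y = Plane v" "norm (u - v) = mesh k"
      have "norm v \<le> norm u + mesh k" using norm_triangle_ineq[of u "v - u"] v(2) by (simp add: norm_minus_commute)
      then show ?thesis using x yV v(1) Plane by auto
    qed auto
  next
    case (Line r)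
    then obtain n where "n \<ge> 1" "r = real n * mesh k" using x by (auto simp: Line_vertex)
    then have "0 < r" by simp
    then show ?thesis using adjacent_Line[of \<epsilon> k r y] adj Line x(2) by auto
  qed
qed

text \<open>Beyond one mesh from \<open>Star\<close> there remain only the vertices to which
  \<open>nbrs_Plane\<close> or \<open>nbrs_Line\<close> applies.\<close>

lemma vertex_far_cases:
  assumes x: "x \<in> vertices \<epsilon> k" "rad \<epsilon> x > mesh k"
  obtains z where "x = Plane z" "z \<in> lattice k" "norm z > \<epsilon> + mesh k"
    | n where "x = Line (real n * mesh k)" "n \<ge> 2"
proof (cases x)
  case Star
  then show ?thesis using x mesh_pos(1)[of k] by simp
next
  case (Plane z)
  then show ?thesis using x that(1) by auto
next
  case (Line r)
  then obtain n where n: "n \<ge> 1" "r = real n * mesh k" using x by (auto simp: Line_vertex)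
  then have "n \<noteq> 1" using x(2) Line by auto
  then show ?thesis using that(2) n Line by auto
qed

lemma mesh_eventually_le:
  assumes "e > 0" shows "\<exists>k0. \<forall>k\<ge>k0. mesh k \<le> e"
proof -
  obtain k0 where k0: "(1/2::real) ^ k0 < e" using real_arch_pow_inv[OF assms, of "1/2"] by auto
  have "mesh k \<le> e" if "k \<ge> k0" for k
  proof -
    have "mesh k = (1/2) ^ k" by (simp add: mesh_def power_one_over)
    also have "\<dots> \<le> (1/2) ^ k0" using that by (intro power_decreasing) auto
    finally show ?thesis using k0 by simp
  qed
  then show ?thesis by blast
qed

text \<open>Started within \<open>\<eta>\<close> of \<open>Star\<close>, the test functions vanish near \<open>Star\<close>, so the shape of the graph there
  is irrelevant.\<close>

lemma escape_near:
  assumes e: "0 < \<epsilon>" and \<eta>: "0 < \<eta>" and b: "b = (2 * \<epsilon> * \<eta> + 3 * \<eta>\<^sup>2) / 3"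
    and h: "mesh k \<le> 1" "2 * mesh k \<le> \<eta>" "2 * mesh k * (\<epsilon> + 2 * \<eta>) + (mesh k)\<^sup>2 \<le> b"
    and K: "walk_semigroup \<epsilon> k K" and x: "x \<in> vertices \<epsilon> k" "rad \<epsilon> x \<le> \<eta>" and t: "t \<ge> 0"
  shows "measure (measure_pmf (K t x)) {y. rho \<epsilon> x y \<ge> 3 * \<eta>} \<le> ((1 + 4 * (\<epsilon> + \<eta>)\<^sup>2 + 18 * b) / b\<^sup>2)\<^sup>2 / 2 * t\<^sup>2"
proof -
  \<comment> \<open>In the plane outside the disk this is the squared distance from the centre, on
    the half line that from the point \<open>- \<epsilon>\<close>; the two agree at
    \<open>Star\<close>. The choice of \<open>b\<close> puts the levels \<open>c\<close> and
    \<open>c + 3 * b\<close> at the radii \<open>\<eta>\<close> and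
    \<open>2 * \<eta>\<close>.\<close>
  define Q where "Q y = (\<epsilon> + rad \<epsilon> y)\<^sup>2" for y
  define c where "c = (\<epsilon> + \<eta>)\<^sup>2"
  have b0: "b > 0" using e \<eta> by (simp add: b add_pos_pos)
  have cb: "c + 3 * b = (\<epsilon> + 2 * \<eta>)\<^sup>2" by (simp add: c_def b power2_eq_square algebra_simps)
  have Qle: "Q y \<le> c" if "rad \<epsilon> y \<le> \<eta>" for y
    unfolding Q_def c_def using that e rad_nonneg[of \<epsilon> y] by (intro power_mono) auto
  have good: "good_at \<epsilon> k Q c b y" if y: "y \<in> vertices \<epsilon> k" for y
  proof (cases "rad \<epsilon> y \<le> mesh k")
    case True
    have "rad \<epsilon> y \<le> \<eta>" using True h(2) mesh_pos(1)[of k] by linarith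
    moreover have "rad \<epsilon> z \<le> \<eta>" if "z \<in> nbrs \<epsilon> k y" for z using rad_nbrs[OF y True that] h(2) by simp
    ultimately show ?thesis unfolding good_at_def using Qle by blast
  next
    case False
    show ?thesis
    proof (cases "Q y \<ge> c + 3 * b")
      case True
      then show ?thesis by (simp add: good_at_def)
    next
      case Q3: False
      then have "(\<epsilon> + rad \<epsilon> y)\<^sup>2 \<le> (\<epsilon> + 2 * \<eta>)\<^sup>2" using cb by (simp add: Q_def)
      then have small: "\<epsilon> + rad \<epsilon> y \<le> \<epsilon> + 2 * \<eta>" by (rule power2_le_imp_le) (use e \<eta> in simp)
      from False have "rad \<epsilon> y > mesh k" by simp
      from y this show ?thesis
      proof (cases rule: vertex_far_cases)
        case (1 z)
        have q: "Q (Plane v) = (norm (v - 0))\<^sup>2" if "norm (z - v) \<le> mesh k" for v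
        proof -
          have "norm v > \<epsilon>" using norm_triangle_ineq2[of z "z - v"] 1(3) that by simp
          then show ?thesis by (simp add: Q_def)
        qed
        have "norm (z - 0) \<le> \<epsilon> + 2 * \<eta>" using small 1 by simp
        then show ?thesis unfolding 1(1) by (intro good_at_Plane[where p = 0, OF 1(2,3) h(1) _ _ h(3)] q)
      next
        case (2 n)
        have q: "Q (Line s) = (s - (- \<epsilon>))\<^sup>2" if "\<bar>real n * mesh k - s\<bar> \<le> mesh k" for s
        proof -
          have "2 * mesh k \<le> real n * mesh k" using 2(2) by (intro mult_right_mono) auto
          then have "s \<ge> 0" using that mesh_pos(1)[of k] by linarith
          then show ?thesis by (simp add: Q_def add.commute)
        qed
        have "\<bar>real n * mesh k - (- \<epsilon>)\<bar> \<le> \<epsilon> + 2 * \<eta>" using small 2 e by simp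
        then show ?thesis unfolding 2(1) by (intro good_at_Line[where p = "- \<epsilon>", OF 2(2) refl h(1) _ _ h(3)] q)
      qed
    qed
  qed
  have "{y. rho \<epsilon> x y \<ge> 3 * \<eta>} \<subseteq> {y. Q y \<ge> c + 3 * b}"
  proof (intro subsetI CollectI)
    fix y assume "y \<in> {y. rho \<epsilon> x y \<ge> 3 * \<eta>}"
    then have "rad \<epsilon> y \<ge> 2 * \<eta>" using rho_le_rad[of \<epsilon> x y] x(2) by simp
    then show "Q y \<ge> c + 3 * b" unfolding cb Q_def using e \<eta> by (intro power_mono) auto
  qed
  then have "measure (measure_pmf (K t x)) {y. rho \<epsilon> x y \<ge> 3 * \<eta>} \<le> measure (measure_pmf (K t x)) {y. Q y \<ge> c + 3 * b}"
    by (intro measure_pmf.finite_measure_mono) auto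
  also have "\<dots> \<le> ((1 + 4 * c + 18 * b) / b\<^sup>2)\<^sup>2 / 2 * t\<^sup>2"
    by (rule escape_quadratic[OF K good b0 _ x(1) Qle[OF x(2)] t]) (auto simp: c_def)
  finally show ?thesis unfolding c_def .
qed

text \<open>Here \<open>Q\<close> is centred at the starting point, which is so far from
  \<open>Star\<close> that within \<open>\<eta> / 2\<close> of it, on its own branch, all vertices
  have the full set of neighbours. Everything on the other branches gets the value
  \<open>3 * b = (\<eta> / 2)\<^sup>2\<close>, that is, it counts as escaped.\<close>

lemma escape_far:
  assumes e: "0 < \<epsilon>" and \<eta>: "0 < \<eta>" and b: "b = \<eta>\<^sup>2 / 12"
    and h: "mesh k \<le> 1" "2 * mesh k < \<eta>" "mesh k * \<eta> + (mesh k)\<^sup>2 \<le> b"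
    and K: "walk_semigroup \<epsilon> k K" and x: "x \<in> vertices \<epsilon> k" "rad \<epsilon> x > \<eta>" and t: "t \<ge> 0"
  shows "measure (measure_pmf (K t x)) {y. rho \<epsilon> x y \<ge> 3 * \<eta>} \<le> ((1 + 18 * b) / b\<^sup>2)\<^sup>2 / 2 * t\<^sup>2"
proof -
  have b0: "b > 0" "3 * b = (\<eta> / 2)\<^sup>2" using \<eta> by (auto simp: b power2_eq_square)
  have R: "2 * mesh k * (\<eta> / 2) + (mesh k)\<^sup>2 \<le> b" using h(3) by simp
  have xm: "rad \<epsilon> x > mesh k" using x(2) h(2) mesh_pos(1)[of k] by linarith
  have "\<exists>Q. Q x \<le> 0 \<and> (\<forall>y\<in>vertices \<epsilon> k. good_at \<epsilon> k Q 0 b y) \<and> (\<forall>y. rho \<epsilon> x y \<ge> 3 * \<eta> \<longrightarrow> Q y \<ge> 3 * b)"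
    using x(1) xm
  proof (cases rule: vertex_far_cases)
    case (1 x0)
    define Q where "Q y = (case y of Plane v \<Rightarrow> (norm (v - x0))\<^sup>2 | _ \<Rightarrow> 3 * b)" for y
    have "good_at \<epsilon> k Q 0 b y" if y: "y \<in> vertices \<epsilon> k" for y
    proof (cases "Q y \<ge> 3 * b")
      case False
      then obtain z where z: "y = Plane z" by (cases y) (auto simp: Q_def)
      then have "(norm (z - x0))\<^sup>2 < (\<eta> / 2)\<^sup>2" using False b0 by (simp add: Q_def)
      then have n: "norm (z - x0) < \<eta> / 2" by (rule power_less_imp_less_base) (use \<eta> in simp)
      have "norm x0 > \<epsilon> + \<eta>" using x 1 by auto
      then have "norm z > \<epsilon> + mesh k" using n norm_triangle_ineq2[of x0 "x0 - z"] h(2) by (simp add: norm_minus_commute)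
      then show ?thesis unfolding z using y z n h(1) R by (intro good_at_Plane[where p = x0 and R = "\<eta> / 2"]) (auto simp: Q_def)
    qed (simp add: good_at_def)
    moreover have "Q y \<ge> 3 * b" if "rho \<epsilon> x y \<ge> 3 * \<eta>" for y
    proof (cases y)
      case (Plane v)
      then have "norm (v - x0) \<ge> 3 * \<eta>" using that 1 by (simp add: norm_minus_commute)
      then show ?thesis unfolding b0 Q_def Plane using \<eta> by (auto intro!: power_mono)
    qed (auto simp: Q_def)
    moreover have "Q x \<le> 0" by (simp add: Q_def 1)
    ultimately show ?thesis by blast
  next
    case (2 n0)
    define r0 where "r0 = real n0 * mesh k"
    define Q where "Q y = (case y of Line s \<Rightarrow> (s - r0)\<^sup>2 | _ \<Rightarrow> 3 * b)" for y
    have "good_at \<epsilon> k Q 0 b y" if y: "y \<in> vertices \<epsilon> k" for y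
    proof (cases "Q y \<ge> 3 * b")
      case False
      then obtain r where r: "y = Line r" by (cases y) (auto simp: Q_def)
      then have "\<bar>r - r0\<bar>\<^sup>2 < (\<eta> / 2)\<^sup>2" using False b0 by (simp add: Q_def)
      then have n: "\<bar>r - r0\<bar> < \<eta> / 2" by (rule power_less_imp_less_base) (use \<eta> in simp)
      obtain m where m: "m \<ge> 1" "r = real m * mesh k" using y r by (auto simp: Line_vertex)
      have "r0 > \<eta>" using x 2 by (simp add: r0_def)
      then have "r > mesh k" using n h(2) by linarith
      then have "m \<ge> 2" using m by (cases "m = 1") auto
      then show ?thesis unfolding r using m n h(1) R by (intro good_at_Line[where p = r0 and R = "\<eta> / 2"]) (auto simp: Q_def)
    qed (simp add: good_at_def)
    moreover have "Q y \<ge> 3 * b" if "rho \<epsilon> x y \<ge> 3 * \<eta>" for y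
    proof (cases y)
      case (Line s)
      then have "\<bar>s - r0\<bar> \<ge> 3 * \<eta>" using that 2 by (simp add: r0_def abs_minus_commute)
      then have "(\<eta> / 2)\<^sup>2 \<le> \<bar>s - r0\<bar>\<^sup>2" using \<eta> by (intro power_mono) auto
      then show ?thesis unfolding b0 Q_def Line by simp
    qed (auto simp: Q_def)
    moreover have "Q x \<le> 0" by (simp add: Q_def 2 r0_def)
    ultimately show ?thesis by blast
  qed
  then obtain Q where Qx: "Q x \<le> 0" and good: "\<And>y. y \<in> vertices \<epsilon> k \<Longrightarrow> good_at \<epsilon> k Q 0 b y"
    and Q\<rho>: "\<And>y. rho \<epsilon> x y \<ge> 3 * \<eta> \<Longrightarrow> Q y \<ge> 3 * b" by blast
  have "measure (measure_pmf (K t x)) {y. rho \<epsilon> x y \<ge> 3 * \<eta>} \<le> measure (measure_pmf (K t x)) {y. Q y \<ge> 0 + 3 * b}"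
    using Q\<rho> by (intro measure_pmf.finite_measure_mono) auto
  also have "\<dots> \<le> ((1 + 4 * 0 + 18 * b) / b\<^sup>2)\<^sup>2 / 2 * t\<^sup>2"
    by (rule escape_quadratic[OF K good b0(1) order.refl x(1) Qx t])
  finally show ?thesis by simp
qed

lemma uniform_escape:
  assumes e: "0 < \<epsilon>" and \<eta>: "0 < \<eta>"
  shows "\<exists>C\<ge>0. \<exists>k0. \<forall>k\<ge>k0. \<forall>K. walk_semigroup \<epsilon> k K \<longrightarrow>
    (\<forall>x\<in>vertices \<epsilon> k. \<forall>t\<ge>0. measure (measure_pmf (K t x)) {y. rho \<epsilon> x y \<ge> \<eta>} \<le> C * t\<^sup>2)"
proof -
  \<comment> \<open>The two escape lemmas concern displacements of three times their radius.\<close>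
  define \<zeta> where "\<zeta> = \<eta> / 3"
  have \<zeta>: "\<zeta> > 0" "3 * \<zeta> = \<eta>" using \<eta> by (auto simp: \<zeta>_def)
  define b1 where "b1 = (2 * \<epsilon> * \<zeta> + 3 * \<zeta>\<^sup>2) / 3"
  define b2 where "b2 = \<zeta>\<^sup>2 / 12"
  have b: "b1 > 0" "b2 > 0" using e \<zeta> by (auto simp: b1_def b2_def add_pos_pos)
  define C1 where "C1 = ((1 + 4 * (\<epsilon> + \<zeta>)\<^sup>2 + 18 * b1) / b1\<^sup>2)\<^sup>2 / 2"
  define C2 where "C2 = ((1 + 18 * b2) / b2\<^sup>2)\<^sup>2 / 2"
  \<comment> \<open>Collects the conditions on the mesh from both escape lemmas; as
    \<open>(mesh k)\<^sup>2 \<le> mesh k\<close>, the quadratic conditions follow from linear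
    ones.\<close>
  define h0 where "h0 = min (min 1 (\<zeta> / 3)) (min (b1 / (2 * (\<epsilon> + 2 * \<zeta>) + 1)) (b2 / (\<zeta> + 1)))"
  have h0: "h0 > 0" using e \<zeta> b by (auto simp: h0_def intro!: divide_pos_pos)
  obtain k0 where k0: "\<And>k. k \<ge> k0 \<Longrightarrow> mesh k \<le> h0" using mesh_eventually_le[OF h0] by blast
  have "measure (measure_pmf (K t x)) {y. rho \<epsilon> x y \<ge> \<eta>} \<le> (C1 + C2) * t\<^sup>2"
    if k: "k \<ge> k0" and K: "walk_semigroup \<epsilon> k K" and x: "x \<in> vertices \<epsilon> k" and t: "t \<ge> 0" for k K x t
  proof -
    have h: "mesh k \<le> 1" "mesh k \<le> \<zeta> / 3" "mesh k \<le> b1 / (2 * (\<epsilon> + 2 * \<zeta>) + 1)" "mesh k \<le> b2 / (\<zeta> + 1)"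
      using k0[OF k] by (auto simp: h0_def)
    have sq: "(mesh k)\<^sup>2 \<le> mesh k" using h(1) by (simp add: power2_eq_square mult_left_le)
    have "mesh k * (2 * (\<epsilon> + 2 * \<zeta>) + 1) \<le> b1" using h(3) e \<zeta> by (simp add: pos_le_divide_eq)
    then have 1: "2 * mesh k * (\<epsilon> + 2 * \<zeta>) + (mesh k)\<^sup>2 \<le> b1" using sq by (simp add: algebra_simps)
    have "mesh k * (\<zeta> + 1) \<le> b2" using h(4) \<zeta> by (simp add: pos_le_divide_eq)
    then have 2: "mesh k * \<zeta> + (mesh k)\<^sup>2 \<le> b2" using sq by (simp add: algebra_simps)
    have C: "C1 \<ge> 0" "C2 \<ge> 0" by (auto simp: C1_def C2_def)
    have 3: "2 * mesh k < \<zeta>" using h(2) \<zeta> by linarith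
    have "measure (measure_pmf (K t x)) {y. rho \<epsilon> x y \<ge> 3 * \<zeta>} \<le> C1 * t\<^sup>2 \<or>
          measure (measure_pmf (K t x)) {y. rho \<epsilon> x y \<ge> 3 * \<zeta>} \<le> C2 * t\<^sup>2"
    proof (cases "rad \<epsilon> x \<le> \<zeta>")
      case True
      then show ?thesis
        using escape_near[OF e \<zeta>(1) b1_def h(1) _ 1 K x _ t] 3 unfolding C1_def by auto
    next
      case False
      then show ?thesis
        using escape_far[OF e \<zeta>(1) b2_def h(1) 3 2 K x _ t] unfolding C2_def by auto
    qed
    moreover have "C1 * t\<^sup>2 \<le> (C1 + C2) * t\<^sup>2" "C2 * t\<^sup>2 \<le> (C1 + C2) * t\<^sup>2" using C by (auto intro!: mult_right_mono)
    ultimately show ?thesis unfolding \<zeta>(2) by linarith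
  qed
  moreover have "C1 + C2 \<ge> 0" by (auto simp: C1_def C2_def)
  ultimately show ?thesis by blast
qed

section \<open>Oscillation of the walks\<close>

lemma (in Metric_space) continuous_map_nonexpansive:
  fixes h :: "'b::metric_space \<Rightarrow> 'a"
  assumes "\<And>x. h x \<in> M" "\<And>x y. d (h x) (h y) \<le> dist x y"
  shows "continuous_map euclidean mtopology h"
  unfolding continuous_map_to_metric
proof (intro ballI allI impI)
  fix x and r :: real assume "0 < r"
  moreover have "h y \<in> mball (h x) r" if "y \<in> ball x r" for y
    using that assms(1) assms(2)[of x y] by (auto intro: le_less_trans)
  ultimately show "\<exists>U. openin euclidean U \<and> x \<in> U \<and> (\<forall>y\<in>U. h y \<in> mball (h x) r)"
    by (intro exI[of _ "ball x r"]) auto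
qed

text \<open>The plane and the line cover the state space by maps that do not increase distances:
  \<open>f\<close> collapses the disk and \<open>g\<close> the negative half line to
  \<open>Star\<close>. A closed ball is thus a closed subset of the images of two compact
  sets.\<close>

lemma E_space_proper:
  "compactin (Metric_space.mtopology (E_space \<epsilon>) (rho \<epsilon>)) (Metric_space.mcball (E_space \<epsilon>) (rho \<epsilon>) a B)"
proof -
  interpret E: Metric_space "E_space \<epsilon>" "rho \<epsilon>" by (rule Metric_space_E)
  define f where "f z = (if norm z \<le> \<epsilon> then Star else Plane z)" for z :: "real ^ 2"
  define g where "g r = (if r \<le> 0 then Star else Line r)" for r :: real
  have fc: "continuous_map euclidean E.mtopology f"
  proof (rule E.continuous_map_nonexpansive)
    show "f z \<in> E_space \<epsilon>" for z by (auto simp: f_def E_space_def)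
    show "rho \<epsilon> (f z) (f w) \<le> dist z w" for z w
      using norm_triangle_ineq2[of z w] norm_triangle_ineq2[of w z]
      by (auto simp: f_def dist_norm norm_minus_commute)
  qed
  have gc: "continuous_map euclidean E.mtopology g"
  proof (rule E.continuous_map_nonexpansive)
    show "g r \<in> E_space \<epsilon>" for r by (auto simp: g_def E_space_def)
    show "rho \<epsilon> (g r) (g s) \<le> dist r s" for r s by (auto simp: g_def dist_real_def)
  qed
  define R where "R = rad \<epsilon> a + B"
  have "compactin E.mtopology (f ` cball 0 (\<epsilon> + R))" by (rule image_compactin[OF _ fc]) simp
  moreover have "compactin E.mtopology (g ` {0..R})" by (rule image_compactin[OF _ gc]) simp
  ultimately have K: "compactin E.mtopology (f ` cball 0 (\<epsilon> + R) \<union> g ` {0..R})" by (rule compactin_Un)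
  have "E.mcball a B \<subseteq> f ` cball 0 (\<epsilon> + R) \<union> g ` {0..R}"
  proof
    fix y assume y: "y \<in> E.mcball a B"
    then have yE: "y \<in> E_space \<epsilon>" "a \<in> E_space \<epsilon>" "rho \<epsilon> a y \<le> B" by auto
    have S: "Star \<in> E_space \<epsilon>" by (simp add: E_space_def)
    have Sr: "rho \<epsilon> Star x = rad \<epsilon> x" for x by (cases x) auto
    have "rad \<epsilon> y \<le> R" using E.triangle[OF S yE(2,1)] yE(3) by (simp add: Sr R_def)
    moreover have "R \<ge> 0" using rad_nonneg[of \<epsilon> y] calculation by linarith
    ultimately show "y \<in> f ` cball 0 (\<epsilon> + R) \<union> g ` {0..R}"
    proof (cases y)
      case Star
      then have "y = g 0" by (simp add: g_def)
      then show ?thesis using \<open>R \<ge> 0\<close> by auto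
    next
      case (Plane z)
      then have "y = f z" "norm z \<le> \<epsilon> + R" using yE(1) \<open>rad \<epsilon> y \<le> R\<close> by (auto simp: f_def E_space_def)
      then show ?thesis by auto
    next
      case (Line r)
      then have "y = g r" "r \<in> {0..R}" using yE(1) \<open>rad \<epsilon> y \<le> R\<close> by (auto simp: g_def E_space_def)
      then show ?thesis by blast
    qed
  qed
  then show ?thesis by (rule closed_compactin[OF K]) simp
qed

text \<open>Plane vertices may lie very close to the disk, so \<open>mesh k\<close> alone is no
  lower bound for distances to \<open>Star\<close>; but only finitely many are within distance 1 of
  it. The bound depends on \<open>k\<close>, which is enough for single laws.\<close>

lemma vertices_separated:
  "\<exists>r>0. \<forall>x\<in>vertices \<epsilon> k. \<forall>y\<in>vertices \<epsilon> k. x \<noteq> y \<longrightarrow> r \<le> rho \<epsilon> x y"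
proof -
  define A where "A = {z \<in> lattice k. norm z \<le> \<epsilon> + 1} - cball 0 \<epsilon>"
  have A: "finite A" unfolding A_def using lattice_finite by blast
  define r where "r = Min (insert (mesh k) (insert 1 ((\<lambda>z. norm z - \<epsilon>) ` A)))"
  have r: "r > 0" using A by (auto simp: r_def A_def)
  have rle1: "r \<le> mesh k" and rle2: "r \<le> 1" and rle3: "\<And>z. z \<in> A \<Longrightarrow> r \<le> norm z - \<epsilon>"
    unfolding r_def by (rule Min_le; use A in simp)+
  have rad_ge: "r \<le> rad \<epsilon> x" if x: "x \<in> vertices \<epsilon> k" "x \<noteq> Star" for x
  proof (cases x)
    case (Plane z)
    then have z: "z \<in> lattice k" "norm z > \<epsilon>" using x by auto
    show ?thesis
    proof (cases "norm z \<le> \<epsilon> + 1")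
      case True
      then have "z \<in> A" using z by (simp add: A_def)
      then show ?thesis using rle3 Plane z by simp
    next
      case False
      then show ?thesis using rle2 Plane by simp
    qed
  next
    case (Line s)
    then obtain n where n: "n \<ge> 1" "s = real n * mesh k" using x by (auto simp: Line_vertex)
    then have "1 * mesh k \<le> s" unfolding n(2) by (intro mult_right_mono) auto
    then show ?thesis using rle1 Line by simp
  qed (use x in simp)
  have "r \<le> rho \<epsilon> x y" if x: "x \<in> vertices \<epsilon> k" and y: "y \<in> vertices \<epsilon> k" and xy: "x \<noteq> y" for x y
  proof -
    have sum: "r \<le> rad \<epsilon> x + rad \<epsilon> y"
      using rad_ge[OF x] rad_ge[OF y] xy rad_nonneg[of \<epsilon> x] rad_nonneg[of \<epsilon> y] by (cases "x = Star") auto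
    have int_ge: "mesh k \<le> \<bar>of_int m * mesh k - of_int n * mesh k\<bar>"
      if "of_int m * mesh k \<noteq> of_int n * mesh k" for m n :: int
    proof -
      have "m \<noteq> n" using that by auto
      then have "1 \<le> \<bar>of_int (m - n) :: real\<bar>" by linarith
      then have "1 * mesh k \<le> \<bar>of_int (m - n)\<bar> * mesh k" by (intro mult_right_mono) auto
      also have "\<dots> = \<bar>of_int (m - n) * mesh k\<bar>" by (simp only: abs_mult mesh_pos(4))
      finally show ?thesis by (simp add: algebra_simps)
    qed
    show ?thesis
    proof (cases "\<exists>z w. x = Plane z \<and> y = Plane w")
      case True
      then obtain z w where zw: "x = Plane z" "y = Plane w" by blast
      then obtain i where i: "z $ i \<noteq> w $ i" using xy by (auto simp: vec_eq_iff)
      obtain m :: int where m: "z $ i = of_int m * mesh k" using x unfolding zw Plane_vertex lattice_def by blast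
      obtain n :: int where n: "w $ i = of_int n * mesh k" using y unfolding zw Plane_vertex lattice_def by blast
      have "mesh k \<le> \<bar>(z - w) $ i\<bar>" using int_ge[of m n] i m n by simp
      also have "\<dots> \<le> norm (z - w)" by (rule component_le_norm_cart)
      finally show ?thesis using sum rle1 by (simp add: zw)
    next
      case F: False
      show ?thesis
      proof (cases "\<exists>p q. x = Line p \<and> y = Line q")
        case True
        then obtain p q where pq: "x = Line p" "y = Line q" by blast
        then obtain m n :: nat where mn: "p = real m * mesh k" "q = real n * mesh k" using x y by (auto simp: Line_vertex)
        then have "mesh k \<le> \<bar>p - q\<bar>" using int_ge[of "int m" "int n"] xy pq by simp
        then show ?thesis using rle1 by (simp add: pq)
      next
        case False
        then have "rho \<epsilon> x y = rad \<epsilon> x + rad \<epsilon> y" using F by (cases x; cases y) auto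
        then show ?thesis using sum by simp
      qed
    qed
  qed
  then show ?thesis using r by blast
qed

section \<open>The Markov property and the maximal inequality\<close>

lemma path_prob_snoc:
  "path_prob K s x (ps @ [(t, y)]) =
     path_prob K s x ps * pmf (K (t - (if ps = [] then s else fst (last ps))) (if ps = [] then x else snd (last ps))) y"
  by (induction ps arbitrary: s x) auto

context
  fixes \<epsilon> :: real and k :: nat and P :: "'w measure" and X :: "real \<Rightarrow> 'w \<Rightarrow> point" and K
  assumes P: "prob_space P" and X: "\<And>t. t \<ge> 0 \<Longrightarrow> X t \<in> measurable P (count_space (vertices \<epsilon> k))"
    and fdd: "\<And>ts xs. length ts = length xs \<Longrightarrow> sorted (0 # ts) \<Longrightarrow>
      measure P {\<omega> \<in> space P. \<forall>i<length ts. X (ts ! i) \<omega> = xs ! i} = path_prob K 0 Star (zip ts xs)"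
begin

interpretation prob_space P by (rule P)

lemma X_vertex: "t \<ge> 0 \<Longrightarrow> \<omega> \<in> space P \<Longrightarrow> X t \<omega> \<in> vertices \<epsilon> k"
  using measurable_space[OF X] by simp

lemma X_pair_event:
  assumes "s \<ge> 0" "t \<ge> 0" shows "{\<omega> \<in> space P. Q (X s \<omega>) (X t \<omega>)} \<in> events"
proof -
  have "{\<omega> \<in> space P. Q (X s \<omega>) (X t \<omega>)} =
      (\<Union>(x, y)\<in>{(x, y) \<in> vertices \<epsilon> k \<times> vertices \<epsilon> k. Q x y}. (X s -` {x} \<inter> space P) \<inter> (X t -` {y} \<inter> space P))"
    using X_vertex assms by auto
  also have "\<dots> \<in> events"
  proof (rule sets.countable_UN')
    show "countable {(x, y) \<in> vertices \<epsilon> k \<times> vertices \<epsilon> k. Q x y}"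
      by (rule countable_subset[of _ "vertices \<epsilon> k \<times> vertices \<epsilon> k"]) (auto intro: countable_SIGMA countable_vertices)
  qed (use measurable_sets[OF X[OF assms(1)]] measurable_sets[OF X[OF assms(2)]] in auto)
  finally show ?thesis .
qed

definition cyl :: "real list \<Rightarrow> point list \<Rightarrow> 'w set" where
  "cyl ts xs = {\<omega> \<in> space P. \<forall>i<length ts. X (ts ! i) \<omega> = xs ! i}"

lemma cyl_events:
  assumes "sorted (0 # ts)" shows "cyl ts xs \<in> events"
proof -
  have "{\<omega> \<in> space P. X (ts ! i) \<omega> = xs ! i} \<in> events" if "i < length ts" for i
  proof -
    have "0 \<le> ts ! i" using assms nth_mem[OF that] by simp
    then show ?thesis using X_pair_event[of "ts ! i" "ts ! i" "\<lambda>x _. x = xs ! i"] by simp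
  qed
  then have "{\<omega> \<in> space P. \<forall>i\<in>{..<length ts}. X (ts ! i) \<omega> = xs ! i} \<in> events"
    by (intro sets.sets_Collect_finite_All) auto
  then show ?thesis unfolding cyl_def by (simp only: Ball_def lessThan_iff)
qed

text \<open>The Markov property at the last time of a cylinder, read off the finite-dimensional laws
  by splitting over the countably many values at time \<open>t\<close>. Only an upper bound is
  claimed, since \<open>B\<close> may also contain points that are not vertices.\<close>

lemma cyl_markov:
  assumes ts: "ts \<noteq> []" "length ts = length xs" "sorted (0 # ts @ [t])"
  shows "emeasure P (cyl ts xs \<inter> {\<omega> \<in> space P. X t \<omega> \<in> B}) \<le> emeasure P (cyl ts xs) * emeasure (measure_pmf (K (t - last ts) (last xs))) B"
proof -
  let ?V = "B \<inter> vertices \<epsilon> k"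
  have t: "t \<ge> 0" and st: "sorted (0 # ts)" using ts(3) by (auto simp: sorted_append)
  have xs: "xs \<noteq> []" using ts by auto
  have ev: "cyl (ts @ [t]) (xs @ [y]) \<in> events" for y by (rule cyl_events) (use ts(3) in simp)
  have split: "cyl (ts @ [t]) (xs @ [y]) = cyl ts xs \<inter> {\<omega> \<in> space P. X t \<omega> = y}" for y
    using ts(2) by (auto simp: cyl_def nth_append less_Suc_eq)
  have "cyl ts xs \<inter> {\<omega> \<in> space P. X t \<omega> \<in> B} = (\<Union>y\<in>?V. cyl (ts @ [t]) (xs @ [y]))"
    unfolding split using X_vertex[OF t] by auto
  then have "emeasure P (cyl ts xs \<inter> {\<omega> \<in> space P. X t \<omega> \<in> B}) = emeasure P (\<Union>y\<in>?V. cyl (ts @ [t]) (xs @ [y]))" by simp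
  also have "\<dots> = (\<integral>\<^sup>+y. emeasure P (cyl (ts @ [t]) (xs @ [y])) \<partial>count_space ?V)"
  proof (rule emeasure_UN_countable)
    show "countable ?V" by (rule countable_subset[OF _ countable_vertices]) auto
    show "disjoint_family_on (\<lambda>y. cyl (ts @ [t]) (xs @ [y])) ?V"
      unfolding disjoint_family_on_def split by auto
  qed (rule ev)
  also have "\<dots> = (\<integral>\<^sup>+y. emeasure P (cyl ts xs) * ennreal (pmf (K (t - last ts) (last xs)) y) \<partial>count_space ?V)"
  proof (rule nn_integral_cong)
    fix y
    have "prob (cyl (ts @ [t]) (xs @ [y])) = path_prob K 0 Star (zip (ts @ [t]) (xs @ [y]))"
      unfolding cyl_def using fdd[of "ts @ [t]" "xs @ [y]"] ts by simp
    also have "\<dots> = path_prob K 0 Star (zip ts xs) * pmf (K (t - last ts) (last xs)) y"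
      using ts xs by (simp add: path_prob_snoc last_zip)
    also have "path_prob K 0 Star (zip ts xs) = prob (cyl ts xs)"
      unfolding cyl_def using fdd[of ts xs] ts(2) st by simp
    finally show "emeasure P (cyl (ts @ [t]) (xs @ [y])) = emeasure P (cyl ts xs) * ennreal (pmf (K (t - last ts) (last xs)) y)"
      by (simp add: emeasure_eq_measure ennreal_mult)
  qed
  also have "\<dots> = emeasure P (cyl ts xs) * emeasure (measure_pmf (K (t - last ts) (last xs))) ?V"
    by (simp add: nn_integral_cmult nn_integral_pmf)
  also have "\<dots> \<le> emeasure P (cyl ts xs) * emeasure (measure_pmf (K (t - last ts) (last xs))) B"
    by (intro mult_left_mono emeasure_mono) auto
  finally show ?thesis .
qed

text \<open>An event \<open>\<Phi>\<close> of the values up to \<open>\<tau> j\<close> is a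
  countable disjoint union of cylinders, so a bound that holds for every present state survives
  averaging over the past.\<close>

lemma markov_bound:
  fixes \<tau> :: "nat \<Rightarrow> real" and \<Phi> :: "point list \<Rightarrow> bool"
  assumes \<tau>: "mono \<tau>" "\<tau> 0 \<ge> 0" and t: "\<tau> j \<le> t" and \<alpha>: "\<alpha> \<ge> 0"
    and bound: "\<And>x. x \<in> vertices \<epsilon> k \<Longrightarrow> measure (measure_pmf (K (t - \<tau> j) x)) {y. \<Psi> x y} \<le> \<alpha>"
  defines "D \<equiv> {\<omega> \<in> space P. \<Phi> (map (\<lambda>i. X (\<tau> i) \<omega>) [0..<Suc j])}"
  shows "D \<in> events" "prob (D \<inter> {\<omega> \<in> space P. \<Psi> (X (\<tau> j) \<omega>) (X t \<omega>)}) \<le> \<alpha> * prob D"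
proof -
  let ?ts = "map \<tau> [0..<Suc j]"
  let ?I = "{xs \<in> lists (vertices \<epsilon> k). length xs = Suc j \<and> \<Phi> xs}"
  have \<tau>0: "\<tau> i \<ge> 0" for i by (rule order_trans[OF \<tau>(2) monoD[OF \<tau>(1) le0]])
  have len: "length ?ts = Suc j" by simp
  have sorted: "sorted (0 # ?ts)" "sorted (0 # ?ts @ [t])"
  proof -
    have "sorted ?ts" using \<tau>(1) by (simp add: sorted_iff_nth_mono_less mono_def nth_append del: upt_Suc)
    moreover have "\<forall>s\<in>set ?ts. 0 \<le> s \<and> s \<le> t"
    proof (intro ballI conjI)
      fix s assume "s \<in> set ?ts"
      then obtain i where i: "i \<le> j" "s = \<tau> i" by (auto simp: less_Suc_eq_le simp del: upt_Suc)
      show "0 \<le> s" using \<tau>0 i by simp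
      show "s \<le> t" using monoD[OF \<tau>(1) i(1)] t i(2) by simp
    qed
    ultimately show "sorted (0 # ?ts)" "sorted (0 # ?ts @ [t])"
      using \<tau>0[of 0] t \<tau>0[of j] by (auto simp: sorted_append simp del: upt_Suc)
  qed
  have last_ts: "last ?ts = \<tau> j" by simp
  have I: "countable ?I" by (rule countable_subset[OF _ countable_lists[OF countable_vertices]]) auto
  have nth: "?ts ! i = \<tau> i" if "i < Suc j" for i using that by (simp del: upt_Suc)
  have cyl_iff: "\<omega> \<in> cyl ?ts xs \<longleftrightarrow> \<omega> \<in> space P \<and> xs = map (\<lambda>i. X (\<tau> i) \<omega>) [0..<Suc j]" if "length xs = Suc j" for xs \<omega>
    using that nth by (auto simp: cyl_def list_eq_iff_nth_eq simp del: upt_Suc)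
  have D: "D = (\<Union>xs\<in>?I. cyl ?ts xs)"
  proof (intro equalityI subsetI)
    fix \<omega> assume w: "\<omega> \<in> D"
    then have "map (\<lambda>i. X (\<tau> i) \<omega>) [0..<Suc j] \<in> ?I" using X_vertex \<tau>0 by (auto simp: D_def simp del: upt_Suc)
    moreover have "\<omega> \<in> cyl ?ts (map (\<lambda>i. X (\<tau> i) \<omega>) [0..<Suc j])" using w by (subst cyl_iff) (auto simp: D_def)
    ultimately show "\<omega> \<in> (\<Union>xs\<in>?I. cyl ?ts xs)" by blast
  next
    fix \<omega> assume "\<omega> \<in> (\<Union>xs\<in>?I. cyl ?ts xs)"
    then obtain xs where "xs \<in> ?I" "\<omega> \<in> cyl ?ts xs" by blast
    then show "\<omega> \<in> D" using cyl_iff[of xs \<omega>] by (auto simp: D_def simp del: upt_Suc)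
  qed
  have ev: "cyl ?ts xs \<in> events" for xs by (rule cyl_events[OF sorted(1)])
  show Dev: "D \<in> events" unfolding D by (intro sets.countable_UN'[OF I] image_subsetI ev)
  have disj: "disjoint_family_on (cyl ?ts) ?I"
    unfolding disjoint_family_on_def using cyl_iff by (auto simp del: upt_Suc)
  let ?R = "{\<omega> \<in> space P. \<Psi> (X (\<tau> j) \<omega>) (X t \<omega>)}"
  have t0: "t \<ge> 0" using \<tau>0[of j] t by simp
  have R: "?R \<in> events" by (rule X_pair_event[OF \<tau>0 t0])
  have "emeasure P (D \<inter> ?R) = emeasure P (\<Union>xs\<in>?I. cyl ?ts xs \<inter> ?R)" unfolding D by (rule arg_cong[where f = "emeasure P"]) blast
  also have "\<dots> = (\<integral>\<^sup>+xs. emeasure P (cyl ?ts xs \<inter> ?R) \<partial>count_space ?I)"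
    using ev R disj by (intro emeasure_UN_countable I) (auto simp: disjoint_family_on_def)
  also have "\<dots> \<le> (\<integral>\<^sup>+xs. ennreal \<alpha> * emeasure P (cyl ?ts xs) \<partial>count_space ?I)"
  proof (rule nn_integral_mono)
    fix xs assume "xs \<in> space (count_space ?I)"
    then have xs: "xs \<in> lists (vertices \<epsilon> k)" "length xs = Suc j" by auto
    have lV: "last xs \<in> vertices \<epsilon> k" using xs by (metis in_lists_conv_set last_in_set length_0_conv nat.simps(3))
    have "last xs = xs ! j" using xs(2) by (metis diff_Suc_1 last_conv_nth length_0_conv nat.simps(3))
    then have "cyl ?ts xs \<inter> ?R \<subseteq> cyl ?ts xs \<inter> {\<omega> \<in> space P. X t \<omega> \<in> {y. \<Psi> (last xs) y}}"
      unfolding cyl_def using nth[of j] by (auto simp del: upt_Suc)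
    then have "emeasure P (cyl ?ts xs \<inter> ?R) \<le> emeasure P (cyl ?ts xs \<inter> {\<omega> \<in> space P. X t \<omega> \<in> {y. \<Psi> (last xs) y}})"
      using X_pair_event[OF t0 t0, of "\<lambda>y _. \<Psi> (last xs) y"] ev by (intro emeasure_mono) auto
    also have "\<dots> \<le> emeasure P (cyl ?ts xs) * emeasure (measure_pmf (K (t - last ?ts) (last xs))) {y. \<Psi> (last xs) y}"
      by (rule cyl_markov) (use sorted xs in auto)
    also have "\<dots> \<le> emeasure P (cyl ?ts xs) * ennreal \<alpha>"
      unfolding last_ts using bound[OF lV] \<alpha>
      by (intro mult_left_mono) (auto simp: measure_pmf.emeasure_eq_measure ennreal_leI)
    finally show "emeasure P (cyl ?ts xs \<inter> ?R) \<le> ennreal \<alpha> * emeasure P (cyl ?ts xs)" by (simp add: mult.commute)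
  qed
  also have "\<dots> = ennreal \<alpha> * (\<integral>\<^sup>+xs. emeasure P (cyl ?ts xs) \<partial>count_space ?I)" by (rule nn_integral_cmult) simp
  also have "(\<integral>\<^sup>+xs. emeasure P (cyl ?ts xs) \<partial>count_space ?I) = emeasure P D"
    unfolding D by (rule emeasure_UN_countable[OF ev I disj, symmetric])
  finally have "ennreal (prob (D \<inter> ?R)) \<le> ennreal (\<alpha> * prob D)"
    using \<alpha> by (simp only: emeasure_eq_measure ennreal_mult measure_nonneg)
  then show "prob (D \<inter> ?R) \<le> \<alpha> * prob D"
    using \<alpha> by (simp only: ennreal_le_iff mult_nonneg_nonneg measure_nonneg)
qed

text \<open>Let \<open>j\<close> be the first index at which the walk is more than
  \<open>2 * \<eta>\<close> from its start. Then either the walk ends at least \<open>\<eta>\<close>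
  from the start, or it moves by at least \<open>\<eta>\<close> after \<open>j\<close>. Each
  alternative has probability at most \<open>\<alpha>\<close>, the second by the Markov property at
  \<open>j\<close>.\<close>

lemma Ottaviani_grid:
  fixes \<tau> :: "nat \<Rightarrow> real"
  assumes \<tau>: "mono \<tau>" "\<tau> 0 \<ge> 0" and \<alpha>: "\<alpha> \<ge> 0"
    and bound: "\<And>x j. j \<le> N \<Longrightarrow> x \<in> vertices \<epsilon> k \<Longrightarrow> measure (measure_pmf (K (\<tau> N - \<tau> j) x)) {y. rho \<epsilon> x y \<ge> \<eta>} \<le> \<alpha>"
  shows "prob {\<omega> \<in> space P. \<exists>j\<le>N. rho \<epsilon> (X (\<tau> 0) \<omega>) (X (\<tau> j) \<omega>) > 2 * \<eta>} \<le> 2 * \<alpha>"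
proof -
  interpret E: Metric_space "E_space \<epsilon>" "rho \<epsilon>" by (rule Metric_space_E)
  have \<tau>0: "\<tau> i \<ge> 0" for i by (rule order_trans[OF \<tau>(2) monoD[OF \<tau>(1) le0]])
  have XE: "X (\<tau> i) \<omega> \<in> E_space \<epsilon>" if "\<omega> \<in> space P" for i \<omega>
    using X_vertex[OF \<tau>0 that] vertices_subset_E_space by blast
  \<comment> \<open>First passage at \<open>j\<close>, written as a condition on the list of
    observed values to match \<open>\<Phi>\<close> in \<open>markov_bound\<close>.\<close>
  define A where "A j = {\<omega> \<in> space P. (\<lambda>xs. rho \<epsilon> (xs ! 0) (xs ! j) > 2 * \<eta> \<and> (\<forall>i<j. rho \<epsilon> (xs ! 0) (xs ! i) \<le> 2 * \<eta>))
    (map (\<lambda>i. X (\<tau> i) \<omega>) [0..<Suc j])}" for j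
  have A_iff: "\<omega> \<in> A j \<longleftrightarrow> \<omega> \<in> space P \<and> rho \<epsilon> (X (\<tau> 0) \<omega>) (X (\<tau> j) \<omega>) > 2 * \<eta> \<and>
      (\<forall>i<j. rho \<epsilon> (X (\<tau> 0) \<omega>) (X (\<tau> i) \<omega>) \<le> 2 * \<eta>)" for j \<omega>
    by (auto simp: A_def simp del: upt_Suc)
  let ?R = "\<lambda>j. {\<omega> \<in> space P. rho \<epsilon> (X (\<tau> j) \<omega>) (X (\<tau> N) \<omega>) \<ge> \<eta>}"
  let ?M = "{\<omega> \<in> space P. \<exists>j\<le>N. rho \<epsilon> (X (\<tau> 0) \<omega>) (X (\<tau> j) \<omega>) > 2 * \<eta>}"
  have \<tau>N: "\<tau> j \<le> \<tau> N" if "j \<le> N" for j using \<tau>(1) that by (simp add: monoD)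
  have Aev: "A j \<in> events" and AR: "prob (A j \<inter> ?R j) \<le> \<alpha> * prob (A j)" if "j \<le> N" for j
    unfolding A_def by (rule markov_bound[OF \<tau> \<tau>N[OF that] \<alpha> bound[OF that]]; assumption)+
  \<comment> \<open>With the trivial condition \<open>markov_bound\<close> estimates the
    displacement over the whole grid.\<close>
  have "prob ({\<omega> \<in> space P. (\<lambda>_. True) (map (\<lambda>i. X (\<tau> i) \<omega>) [0..<Suc 0])} \<inter> ?R 0) \<le>
      \<alpha> * prob {\<omega> \<in> space P. (\<lambda>_. True) (map (\<lambda>i. X (\<tau> i) \<omega>) [0..<Suc 0])}"
    by (rule markov_bound(2)[OF \<tau> \<tau>N[OF le0] \<alpha> bound[OF le0]])
  moreover have "space P \<inter> ?R 0 = ?R 0" by blast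
  ultimately have R0: "prob (?R 0) \<le> \<alpha>" by (simp add: prob_space)
  have M: "?M = (\<Union>j\<le>N. A j)"
  proof (intro equalityI subsetI)
    fix \<omega> assume "\<omega> \<in> ?M"
    then obtain j where j: "\<omega> \<in> space P" "j \<le> N" "rho \<epsilon> (X (\<tau> 0) \<omega>) (X (\<tau> j) \<omega>) > 2 * \<eta>" by blast
    define l where "l = (LEAST j. rho \<epsilon> (X (\<tau> 0) \<omega>) (X (\<tau> j) \<omega>) > 2 * \<eta>)"
    have l: "rho \<epsilon> (X (\<tau> 0) \<omega>) (X (\<tau> l) \<omega>) > 2 * \<eta>" unfolding l_def by (rule LeastI[of _ j]) (rule j(3))
    have "l \<le> j" unfolding l_def by (rule Least_le) (rule j(3))
    moreover have "rho \<epsilon> (X (\<tau> 0) \<omega>) (X (\<tau> i) \<omega>) \<le> 2 * \<eta>" if "i < l" for i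
      using not_less_Least[of i "\<lambda>j. rho \<epsilon> (X (\<tau> 0) \<omega>) (X (\<tau> j) \<omega>) > 2 * \<eta>"] that unfolding l_def by linarith
    ultimately show "\<omega> \<in> (\<Union>j\<le>N. A j)" using j l by (intro UN_I[of l]) (auto simp: A_iff)
  qed (auto simp: A_iff)
  have Mev: "?M \<in> events" unfolding M using Aev by auto
  have disj: "disjoint_family_on A {..N}"
    unfolding disjoint_family_on_def
  proof (intro ballI impI)
    fix i j :: nat assume "i \<noteq> j"
    have "A i \<inter> A j = {}" if "i < j" for i j using that by (fastforce simp: A_iff)
    from this[of i j] this[of j i] \<open>i \<noteq> j\<close> show "A i \<inter> A j = {}" by (auto simp: neq_iff)
  qed
  have "?M \<subseteq> ?R 0 \<union> (\<Union>j\<le>N. A j \<inter> ?R j)"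
  proof
    fix \<omega> assume "\<omega> \<in> ?M"
    then obtain j where j: "j \<le> N" "\<omega> \<in> A j" unfolding M by blast
    show "\<omega> \<in> ?R 0 \<union> (\<Union>j\<le>N. A j \<inter> ?R j)"
    proof (rule ccontr)
      assume "\<not> ?thesis"
      then have w: "\<omega> \<in> space P" "rho \<epsilon> (X (\<tau> 0) \<omega>) (X (\<tau> N) \<omega>) < \<eta>" "rho \<epsilon> (X (\<tau> j) \<omega>) (X (\<tau> N) \<omega>) < \<eta>"
        using j by (auto simp: A_iff)
      have "rho \<epsilon> (X (\<tau> 0) \<omega>) (X (\<tau> j) \<omega>) \<le> rho \<epsilon> (X (\<tau> 0) \<omega>) (X (\<tau> N) \<omega>) + rho \<epsilon> (X (\<tau> N) \<omega>) (X (\<tau> j) \<omega>)"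
        by (intro E.triangle XE w)
      then show False using w j(2) E.commute[of "X (\<tau> N) \<omega>" "X (\<tau> j) \<omega>"] by (simp add: A_iff)
    qed
  qed
  moreover have Rev: "?R j \<in> events" for j by (rule X_pair_event[OF \<tau>0 \<tau>0])
  ultimately have "prob ?M \<le> prob (?R 0 \<union> (\<Union>j\<le>N. A j \<inter> ?R j))"
    using Aev by (intro finite_measure_mono sets.Un sets.finite_UN sets.Int) auto
  also have "\<dots> \<le> prob (?R 0) + prob (\<Union>j\<le>N. A j \<inter> ?R j)"
    using Aev Rev by (intro measure_Un_le sets.finite_UN sets.Int) auto
  also have "prob (\<Union>j\<le>N. A j \<inter> ?R j) \<le> (\<Sum>j\<le>N. prob (A j \<inter> ?R j))"
    using Aev Rev by (intro finite_measure_subadditive_finite) auto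
  also have "\<dots> \<le> (\<Sum>j\<le>N. \<alpha> * prob (A j))" using AR by (intro sum_mono) auto
  also have "\<dots> = \<alpha> * prob ?M"
    unfolding M using finite_measure_finite_Union[of "{..N}" A] Aev disj by (simp add: sum_distrib_left image_subset_iff)
  also have "\<dots> \<le> \<alpha> * 1" using \<alpha> by (intro mult_left_mono prob_le_1)
  finally show ?thesis using R0 by simp
qed

text \<open>The bound of \<open>Ottaviani_grid\<close> does not depend on the number of grid points.
  As dyadic grids are nested, it passes to the increasing union of the exceptional events, and
  right-continuity carries it to all times.\<close>

lemma interval_maximal:
  assumes a: "0 \<le> a" and \<delta>: "0 < \<delta>" and C: "C \<ge> 0"
    and cadlag: "\<And>\<omega>. \<omega> \<in> space P \<Longrightarrow>
      restrict (\<lambda>t. X t \<omega>) {0..a + \<delta>} \<in> Metric_space.cadlag_paths (E_space \<epsilon>) (rho \<epsilon>) (a + \<delta>)"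
    and bound: "\<And>x t. x \<in> vertices \<epsilon> k \<Longrightarrow> t \<ge> 0 \<Longrightarrow> measure (measure_pmf (K t x)) {y. rho \<epsilon> x y \<ge> \<eta>} \<le> C * t\<^sup>2"
  obtains B where "B \<in> events" "prob B \<le> 2 * (C * \<delta>\<^sup>2)"
    "\<And>\<omega> t. \<omega> \<in> space P - B \<Longrightarrow> t \<in> {a..a + \<delta>} \<Longrightarrow> rho \<epsilon> (X a \<omega>) (X t \<omega>) \<le> 2 * \<eta>"
proof -
  interpret E: Metric_space "E_space \<epsilon>" "rho \<epsilon>" by (rule Metric_space_E)
  define \<tau> where "\<tau> n j = a + real j * \<delta> / 2 ^ n" for n j :: nat
  define B where "B n = {\<omega> \<in> space P. \<exists>j\<le>2 ^ n. rho \<epsilon> (X (\<tau> n 0) \<omega>) (X (\<tau> n j) \<omega>) > 2 * \<eta>}" for n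
  have \<tau>a: "\<tau> n 0 = a" for n by (simp add: \<tau>_def)
  have \<tau>_mono: "mono (\<tau> n)" for n
    unfolding mono_def \<tau>_def using \<delta> by (auto intro!: divide_right_mono mult_right_mono)
  have \<tau>0: "\<tau> n j \<ge> 0" for n j using a \<delta> by (simp add: \<tau>_def)
  have Bev: "B n \<in> events" for n
  proof -
    have "B n = (\<Union>j\<le>2 ^ n. {\<omega> \<in> space P. rho \<epsilon> (X (\<tau> n 0) \<omega>) (X (\<tau> n j) \<omega>) > 2 * \<eta>})" by (auto simp: B_def)
    also have "\<dots> \<in> events" using \<tau>0 X_pair_event by (intro sets.finite_UN) auto
    finally show ?thesis .
  qed
  have PB: "prob (B n) \<le> 2 * (C * \<delta>\<^sup>2)" for n
    unfolding B_def
  proof (rule Ottaviani_grid[OF \<tau>_mono \<tau>0])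
    show "0 \<le> C * \<delta>\<^sup>2" using C by simp
    fix x and j :: nat assume j: "j \<le> 2 ^ n" and x: "x \<in> vertices \<epsilon> k"
    have l: "\<tau> n (2 ^ n) = a + \<delta>" by (simp add: \<tau>_def)
    have d: "0 \<le> \<tau> n (2 ^ n) - \<tau> n j" "\<tau> n (2 ^ n) - \<tau> n j \<le> \<delta>"
      using monoD[OF \<tau>_mono j, of n] monoD[OF \<tau>_mono le0, of n j] unfolding l by (auto simp: \<tau>a)
    have "measure (measure_pmf (K (\<tau> n (2 ^ n) - \<tau> n j) x)) {y. rho \<epsilon> x y \<ge> \<eta>} \<le> C * (\<tau> n (2 ^ n) - \<tau> n j)\<^sup>2"
      by (rule bound[OF x d(1)])
    also have "\<dots> \<le> C * \<delta>\<^sup>2" using d C by (intro mult_left_mono power_mono) auto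
    finally show "measure (measure_pmf (K (\<tau> n (2 ^ n) - \<tau> n j) x)) {y. rho \<epsilon> x y \<ge> \<eta>} \<le> C * \<delta>\<^sup>2" .
  qed
  have "incseq B"
  proof (rule incseq_SucI, rule subsetI)
    fix n \<omega> assume "\<omega> \<in> B n"
    then obtain j where j: "\<omega> \<in> space P" "j \<le> 2 ^ n" "rho \<epsilon> (X a \<omega>) (X (\<tau> n j) \<omega>) > 2 * \<eta>" by (auto simp: B_def \<tau>a)
    have "\<tau> (Suc n) (2 * j) = \<tau> n j" by (simp add: \<tau>_def field_simps)
    then show "\<omega> \<in> B (Suc n)" using j by (auto simp: B_def \<tau>a intro!: exI[of _ "2 * j"])
  qed
  then have "(\<lambda>n. prob (B n)) \<longlonglongrightarrow> prob (\<Union>n. B n)" using Bev by (intro finite_Lim_measure_incseq) auto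
  then have "prob (\<Union>n. B n) \<le> 2 * (C * \<delta>\<^sup>2)" by (rule LIMSEQ_le_const2) (use PB in auto)
  moreover have "(\<Union>n. B n) \<in> events" using Bev by auto
  moreover have "rho \<epsilon> (X a \<omega>) (X t \<omega>) \<le> 2 * \<eta>" if w: "\<omega> \<in> space P - (\<Union>n. B n)" and t: "t \<in> {a..a + \<delta>}" for \<omega> t
  proof -
    have grid: "rho \<epsilon> (X a \<omega>) (X (\<tau> n j) \<omega>) \<le> 2 * \<eta>" if "j \<le> 2 ^ n" for n j
      using w that by (force simp: B_def \<tau>a)
    have XE: "X s \<omega> \<in> E_space \<epsilon>" if "s \<ge> 0" for s
      using X_vertex[OF that] w vertices_subset_E_space by blast
    show ?thesis
    proof (cases "t = a + \<delta>")
      \<comment> \<open>Right-continuity is of no use at the right end, but that is itself a grid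
        point.\<close>
      case True
      have "\<tau> 0 1 = a + \<delta>" by (simp add: \<tau>_def)
      then show ?thesis using grid[of 1 0] True by simp
    next
      case False
      then have t: "a \<le> t" "t < a + \<delta>" using t by auto
      show ?thesis
      proof (rule ccontr)
        assume "\<not> ?thesis"
        then have gap: "rho \<epsilon> (X a \<omega>) (X t \<omega>) - 2 * \<eta> > 0" by simp
        have "limitin E.mtopology (restrict (\<lambda>t. X t \<omega>) {0..a + \<delta>}) (restrict (\<lambda>t. X t \<omega>) {0..a + \<delta>} t) (at_right t)"
          using cadlag[of \<omega>] w t a unfolding E.cadlag_paths_def by (simp del: restrict_apply)
        then have "\<forall>\<^sub>F s in at_right t. restrict (\<lambda>t. X t \<omega>) {0..a + \<delta>} s \<in> E_space \<epsilon> \<and>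
            rho \<epsilon> (restrict (\<lambda>t. X t \<omega>) {0..a + \<delta>} s) (restrict (\<lambda>t. X t \<omega>) {0..a + \<delta>} t) < rho \<epsilon> (X a \<omega>) (X t \<omega>) - 2 * \<eta>"
          using gap unfolding E.limitin_metric by blast
        then have "\<forall>\<^sub>F s in at_right t. rho \<epsilon> (restrict (\<lambda>t. X t \<omega>) {0..a + \<delta>} s) (X t \<omega>) < rho \<epsilon> (X a \<omega>) (X t \<omega>) - 2 * \<eta>"
          by (rule eventually_mono) (use t a in simp)
        then obtain b where b: "b > t" "\<And>s. t < s \<Longrightarrow> s < b \<Longrightarrow>
            rho \<epsilon> (restrict (\<lambda>t. X t \<omega>) {0..a + \<delta>} s) (X t \<omega>) < rho \<epsilon> (X a \<omega>) (X t \<omega>) - 2 * \<eta>"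
          unfolding eventually_at_right_field by blast
        define c where "c = min b (a + \<delta>)"
        have c: "c > t" using b t by (simp add: c_def)
        obtain n where n: "(1/2::real) ^ n < (c - t) / \<delta>" using real_arch_pow_inv[of "(c - t) / \<delta>" "1/2"] c \<delta> by auto
        \<comment> \<open>The first grid index strictly to the right of \<open>t\<close>; by the
          choice of \<open>n\<close> its time is still below \<open>c\<close>.\<close>
        define j where "j = nat (\<lfloor>(t - a) * 2 ^ n / \<delta>\<rfloor> + 1)"
        have "0 \<le> (t - a) * 2 ^ n / \<delta>" using t \<delta> by simp
        then have "real j = of_int \<lfloor>(t - a) * 2 ^ n / \<delta>\<rfloor> + 1" by (simp add: j_def)
        then have j: "(t - a) * 2 ^ n / \<delta> < real j" "real j \<le> (t - a) * 2 ^ n / \<delta> + 1" by linarith+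
        have lo: "t < \<tau> n j" using j(1) \<delta> by (simp add: \<tau>_def field_simps)
        have "real j * \<delta> / 2 ^ n \<le> ((t - a) * 2 ^ n / \<delta> + 1) * \<delta> / 2 ^ n"
          using j(2) \<delta> by (intro divide_right_mono mult_right_mono) auto
        also have "\<dots> = (t - a) + \<delta> * (1/2) ^ n" using \<delta> by (simp add: field_simps power_one_over)
        also have "\<dots> < (t - a) + (c - t)" using n \<delta> by (simp add: pos_less_divide_eq mult.commute)
        finally have hi: "\<tau> n j < c" by (simp add: \<tau>_def)
        have "real j * \<delta> / 2 ^ n < \<delta>" using hi by (simp add: \<tau>_def c_def)
        then have "real j < 2 ^ n" using \<delta> by (simp add: divide_less_eq)
        then have "j \<le> 2 ^ n" by (metis less_imp_le of_nat_less_numeral_power_cancel_iff)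
        then have "rho \<epsilon> (X a \<omega>) (X (\<tau> n j) \<omega>) \<le> 2 * \<eta>" by (rule grid)
        moreover have "rho \<epsilon> (X (\<tau> n j) \<omega>) (X t \<omega>) < rho \<epsilon> (X a \<omega>) (X t \<omega>) - 2 * \<eta>"
          using b(2)[OF lo] hi lo t a by (simp add: c_def)
        moreover have "rho \<epsilon> (X a \<omega>) (X t \<omega>) \<le> rho \<epsilon> (X a \<omega>) (X (\<tau> n j) \<omega>) + rho \<epsilon> (X (\<tau> n j) \<omega>) (X t \<omega>)"
          using a t lo by (intro E.triangle XE) auto
        ultimately show False by linarith
      qed
    qed
  qed
  ultimately show ?thesis using that[of "\<Union>n. B n"] by blast
qed

text \<open>Each of \<open>m\<close> intervals fails with probability at most
  \<open>2 * C * (T / m)\<^sup>2\<close>, whence the total. Two times at most \<open>T / m\<close>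
  apart lie in the same or in adjacent intervals, so three displacements of at most
  \<open>2 * \<eta>\<close> connect them.\<close>

lemma modulus_event:
  assumes T: "0 < T" and m: "m > 0" and C: "C \<ge> 0" and K0: "K 0 Star = return_pmf Star"
    and cadlag: "\<And>\<omega> T. \<omega> \<in> space P \<Longrightarrow> T > 0 \<Longrightarrow>
      restrict (\<lambda>t. X t \<omega>) {0..T} \<in> Metric_space.cadlag_paths (E_space \<epsilon>) (rho \<epsilon>) T"
    and bound: "\<And>x t. x \<in> vertices \<epsilon> k \<Longrightarrow> t \<ge> 0 \<Longrightarrow> measure (measure_pmf (K t x)) {y. rho \<epsilon> x y \<ge> \<eta>} \<le> C * t\<^sup>2"
  shows "\<exists>A\<in>events. prob A \<ge> 1 - 2 * C * T\<^sup>2 / real m \<and>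
    (\<forall>\<omega>\<in>A. restrict (\<lambda>t. X t \<omega>) {0..T} 0 = Star \<and>
      Metric_space.modulus_le (rho \<epsilon>) T (restrict (\<lambda>t. X t \<omega>) {0..T}) (T / real m) (6 * \<eta>))"
proof -
  interpret E: Metric_space "E_space \<epsilon>" "rho \<epsilon>" by (rule Metric_space_E)
  define \<delta> where "\<delta> = T / real m"
  have \<delta>: "\<delta> > 0" "real m * \<delta> = T" using T m by (auto simp: \<delta>_def)
  have "\<exists>B. B \<in> events \<and> prob B \<le> 2 * (C * \<delta>\<^sup>2) \<and>
    (\<forall>\<omega>\<in>space P - B. \<forall>t\<in>{real i * \<delta>..real i * \<delta> + \<delta>}. rho \<epsilon> (X (real i * \<delta>) \<omega>) (X t \<omega>) \<le> 2 * \<eta>)" for i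
  proof -
    have i0: "0 \<le> real i * \<delta>" using \<delta> by simp
    have cd: "restrict (\<lambda>t. X t \<omega>) {0..real i * \<delta> + \<delta>} \<in> E.cadlag_paths (real i * \<delta> + \<delta>)"
      if "\<omega> \<in> space P" for \<omega>
      by (rule cadlag[OF that]) (use i0 \<delta>(1) in linarith)
    obtain B where "B \<in> events" "prob B \<le> 2 * (C * \<delta>\<^sup>2)"
      "\<And>\<omega> t. \<omega> \<in> space P - B \<Longrightarrow> t \<in> {real i * \<delta>..real i * \<delta> + \<delta>} \<Longrightarrow> rho \<epsilon> (X (real i * \<delta>) \<omega>) (X t \<omega>) \<le> 2 * \<eta>"
      by (rule interval_maximal[OF i0 \<delta>(1) C cd bound]) blast+
    then show ?thesis by blast
  qed
  then obtain B where B: "\<And>i. B i \<in> events" "\<And>i. prob (B i) \<le> 2 * (C * \<delta>\<^sup>2)"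
    "\<And>i \<omega> t. \<omega> \<in> space P - B i \<Longrightarrow> t \<in> {real i * \<delta>..real i * \<delta> + \<delta>} \<Longrightarrow> rho \<epsilon> (X (real i * \<delta>) \<omega>) (X t \<omega>) \<le> 2 * \<eta>"
    by metis
  define Z where "Z = {\<omega> \<in> space P. X 0 \<omega> = Star}"
  have Zev: "Z \<in> events" unfolding Z_def using X_pair_event[of 0 0 "\<lambda>x _. x = Star"] by simp
  have PZ: "prob Z = 1" using fdd[of "[0]" "[Star]"] by (simp add: Z_def K0)
  define U where "U = (\<Union>i<m. B i)"
  have Uev: "U \<in> events" unfolding U_def using B(1) by auto
  have "prob U \<le> (\<Sum>i<m. prob (B i))" unfolding U_def using B(1) by (intro finite_measure_subadditive_finite) auto
  also have "\<dots> \<le> (\<Sum>i<m. 2 * (C * \<delta>\<^sup>2))" by (intro sum_mono B(2))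
  also have "\<dots> = 2 * C * T\<^sup>2 / real m" using m by (simp add: \<delta>_def power2_eq_square)
  finally have PU: "prob U \<le> 2 * C * T\<^sup>2 / real m" .
  have "prob Z \<le> prob (Z - U) + prob U"
    using Zev Uev measure_Un_le[of "Z - U" P U] finite_measure_mono[of Z "(Z - U) \<union> U"] by auto
  then have "prob (Z - U) \<ge> 1 - 2 * C * T\<^sup>2 / real m" using PZ PU by simp
  moreover have "E.modulus_le T (restrict (\<lambda>t. X t \<omega>) {0..T}) \<delta> (6 * \<eta>)" if w: "\<omega> \<in> Z - U" for \<omega>
  proof -
    have wS: "\<omega> \<in> space P" using w by (simp add: Z_def)
    have XE: "X s \<omega> \<in> E_space \<epsilon>" if "s \<ge> 0" for s
      using X_vertex[OF that wS] vertices_subset_E_space by blast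
    have osc: "rho \<epsilon> (X (real i * \<delta>) \<omega>) (X t \<omega>) \<le> 2 * \<eta>" if "i < m" "t \<in> {real i * \<delta>..real i * \<delta> + \<delta>}" for i t
      using B(3)[of \<omega> i t] w that by (auto simp: U_def Z_def)
    have "rho \<epsilon> (X (real 0 * \<delta>) \<omega>) (X 0 \<omega>) \<le> 2 * \<eta>" by (rule osc[OF m]) (use \<delta>(1) in simp)
    then have \<eta>0: "0 \<le> 2 * \<eta>" using E.nonneg order_trans by blast
    have main: "rho \<epsilon> (X s \<omega>) (X t \<omega>) \<le> 6 * \<eta>" if st: "0 \<le> s" "s \<le> t" "t \<le> T" "t - s \<le> \<delta>" for s t
    proof (cases "s = T")
      \<comment> \<open>For \<open>s = T\<close> the index \<open>i\<close> below would be
        \<open>m\<close>, one too many; here \<open>t = T\<close> as well.\<close>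
      case True
      then show ?thesis using st XE[of T] \<eta>0 T by simp
    next
      case False
      define i where "i = nat \<lfloor>s / \<delta>\<rfloor>"
      have "0 \<le> s / \<delta>" using st \<delta> by simp
      then have i: "real i \<le> s / \<delta>" "s / \<delta> < real i + 1" by (auto simp: i_def)
      have si: "real i * \<delta> \<le> s" "s < real i * \<delta> + \<delta>" using i \<delta> by (auto simp: pos_le_divide_eq pos_divide_less_eq algebra_simps)
      have "real i * \<delta> < real m * \<delta>" using si False st \<delta>(2) by linarith
      then have im: "i < m" using \<delta>(1) by simp
      have i0: "0 \<le> real i * \<delta>" using \<delta> by simp
      have s: "rho \<epsilon> (X (real i * \<delta>) \<omega>) (X s \<omega>) \<le> 2 * \<eta>" using osc[OF im] si by simp
      have tri: "rho \<epsilon> (X s \<omega>) (X t \<omega>) \<le> rho \<epsilon> (X (real i * \<delta>) \<omega>) (X s \<omega>) + rho \<epsilon> (X (real i * \<delta>) \<omega>) (X t \<omega>)"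
        using E.triangle[of "X s \<omega>" "X (real i * \<delta>) \<omega>" "X t \<omega>"] XE st i0 by (simp add: E.commute)
      show ?thesis
      proof (cases "t \<le> real i * \<delta> + \<delta>")
        case True
        then have "rho \<epsilon> (X (real i * \<delta>) \<omega>) (X t \<omega>) \<le> 2 * \<eta>" using osc[OF im] si st by simp
        then show ?thesis using tri s \<eta>0 by linarith
      next
        case False
        have Si: "real (Suc i) * \<delta> = real i * \<delta> + \<delta>" by (simp add: algebra_simps)
        have "real (Suc i) * \<delta> < real m * \<delta>" using False st \<delta>(2) Si by linarith
        then have im': "Suc i < m" using \<delta>(1) by (simp only: mult_less_cancel_right_pos of_nat_less_iff)
        have 1: "rho \<epsilon> (X (real (Suc i) * \<delta>) \<omega>) (X t \<omega>) \<le> 2 * \<eta>"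
          by (rule osc[OF im']) (use False st si Si in auto)
        have 2: "rho \<epsilon> (X (real i * \<delta>) \<omega>) (X (real (Suc i) * \<delta>) \<omega>) \<le> 2 * \<eta>"
          by (rule osc[OF im]) (use \<delta> Si in auto)
        have "rho \<epsilon> (X (real i * \<delta>) \<omega>) (X t \<omega>) \<le> rho \<epsilon> (X (real i * \<delta>) \<omega>) (X (real (Suc i) * \<delta>) \<omega>) + rho \<epsilon> (X (real (Suc i) * \<delta>) \<omega>) (X t \<omega>)"
          using st i0 \<delta>(1) by (intro E.triangle XE) auto
        then show ?thesis using 1 2 tri s by linarith
      qed
    qed
    show ?thesis
      unfolding E.modulus_le_def
    proof (intro ballI impI)
      fix s t assume st: "s \<in> {0..T}" "t \<in> {0..T}" "\<bar>s - t\<bar> \<le> \<delta>"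
      show "rho \<epsilon> (restrict (\<lambda>t. X t \<omega>) {0..T} s) (restrict (\<lambda>t. X t \<omega>) {0..T} t) \<le> 6 * \<eta>"
        using st main[of s t] main[of t s] by (cases "s \<le> t") (auto simp: E.commute)
    qed
  qed
  moreover have "restrict (\<lambda>t. X t \<omega>) {0..T} 0 = Star" if "\<omega> \<in> Z - U" for \<omega>
    using that T by (simp add: Z_def)
  ultimately show ?thesis unfolding \<delta>_def using Zev Uev by (intro bexI[of _ "Z - U"]) auto
qed

end

theorem theorem4p8:
  fixes \<epsilon> T :: real
    and P :: "nat \<Rightarrow> 'w measure"
    and X :: "nat \<Rightarrow> real \<Rightarrow> 'w \<Rightarrow> point"
  assumes "0 < \<epsilon>" and "\<epsilon> < 1 / 64"
    and "\<And>k. k \<ge> 1 \<Longrightarrow> random_walk \<epsilon> k (P k) (X k)"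
    and "T > 0"
  shows "Metric_space.C_tight (E_space \<epsilon>) (rho \<epsilon>) T {1..} (\<lambda>k. path_law \<epsilon> T (P k) (X k))"
proof -
  interpret E: Metric_space "E_space \<epsilon>" "rho \<epsilon>" by (rule Metric_space_E)
  note e = assms(1) and T = assms(4)
  define Y where "Y k \<omega> = restrict (\<lambda>t. X k t \<omega>) {0..T}" for k \<omega>
  have rw: "prob_space (P k)" "t \<ge> 0 \<Longrightarrow> X k t \<in> measurable (P k) (count_space (vertices \<epsilon> k))"
    "\<omega> \<in> space (P k) \<Longrightarrow> S > 0 \<Longrightarrow> restrict (\<lambda>t. X k t \<omega>) {0..S} \<in> E.cadlag_paths S"
    if "k \<ge> 1" for k t \<omega> S
    using assms(3)[OF that] unfolding random_walk_def by blast+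
  have K: "\<exists>K. walk_semigroup \<epsilon> k K \<and> (\<forall>ts xs. length ts = length xs \<and> sorted (0 # ts) \<longrightarrow>
      measure (P k) {\<omega> \<in> space (P k). \<forall>i<length ts. X k (ts ! i) \<omega> = xs ! i} = path_prob K 0 Star (zip ts xs))"
    if "k \<ge> 1" for k
    using assms(3)[OF that] unfolding random_walk_def by blast
  have Yc: "Y k \<omega> \<in> E.cadlag_paths T" if "k \<ge> 1" "\<omega> \<in> space (P k)" for k \<omega>
    unfolding Y_def by (rule rw(3)[OF that T])
  have Ym: "(\<lambda>\<omega>. Y k \<omega> t) \<in> measurable (P k) (count_space (vertices \<epsilon> k))" if "k \<ge> 1" "t \<in> {0..T}" for k t
    using rw(2)[OF that(1), of t] that(2) by (simp add: Y_def)
  have "E.C_tight T {1..} (\<lambda>k. distr (P k) (borel_of (E.skorokhod_topology T)) (Y k))"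
  proof (rule E.C_tight_criterion[OF T E_space_proper, of Star])
    show "Star \<in> E_space \<epsilon>" by (simp add: E_space_def)
  next
    fix k :: nat assume k: "k \<ge> 1"
    show "prob_space (P k)" by (rule rw(1)[OF k])
    obtain r where r: "r > 0" "\<And>x y. x \<in> vertices \<epsilon> k \<Longrightarrow> y \<in> vertices \<epsilon> k \<Longrightarrow> x \<noteq> y \<Longrightarrow> r \<le> rho \<epsilon> x y"
      using vertices_separated[of \<epsilon> k] by blast
    show "Y k \<in> measurable (P k) (borel_of (E.skorokhod_topology T))"
      by (rule E.measurable_skorokhod[OF T countable_vertices vertices_subset_E_space r Yc[OF k] Ym[OF k]])
    fix d :: real assume d: "d > 0"
    show "\<exists>K. compactin (E.skorokhod_topology T) K \<and> measure (P k) (Y k -` K \<inter> space (P k)) \<ge> 1 - d"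
      by (rule E.discrete_law_tight[OF T countable_vertices vertices_subset_E_space r rw(1)[OF k] Yc[OF k] Ym[OF k] d])
  next
    fix \<eta> \<kappa> :: real assume \<eta>: "\<eta> > 0" and \<kappa>: "\<kappa> > 0"
    \<comment> \<open>The 6 undoes the factor in \<open>modulus_event\<close>. \<open>C\<close> is
      obtained before \<open>k\<close> is fixed, so \<open>m\<close>, and with it the scale
      \<open>T / m\<close>, is the same for all \<open>k\<close>.\<close>
    then have "\<eta> / 6 > 0" by simp
    from uniform_escape[OF e this] obtain C k0 where C: "C \<ge> 0" and esc: "\<And>k K x t. k \<ge> k0 \<Longrightarrow> walk_semigroup \<epsilon> k K \<Longrightarrow>
        x \<in> vertices \<epsilon> k \<Longrightarrow> t \<ge> 0 \<Longrightarrow> measure (measure_pmf (K t x)) {y. rho \<epsilon> x y \<ge> \<eta> / 6} \<le> C * t\<^sup>2"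
      by metis
    obtain m :: nat where m: "real m > 2 * C * T\<^sup>2 / \<kappa>" using reals_Archimedean2 by blast
    have "0 \<le> 2 * C * T\<^sup>2 / \<kappa>" using C \<kappa> by simp
    then have m0: "m > 0" using m by linarith
    have le: "2 * C * T\<^sup>2 / real m \<le> \<kappa>" using m m0 \<kappa> by (simp add: field_simps)
    have "\<exists>A\<in>sets (P k). measure (P k) A \<ge> 1 - \<kappa> \<and> (\<forall>\<omega>\<in>A. Y k \<omega> 0 = Star \<and> E.modulus_le T (Y k \<omega>) (T / real m) \<eta>)"
      if k: "k \<ge> k0" "k \<ge> 1" for k
    proof -
      obtain K where K: "walk_semigroup \<epsilon> k K" and fdd: "\<And>ts xs. length ts = length xs \<Longrightarrow> sorted (0 # ts) \<Longrightarrow>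
          measure (P k) {\<omega> \<in> space (P k). \<forall>i<length ts. X k (ts ! i) \<omega> = xs ! i} = path_prob K 0 Star (zip ts xs)"
        using K[OF k(2)] by blast
      have "\<exists>A\<in>sets (P k). measure (P k) A \<ge> 1 - 2 * C * T\<^sup>2 / real m \<and>
        (\<forall>\<omega>\<in>A. Y k \<omega> 0 = Star \<and> E.modulus_le T (Y k \<omega>) (T / real m) (6 * (\<eta> / 6)))"
        unfolding Y_def
        by (rule modulus_event[OF rw(1)[OF k(2)] rw(2)[OF k(2)] fdd T m0 C K_zero[OF K Star_vertex] rw(3)[OF k(2)] esc[OF k(1) K]])
      then obtain A where A: "A \<in> sets (P k)" "measure (P k) A \<ge> 1 - 2 * C * T\<^sup>2 / real m"
        "\<forall>\<omega>\<in>A. Y k \<omega> 0 = Star \<and> E.modulus_le T (Y k \<omega>) (T / real m) (6 * (\<eta> / 6))" by blast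
      have "6 * (\<eta> / 6) = \<eta>" by simp
      moreover have "measure (P k) A \<ge> 1 - \<kappa>" using A(2) le by linarith
      ultimately show ?thesis using A(1,3) by (intro bexI[of _ A]) auto
    qed
    moreover have "T / real m > 0" using T m0 by simp
    ultimately show "\<exists>\<delta>>0. \<exists>k0. \<forall>k\<ge>k0. k \<ge> 1 \<longrightarrow> (\<exists>A\<in>sets (P k). measure (P k) A \<ge> 1 - \<kappa> \<and>
        (\<forall>\<omega>\<in>A. Y k \<omega> 0 = Star \<and> E.modulus_le T (Y k \<omega>) \<delta> \<eta>))" by blast
  qed
  then show ?thesis unfolding path_law_def Y_def by simp
qed

end
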